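(* Let $$P_n(x_1,\dots,x_n;y)=\prod_{i=1}^n\bigl(1+\overline{y}\,x_i+a^{-1}x_i^2\bigr),$$ a symmetric polynomial in $x_1,\dots,x_n$ over $\mathcal{R}$, and write $P_n=P_n^++P_n^-$ as the sum of its parts of even and odd (total) monomial degree in the $x_i$. Let $\delta_n(y)=P_n^+(j_1^D,\dots,j_n^D;y)\in\mathcal{H}(D_n)\otimes_{\mathcal{A}}\mathcal{R}$. Let $(\mathrm{tr}^D_{n,y})_{n\ge2}$ be the unique $\mathcal{R}$-valued Markov trace on the algebras $\mathcal{H}(D_n)$ with constants $\rho=1+a$, $\mu=v-v^{-1}$, normalization $\mathrm{tr}^D_{n,y}(1)=(1+a)^n$, and $\mathrm{tr}^D_{2m,y}(U_1U_2\cdots U_{2m})=y^{2m}$ for all $m\ge1$. Then for every $n\ge 2$ one has $\mathrm{tr}^D_{n,y}=\mathrm{tr}_{\delta_n(y)}$, that is, $\mathrm{tr}^D_{n,y}(h)=\langle\delta_n(y),h\rangle$ for all $h\in\mathcal{H}(D_n)$.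
   Context: **Hecke algebra.** $\mathcal{A}=\mathbb{Q}(v)$ with involution $\overline{v}=v^{-1}$. For $n\ge2$, $\mathcal{H}(D_n)$ is the Iwahori-Hecke algebra of type $D_n$: the unital $\mathcal{A}$-algebra with generators $t_1,t_{1'},t_2,\dots,t_{n-1}$, the braid relations of the Coxeter diagram consisting of the path $1-2-\cdots-(n-1)$ together with a vertex $1'$ joined only to $2$ (for $n=2$: two commuting generators $t_1,t_{1'}$), and $(t-v)(t+v^{-1})=0$ for each generator $t$. For a reduced expression of $w\in W(D_n)$, $t_w$ is the corresponding product of generators; $\{t_w\}$ and $\{t_w^{-1}\}$ are $\mathcal{A}$-bases. $\iota:\mathcal{H}(D_{n-1})\to\mathcal{H}(D_n)$ is the embedding induced by inclusion of labels of generators. **Coefficients.** $\mathcal{R}$ is a field extension of the rational function field $\mathcal{A}(a)$ containing an element $y$ (e.g. $y$ an indeterminate), equipped with an involutive field automorphism $x\mapsto\overline{x}$ extending that of $\mathcal{A}$, with $\overline{a}=a^{-1}$. **Pairing.** The bar involution on $\mathcal{H}(D_n)$ is the $\mathbb{Q}$-algebra involution with $\overline{v}=v^{-1}$, $\overline{t_w}=t_{w^{-1}}^{-1}$; $i$ is the $\mathcal{A}$-linear anti-involution with $i(t_w)=t_{w^{-1}}$; $\tau(h)$ is the coefficient of $t_e^{-1}=1$ of $h$ in the basis $\{t_w^{-1}\}$. $\langle h,h'\rangle=\tau(i(\overline{h})h')$, extended to $\mathcal{H}(D_n)\otimes_{\mathcal{A}}\mathcal{R}$, antilinearly (with respect to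 the involution of $\mathcal{R}$) in the first argument and linearly in the second. $\mathrm{tr}_z(h):=\langle z,h\rangle$. **Elements.** $j_1^D=1$ and $j_i^D=t_{i-1}\cdots t_2t_{1'}t_1t_2\cdots t_{i-1}$ for $i\ge2$ (these commute with each other). $U_1=1$ and $U_n=t_{n-1}\cdots t_2\,t_{1'}\,t_1^{-1}t_2^{-1}\cdots t_{n-1}^{-1}$ for $n\ge2$. Elements of smaller algebras are regarded in larger ones via the embeddings. **Markov trace.** A family $(\phi_n)_{n\ge2}$ of $\mathcal{A}$-linear functionals $\phi_n:\mathcal{H}(D_n)\to\mathcal{R}$ is a Markov trace with constants $\rho,\mu\in\mathcal R$ if (M1) $\phi_n(hh')=\phi_n(h'h)$; and for $n\ge3$, $h\in\mathcal{H}(D_{n-1})$: (U1) $\phi_n(\iota(h))=\rho\,\phi_{n-1}(h)$; (M2) $\phi_n(\iota(h)t_{n-1})=\mu\,\phi_{n-1}(h)$. Existence and uniqueness of $(\mathrm{tr}^D_{n,y})$ with the listed properties is a theorem of Geck and Lambropoulou. *)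

theory Defs
  imports
    "HOL-Library.Poly_Mapping"
    "HOL-Computational_Algebra.Computational_Algebra"
    "HOL-Computational_Algebra.Field_as_Ring"
    "HOL-Algebra.QuotRing"
begin

section \<open>Coefficients\<close>

text \<open>The field \<open>\<rat>(v)\<close>.\<close>

type_synonym ratfun = "rat poly fract"

definition v_A :: ratfun where
  "v_A = to_fract [:0, 1:]"

text \<open>The involution \<open>v \<mapsto> v\<inverse>\<close>: a fraction \<open>p/q\<close> in lowest terms is sent to
  \<open>p(v\<inverse>)/q(v\<inverse>)\<close>.\<close>

definition eval_at_inv_v :: "rat poly \<Rightarrow> ratfun" where
  "eval_at_inv_v p = poly (map_poly (\<lambda>c. to_fract [:c:]) p) (inverse v_A)"

definition bar_A :: "ratfun \<Rightarrow> ratfun" where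
  "bar_A f = eval_at_inv_v (fst (quot_of_fract f)) / eval_at_inv_v (snd (quot_of_fract f))"

text \<open>The coefficient field is a whole type \<open>'r\<close>, made into an extension of \<open>\<rat>(v)(a)\<close> by a
  field homomorphism \<open>ext\<close>; it carries an involutive automorphism \<open>bar\<close>.\<close>

definition ext_A :: "(ratfun poly fract \<Rightarrow> 'r) \<Rightarrow> ratfun \<Rightarrow> 'r" where
  "ext_A ext f = ext (to_fract [:f:])"

definition ext_a :: "(ratfun poly fract \<Rightarrow> 'r) \<Rightarrow> 'r" where
  "ext_a ext = ext (to_fract [:0, 1:])"

definition coefficient_extension ::
  "(ratfun poly fract \<Rightarrow> 'r::field) \<Rightarrow> ('r \<Rightarrow> 'r) \<Rightarrow> bool" where
  "coefficient_extension ext bar \<longleftrightarrow>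
     ext 1 = 1 \<and> (\<forall>f g. ext (f + g) = ext f + ext g) \<and> (\<forall>f g. ext (f * g) = ext f * ext g) \<and>
     bar 1 = 1 \<and> (\<forall>x z. bar (x + z) = bar x + bar z) \<and> (\<forall>x z. bar (x * z) = bar x * bar z) \<and>
     (\<forall>x. bar (bar x) = x) \<and>
     (\<forall>f. bar (ext_A ext f) = ext_A ext (bar_A f)) \<and>
     bar (ext_a ext) = inverse (ext_a ext)"


section \<open>The Coxeter group of type \<open>D\<^sub>n\<close>\<close>

text \<open>The labels of the generators for \<open>D\<^sub>n\<close> are the natural numbers below \<open>n\<close>:
  \<open>0\<close> stands for \<open>1'\<close> and \<open>i \<ge> 1\<close> for \<open>i\<close>.\<close>

definition adjacent :: "nat \<Rightarrow> nat \<Rightarrow> bool" where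
  "adjacent s t \<longleftrightarrow>
     (1 \<le> s \<and> t = s + 1) \<or> (1 \<le> t \<and> s = t + 1) \<or> (s = 0 \<and> t = 2) \<or> (s = 2 \<and> t = 0)"

text \<open>The group is presented by involutions and braid relations; its elements are equivalence
  classes of words.\<close>

inductive coxeter_move :: "nat \<Rightarrow> nat list \<Rightarrow> nat list \<Rightarrow> bool" for n where
  square: "set x \<subseteq> {..<n} \<Longrightarrow> set z \<subseteq> {..<n} \<Longrightarrow> s < n \<Longrightarrow>
    coxeter_move n (x @ [s, s] @ z) (x @ z)"
| braid2: "set x \<subseteq> {..<n} \<Longrightarrow> set z \<subseteq> {..<n} \<Longrightarrow> s < n \<Longrightarrow> t < n \<Longrightarrow> s \<noteq> t \<Longrightarrow>
    \<not> adjacent s t \<Longrightarrow> coxeter_move n (x @ [s, t] @ z) (x @ [t, s] @ z)"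
| braid3: "set x \<subseteq> {..<n} \<Longrightarrow> set z \<subseteq> {..<n} \<Longrightarrow> s < n \<Longrightarrow> t < n \<Longrightarrow>
    adjacent s t \<Longrightarrow> coxeter_move n (x @ [s, t, s] @ z) (x @ [t, s, t] @ z)"

definition coxeter_rel :: "nat \<Rightarrow> (nat list \<times> nat list) set" where
  "coxeter_rel n = {(x, z). set x \<subseteq> {..<n} \<and> set z \<subseteq> {..<n} \<and> equivclp (coxeter_move n) x z}"

definition W_D :: "nat \<Rightarrow> nat list set set" where
  "W_D n = {x. set x \<subseteq> {..<n}} // coxeter_rel n"

definition W_e :: "nat \<Rightarrow> nat list set" where
  "W_e n = coxeter_rel n `` {[]}"

definition W_inv :: "nat list set \<Rightarrow> nat list set" where
  "W_inv w = rev ` w"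

definition reduced_word :: "nat list set \<Rightarrow> nat list" where
  "reduced_word w = arg_min length (\<lambda>x. x \<in> w)"


section \<open>The Hecke algebra of type \<open>D\<^sub>n\<close>\<close>

text \<open>Free algebras are monoid algebras of words. A wrapper type for words avoids
  fixing an additive structure on lists.\<close>

datatype word = Word (letters: "nat list")

instantiation word :: monoid_add
begin

definition zero_word :: word where
  "zero_word = Word []"

definition plus_word :: "word \<Rightarrow> word \<Rightarrow> word" where
  "plus_word x z = Word (letters x @ letters z)"

instance
  by standard (simp_all add: zero_word_def plus_word_def)

end

definition free_algebra :: "nat \<Rightarrow> (word \<Rightarrow>\<^sub>0 'k::field) ring" where
  "free_algebra n =
     \<lparr>carrier = {f. \<forall>x\<in>Poly_Mapping.keys f. set (letters x) \<subseteq> {..<n}},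
      mult = (*), one = 1, zero = 0, add = (+)\<rparr>"

definition gen_F :: "nat \<Rightarrow> (word \<Rightarrow>\<^sub>0 'k::field)" where
  "gen_F s = Poly_Mapping.single (Word [s]) 1"

definition const_F :: "'k \<Rightarrow> (word \<Rightarrow>\<^sub>0 'k::field)" where
  "const_F c = Poly_Mapping.single 0 c"

definition hecke_relators :: "'k::field \<Rightarrow> nat \<Rightarrow> (word \<Rightarrow>\<^sub>0 'k) set" where
  "hecke_relators q n =
     {(gen_F s - const_F q) * (gen_F s + const_F (inverse q)) | s. s < n} \<union>
     {gen_F s * gen_F t - gen_F t * gen_F s | s t. s < n \<and> t < n \<and> s \<noteq> t \<and> \<not> adjacent s t} \<union>
     {gen_F s * gen_F t * gen_F s - gen_F t * gen_F s * gen_F t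
        | s t. s < n \<and> t < n \<and> adjacent s t}"

definition hecke_ideal :: "'k::field \<Rightarrow> nat \<Rightarrow> (word \<Rightarrow>\<^sub>0 'k) set" where
  "hecke_ideal q n = Idl\<^bsub>free_algebra n\<^esub> (hecke_relators q n)"

text \<open>The algebra over an arbitrary field with parameter \<open>q\<close>. The algebra \<open>\<H>(D\<^sub>n)\<close> is the
  case \<open>q = v\<close> over \<open>\<rat>(v)\<close>. Its scalar extension to \<open>'r\<close> has the same presentation over
  \<open>'r\<close>, with \<open>q\<close> the image of \<open>v\<close>.\<close>

definition hecke :: "'k::field \<Rightarrow> nat \<Rightarrow> (word \<Rightarrow>\<^sub>0 'k) set ring" where
  "hecke q n = free_algebra n Quot hecke_ideal q n"

definition hecke_class :: "'k::field \<Rightarrow> nat \<Rightarrow> (word \<Rightarrow>\<^sub>0 'k) \<Rightarrow> (word \<Rightarrow>\<^sub>0 'k) set" where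
  "hecke_class q n f = hecke_ideal q n +>\<^bsub>free_algebra n\<^esub> f"

definition hecke_scale ::
  "'k::field \<Rightarrow> nat \<Rightarrow> 'k \<Rightarrow> (word \<Rightarrow>\<^sub>0 'k) set \<Rightarrow> (word \<Rightarrow>\<^sub>0 'k) set" where
  "hecke_scale q n c h = hecke_class q n (const_F c) \<otimes>\<^bsub>hecke q n\<^esub> h"

definition gen :: "'k::field \<Rightarrow> nat \<Rightarrow> nat \<Rightarrow> (word \<Rightarrow>\<^sub>0 'k) set" where
  "gen q n s = hecke_class q n (gen_F s)"

definition inv_gen :: "'k::field \<Rightarrow> nat \<Rightarrow> nat \<Rightarrow> (word \<Rightarrow>\<^sub>0 'k) set" where
  "inv_gen q n s = inv\<^bsub>hecke q n\<^esub> (gen q n s)"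

definition list_prod :: "('b, 'm) monoid_scheme \<Rightarrow> 'b list \<Rightarrow> 'b" where
  "list_prod G xs = foldr (\<lambda>x z. x \<otimes>\<^bsub>G\<^esub> z) xs \<one>\<^bsub>G\<^esub>"

definition T_basis :: "'k::field \<Rightarrow> nat \<Rightarrow> nat list set \<Rightarrow> (word \<Rightarrow>\<^sub>0 'k) set" where
  "T_basis q n w = list_prod (hecke q n) (map (gen q n) (reduced_word w))"

definition T_inv_basis :: "'k::field \<Rightarrow> nat \<Rightarrow> nat list set \<Rightarrow> (word \<Rightarrow>\<^sub>0 'k) set" where
  "T_inv_basis q n w = inv\<^bsub>hecke q n\<^esub> (T_basis q n w)"

definition hecke_comb ::
  "'k::field \<Rightarrow> nat \<Rightarrow> (nat list set \<Rightarrow> (word \<Rightarrow>\<^sub>0 'k) set) \<Rightarrow> (nat list set \<Rightarrow> 'k)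
    \<Rightarrow> (word \<Rightarrow>\<^sub>0 'k) set" where
  "hecke_comb q n B c = (\<Oplus>\<^bsub>hecke q n\<^esub> w\<in>W_D n. hecke_scale q n (c w) (B w))"

definition hecke_coords ::
  "'k::field \<Rightarrow> nat \<Rightarrow> (nat list set \<Rightarrow> (word \<Rightarrow>\<^sub>0 'k) set) \<Rightarrow> (word \<Rightarrow>\<^sub>0 'k) set
    \<Rightarrow> nat list set \<Rightarrow> 'k" where
  "hecke_coords q n B h = (THE c. (\<forall>w. w \<notin> W_D n \<longrightarrow> c w = 0) \<and> h = hecke_comb q n B c)"

text \<open>The map \<open>\<iota>\<close> induced by inclusion of labels, and scalar extension along a field
  homomorphism \<open>\<epsilon>\<close>. In both cases all representatives of a coset are sent to the same coset.\<close>

definition hecke_embed :: "'k::field \<Rightarrow> nat \<Rightarrow> (word \<Rightarrow>\<^sub>0 'k) set \<Rightarrow> (word \<Rightarrow>\<^sub>0 'k) set" where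
  "hecke_embed q n h = the_elem (hecke_class q n ` h)"

definition scalar_ext ::
  "('k::field \<Rightarrow> 'l::field) \<Rightarrow> 'k \<Rightarrow> nat \<Rightarrow> (word \<Rightarrow>\<^sub>0 'k) set \<Rightarrow> (word \<Rightarrow>\<^sub>0 'l) set" where
  "scalar_ext \<epsilon> q n h = the_elem ((\<lambda>f. hecke_class (\<epsilon> q) n (Poly_Mapping.map \<epsilon> f)) ` h)"


section \<open>The pairing\<close>

definition hecke_bar ::
  "('k \<Rightarrow> 'k) \<Rightarrow> 'k::field \<Rightarrow> nat \<Rightarrow> (word \<Rightarrow>\<^sub>0 'k) set \<Rightarrow> (word \<Rightarrow>\<^sub>0 'k) set" where
  "hecke_bar bar q n h =
     hecke_comb q n (\<lambda>w. T_inv_basis q n (W_inv w))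
       (\<lambda>w. bar (hecke_coords q n (T_basis q n) h w))"

definition hecke_anti :: "'k::field \<Rightarrow> nat \<Rightarrow> (word \<Rightarrow>\<^sub>0 'k) set \<Rightarrow> (word \<Rightarrow>\<^sub>0 'k) set" where
  "hecke_anti q n h =
     hecke_comb q n (\<lambda>w. T_basis q n (W_inv w)) (hecke_coords q n (T_basis q n) h)"

definition hecke_tau :: "'k::field \<Rightarrow> nat \<Rightarrow> (word \<Rightarrow>\<^sub>0 'k) set \<Rightarrow> 'k" where
  "hecke_tau q n h = hecke_coords q n (T_inv_basis q n) h (W_e n)"

text \<open>For \<open>bar\<close> an involution of the coefficient field sending \<open>q\<close> to \<open>q\<inverse>\<close>, the pairing is
  antilinear in the first and linear in the second argument. Over \<open>'r\<close> it is therefore the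
  sesquilinear extension of the pairing over \<open>\<rat>(v)\<close>, as both agree on the basis
  elements.\<close>

definition hecke_pairing ::
  "('k \<Rightarrow> 'k) \<Rightarrow> 'k::field \<Rightarrow> nat \<Rightarrow> (word \<Rightarrow>\<^sub>0 'k) set \<Rightarrow> (word \<Rightarrow>\<^sub>0 'k) set \<Rightarrow> 'k" where
  "hecke_pairing bar q n h h' =
     hecke_tau q n (hecke_anti q n (hecke_bar bar q n h) \<otimes>\<^bsub>hecke q n\<^esub> h')"

definition hecke_tr ::
  "('k \<Rightarrow> 'k) \<Rightarrow> 'k::field \<Rightarrow> nat \<Rightarrow> (word \<Rightarrow>\<^sub>0 'k) set \<Rightarrow> (word \<Rightarrow>\<^sub>0 'k) set \<Rightarrow> 'k" where
  "hecke_tr bar q n z = (\<lambda>h. hecke_pairing bar q n z h)"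


section \<open>Special elements\<close>

definition JM :: "'k::field \<Rightarrow> nat \<Rightarrow> nat \<Rightarrow> (word \<Rightarrow>\<^sub>0 'k) set" where
  "JM q n i =
     (if i \<le> 1 then \<one>\<^bsub>hecke q n\<^esub>
      else list_prod (hecke q n) (map (gen q n) (rev [2..<i] @ [0] @ [1..<i])))"

definition U_elt :: "'k::field \<Rightarrow> nat \<Rightarrow> nat \<Rightarrow> (word \<Rightarrow>\<^sub>0 'k) set" where
  "U_elt q n i =
     (if i \<le> 1 then \<one>\<^bsub>hecke q n\<^esub>
      else list_prod (hecke q n)
        (map (gen q n) (rev [2..<i] @ [0]) @ map (inv_gen q n) [1..<i]))"

definition U_prod :: "'k::field \<Rightarrow> nat \<Rightarrow> (word \<Rightarrow>\<^sub>0 'k) set" where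
  "U_prod q n = list_prod (hecke q n) (map (U_elt q n) [1..<n + 1])"

text \<open>Multivariate polynomials in \<open>x\<^sub>1, x\<^sub>2, \<dots>\<close> are finitely supported functions on
  exponent vectors.\<close>

type_synonym 'r mpoly = "(nat \<Rightarrow>\<^sub>0 nat) \<Rightarrow>\<^sub>0 'r"

definition mp_var :: "nat \<Rightarrow> 'r::field mpoly" where
  "mp_var i = Poly_Mapping.single (Poly_Mapping.single i 1) 1"

definition mp_const :: "'r \<Rightarrow> 'r::field mpoly" where
  "mp_const c = Poly_Mapping.single 0 c"

definition total_degree :: "(nat \<Rightarrow>\<^sub>0 nat) \<Rightarrow> nat" where
  "total_degree m = (\<Sum>i\<in>Poly_Mapping.keys m. Poly_Mapping.lookup m i)"

definition even_part :: "'r::field mpoly \<Rightarrow> 'r mpoly" where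
  "even_part p =
     (\<Sum>m\<in>{m\<in>Poly_Mapping.keys p. even (total_degree m)}.
        Poly_Mapping.single m (Poly_Mapping.lookup p m))"

definition P_poly :: "('r \<Rightarrow> 'r) \<Rightarrow> 'r \<Rightarrow> nat \<Rightarrow> 'r \<Rightarrow> 'r::field mpoly" where
  "P_poly bar a n y =
     (\<Prod>i\<in>{1..n}. 1 + mp_const (bar y) * mp_var i + mp_const (inverse a) * mp_var i ^ 2)"

text \<open>Evaluation at a family of \<open>n\<close> commuting elements.\<close>

definition mp_eval ::
  "'r::field \<Rightarrow> nat \<Rightarrow> (nat \<Rightarrow> (word \<Rightarrow>\<^sub>0 'r) set) \<Rightarrow> 'r mpoly \<Rightarrow> (word \<Rightarrow>\<^sub>0 'r) set" where
  "mp_eval q n \<xi> p =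
     (\<Oplus>\<^bsub>hecke q n\<^esub> m\<in>Poly_Mapping.keys p.
        hecke_scale q n (Poly_Mapping.lookup p m)
          (list_prod (hecke q n)
            (map (\<lambda>i. \<xi> i [^]\<^bsub>hecke q n\<^esub> Poly_Mapping.lookup m i) [1..<n + 1])))"

definition delta ::
  "('r \<Rightarrow> 'r) \<Rightarrow> 'r::field \<Rightarrow> 'r \<Rightarrow> nat \<Rightarrow> 'r \<Rightarrow> (word \<Rightarrow>\<^sub>0 'r) set" where
  "delta bar q a n y = mp_eval q n (JM q n) (even_part (P_poly bar a n y))"


section \<open>Markov traces\<close>

definition A_linear_functional ::
  "(ratfun \<Rightarrow> 'r::field) \<Rightarrow> nat \<Rightarrow> ((word \<Rightarrow>\<^sub>0 ratfun) set \<Rightarrow> 'r) \<Rightarrow> bool" where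
  "A_linear_functional \<epsilon> n \<phi> \<longleftrightarrow>
     (\<forall>h\<in>carrier (hecke v_A n). \<forall>h'\<in>carrier (hecke v_A n).
        \<phi> (h \<oplus>\<^bsub>hecke v_A n\<^esub> h') = \<phi> h + \<phi> h') \<and>
     (\<forall>c. \<forall>h\<in>carrier (hecke v_A n). \<phi> (hecke_scale v_A n c h) = \<epsilon> c * \<phi> h)"

definition markov_trace ::
  "(ratfun \<Rightarrow> 'r::field) \<Rightarrow> 'r \<Rightarrow> 'r \<Rightarrow> (nat \<Rightarrow> (word \<Rightarrow>\<^sub>0 ratfun) set \<Rightarrow> 'r) \<Rightarrow> bool" where
  "markov_trace \<epsilon> \<rho> \<mu> \<phi> \<longleftrightarrow>
     (\<forall>n\<ge>2. A_linear_functional \<epsilon> n (\<phi> n)) \<and>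
     (\<forall>n\<ge>2. \<forall>h\<in>carrier (hecke v_A n). \<forall>h'\<in>carrier (hecke v_A n).
        \<phi> n (h \<otimes>\<^bsub>hecke v_A n\<^esub> h') = \<phi> n (h' \<otimes>\<^bsub>hecke v_A n\<^esub> h)) \<and>
     (\<forall>n\<ge>3. \<forall>h\<in>carrier (hecke v_A (n - 1)).
        \<phi> n (hecke_embed v_A n h) = \<rho> * \<phi> (n - 1) h \<and>
        \<phi> n (hecke_embed v_A n h \<otimes>\<^bsub>hecke v_A n\<^esub> gen v_A n (n - 1)) = \<mu> * \<phi> (n - 1) h)"

end

theory Submission
  imports Defs
begin

text \<open>The algebra acts faithfully on the functions on the Coxeter group, and \<open>\<tau>\<close> reads off the
  value at the identity of the image of the delta function there. Together with the diagram
  automorphism \<open>S\<close>, which exchanges \<open>1'\<close> and \<open>1\<close>, the generators act as an algebra of type \<open>B\<close>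
  with trivial parameter at the end node. In it \<open>L\<^sub>n = t\<^sub>n\<^sub>-\<^sub>1 \<dots> t\<^sub>1 S t\<^sub>1 \<dots> t\<^sub>n\<^sub>-\<^sub>1\<close> commutes with the
  algebra \<open>B\<^sub>n\<^sub>-\<^sub>1\<close> one step below, and
  \<open>B\<^sub>n = B\<^sub>n\<^sub>-\<^sub>1 + B\<^sub>n\<^sub>-\<^sub>1 t\<^sub>n\<^sub>-\<^sub>1 B\<^sub>n\<^sub>-\<^sub>1 + B\<^sub>n\<^sub>-\<^sub>1 L\<^sub>n\<close>. Since \<open>U\<^sub>i\<close> agrees with \<open>S L\<^sub>i\<close> up to the first two
  summands, a trace on \<open>B\<^sub>n\<close> (restricted to even degree in \<open>S\<close>) that vanishes on these two and on
  \<open>U\<^sub>1 \<dots> U\<^sub>n\<close> is zero; this gives uniqueness. The other way round, \<open>\<delta>\<close> corresponds to the even part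
  of \<open>\<Prod>\<^sub>i (1 + y \<Lambda>\<^sub>i + a \<Lambda>\<^sub>i\<^sup>2)\<close> with \<open>\<Lambda>\<^sub>i = L\<^sub>i\<inverse>\<close>, and the same decomposition computes the conditional
  expectation of its last factor, hence the Markov constants of \<open>tr\<^sub>\<delta>\<close>.\<close>

section \<open>The Coxeter group on all labels\<close>

text \<open>One Coxeter group on all labels and one ring of operators \<open>lend\<close> serve
  every rank, so embeddings of algebras become inclusions, and \<open>S\<close>, which has no place
  in the algebra of type D, is simply another operator. The price is the comparison with the
  presented algebra in \<open>op_rep_kernel\<close>: it needs a spanning set, hence Matsumoto's
  theorem, and the finiteness of the group, which is in turn read off from the decomposition of B_n.
  The trace \<tau> refers to the basis of inverses, so \<open>u\<close> and \<open>Lam\<close>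
  rather than \<open>t\<close> and \<open>L\<close> span the part on which conditional expectations
  vanish. The constants have these sources: Lam_i^2 has expectation 1, which gives \<rho> = 1 + a; t
  = u + m gives \<mu> = m; and for M_i = S U_i the elements M_i, Lam_i M_i, Lam_i^2 M_i have
  expectations 0, 1, 0, so each U_i contributes one y. Two obstacles shape the details. The trace
  property is available on even elements only, so parities are tracked throughout and odd factors
  occur in pairs. And the Markov rule starts in rank three, so the values at t_1 and t_1' have to be
  recovered from there by conjugacy.\<close>

definition cox_move :: "nat list \<Rightarrow> nat list \<Rightarrow> bool" where
  "cox_move x z \<longleftrightarrow> (\<exists>n. coxeter_move n x z)"

lemma set_bounded: "\<exists>n. set (x :: nat list) \<subseteq> {..<n}"
  using finite_nat_iff_bounded by blast

lemma cox_moveI: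
  "cox_move (x @ [s, s] @ z) (x @ z)"
  "s \<noteq> t \<Longrightarrow> \<not> adjacent s t \<Longrightarrow> cox_move (x @ [s, t] @ z) (x @ [t, s] @ z)"
  "adjacent s t \<Longrightarrow> cox_move (x @ [s, t, s] @ z) (x @ [t, s, t] @ z)"
proof -
  obtain n where "set (x @ z @ [s, t]) \<subseteq> {..<n}"
    using set_bounded by blast
  hence n: "set x \<subseteq> {..<n}" "set z \<subseteq> {..<n}" "s < n" "t < n"
    by auto
  show "cox_move (x @ [s, s] @ z) (x @ z)"
    unfolding cox_move_def using coxeter_move.square[OF n(1,2,3)] by blast
  show "s \<noteq> t \<Longrightarrow> \<not> adjacent s t \<Longrightarrow> cox_move (x @ [s, t] @ z) (x @ [t, s] @ z)"
    unfolding cox_move_def using coxeter_move.braid2[OF n] by blast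
  show "adjacent s t \<Longrightarrow> cox_move (x @ [s, t, s] @ z) (x @ [t, s, t] @ z)"
    unfolding cox_move_def using coxeter_move.braid3[OF n] by blast
qed

lemma cox_move_cases:
  assumes "cox_move x z"
  obtains
    (square) a b s where "x = a @ [s, s] @ b" "z = a @ b"
  | (braid2) a b s t where "s \<noteq> t" "\<not> adjacent s t" "x = a @ [s, t] @ b" "z = a @ [t, s] @ b"
  | (braid3) a b s t where "adjacent s t" "x = a @ [s, t, s] @ b" "z = a @ [t, s, t] @ b"
proof -
  obtain n where "coxeter_move n x z"
    using assms by (auto simp: cox_move_def)
  thus thesis
    by (cases rule: coxeter_move.cases) (use that in blast)+
qed

abbreviation cox_eq :: "nat list \<Rightarrow> nat list \<Rightarrow> bool" where
  "cox_eq \<equiv> equivclp cox_move"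

lemma equivclp_map:
  assumes "equivclp r x z" and "\<And>x z. r x z \<Longrightarrow> equivclp r' (f x) (f z)"
  shows "equivclp r' (f x) (f z)"
  using assms(1)
proof (induction rule: equivclp_induct)
  case base
  show ?case by simp
next
  case (step y z)
  hence "equivclp r' (f y) (f z)"
    using assms(2) equivclp_sym by metis
  with step show ?case
    using equivclp_trans by metis
qed

lemma cox_eq_context: "cox_eq x z \<Longrightarrow> cox_eq (a @ x @ b) (a @ z @ b)"
proof (rule equivclp_map[where f = "\<lambda>x. a @ x @ b"])
  fix x z assume "cox_move x z"
  thus "cox_eq (a @ x @ b) (a @ z @ b)"
  proof (cases rule: cox_move_cases)
    case (square c d s)
    thus ?thesis
      using cox_moveI(1)[of "a @ c" s "d @ b"] by auto
  next
    case (braid2 c d s t)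
    thus ?thesis
      using cox_moveI(2)[of s t "a @ c" "d @ b"] by auto
  next
    case (braid3 c d s t)
    thus ?thesis
      using cox_moveI(3)[of s t "a @ c" "d @ b"] by auto
  qed
qed

lemma cox_eq_append: "cox_eq x z \<Longrightarrow> cox_eq x' z' \<Longrightarrow> cox_eq (x @ x') (z @ z')"
  using cox_eq_context[of x z "[]" x'] cox_eq_context[of x' z' z "[]"] equivclp_trans by fastforce

lemma adjacent_sym: "adjacent s t \<longleftrightarrow> adjacent t s"
  by (auto simp: adjacent_def)

lemma cox_eq_rev: "cox_eq x z \<Longrightarrow> cox_eq (rev x) (rev z)"
proof (rule equivclp_map[where f = rev])
  fix x z assume "cox_move x z"
  thus "cox_eq (rev x) (rev z)"
  proof (cases rule: cox_move_cases)
    case (square c d s)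
    thus ?thesis
      using cox_moveI(1)[of "rev d" s "rev c"] by auto
  next
    case (braid2 c d s t)
    thus ?thesis
      using cox_moveI(2)[of t s "rev d" "rev c"] adjacent_sym[of s t] by auto
  next
    case (braid3 c d s t)
    thus ?thesis
      using cox_moveI(3)[of s t "rev d" "rev c"] by auto
  qed
qed

lemma cox_eq_rev_append: "cox_eq (rev x @ x) []"
proof (induction x)
  case (Cons s x)
  have "cox_move (rev x @ [s, s] @ x) (rev x @ x)"
    by (rule cox_moveI)
  hence "cox_eq (rev (s # x) @ s # x) (rev x @ x)"
    by auto
  with Cons show ?case
    using equivclp_trans by metis
qed simp

quotient_type cox = "nat list" / cox_eq
  by (rule equivpI) (auto simp: reflp_def symp_def transp_def intro: equivclp_sym equivclp_trans)

lift_definition cw :: "nat list \<Rightarrow> cox" is "\<lambda>x. x" .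

lemma cw_eq_iff: "cw x = cw z \<longleftrightarrow> cox_eq x z"
  by transfer simp

lemma cw_surj: "\<exists>x. w = cw x"
  by transfer (metis equivclp_refl)

text \<open>Additive notation for a noncommutative group, which \<open>group_add\<close> permits.
  Inverses are reversed words, as the generators are involutions.\<close>

instantiation cox :: group_add
begin

lift_definition zero_cox :: cox is "[]" .
lift_definition plus_cox :: "cox \<Rightarrow> cox \<Rightarrow> cox" is "(@)"
  by (rule cox_eq_append)
lift_definition uminus_cox :: "cox \<Rightarrow> cox" is rev
  by (rule cox_eq_rev)
definition minus_cox :: "cox \<Rightarrow> cox \<Rightarrow> cox" where
  "minus_cox a b = a + - b"

instance
proof
  fix a b c :: cox
  show "a + b + c = a + (b + c)" by transfer simp
  show "0 + a = a" by transfer simp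
  show "a + 0 = a" by transfer simp
  show "- a + a = 0" by transfer (rule cox_eq_rev_append)
  show "a + - b = a - b" by (simp add: minus_cox_def)
qed

end

definition cg :: "nat \<Rightarrow> cox" where
  "cg s = cw [s]"

lemma cw_Nil [simp]: "cw [] = 0"
  by transfer simp

lemma cw_append: "cw (x @ z) = cw x + cw z"
  by transfer simp

lemma cw_rev: "cw (rev x) = - cw x"
  by transfer simp

lemma cw_Cons: "cw (s # x) = cg s + cw x"
  using cw_append[of "[s]" x] by (simp add: cg_def)

lemma cg_add_self [simp]: "cg s + cg s = 0"
  unfolding cg_def cw_append[symmetric] zero_cox_def
  using cox_moveI(1)[of "[]" s "[]"] by (simp add: cw.abs_eq cox.abs_eq_iff r_into_equivclp)

lemma cg_uminus [simp]: "- cg s = cg s"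
  using cg_add_self minus_unique by blast

lemma cg_cancel_left [simp]: "cg s + (cg s + w) = w"
  by (simp flip: add.assoc)

lemma cg_cancel_right [simp]: "w + cg s + cg s = w"
  by (simp add: add.assoc)

lemma cg_commute: "s \<noteq> t \<Longrightarrow> \<not> adjacent s t \<Longrightarrow> cg s + cg t = cg t + cg s"
  using cox_moveI(2)[of s t "[]" "[]"]
  by (simp add: cg_def cw_eq_iff r_into_equivclp flip: cw_append)

lemma cg_braid: "adjacent s t \<Longrightarrow> cg s + cg t + cg s = cg t + cg s + cg t"
  using cox_moveI(3)[of s t "[]" "[]"]
  by (simp add: cg_def cw_eq_iff r_into_equivclp flip: cw_append)

lemma cox_eq_invariant:
  assumes "cox_eq x z" and "\<And>x z. cox_move x z \<Longrightarrow> f x = f z"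
  shows "f x = f z"
  using assms(1) by (induction rule: equivclp_induct) (auto dest: assms(2))


section \<open>Signed permutations\<close>

text \<open>The realisation by signed permutations: \<open>b\<close> is a sign, and the label
  \<open>0\<close> acts as the reflection in e_1 + e_2. It serves to tell elements of
  \<open>cox\<close> apart.\<close>

definition sgn_act :: "nat \<Rightarrow> nat \<times> bool \<Rightarrow> nat \<times> bool" where
  "sgn_act s = (\<lambda>(k, b).
     if s = 0 then (if k = 1 then (2, \<not> b) else if k = 2 then (1, \<not> b) else (k, b))
     else (if k = s then s + 1 else if k = s + 1 then s else k, b))"

lemma sgn_act_involution: "sgn_act s (sgn_act s k) = k"
  by (auto simp: sgn_act_def split: prod.splits)

definition sgn_supp :: "nat \<Rightarrow> nat set" where
  "sgn_supp s = (if s = 0 then {1, 2} else {s, s + 1})"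

lemma sgn_act_in_supp: "fst k \<in> sgn_supp s \<Longrightarrow> fst (sgn_act s k) \<in> sgn_supp s"
  by (cases "s = 0") (auto simp: sgn_act_def sgn_supp_def split: prod.splits)

lemma sgn_act_notin_supp: "fst k \<notin> sgn_supp s \<Longrightarrow> sgn_act s k = k"
  by (cases "s = 0") (auto simp: sgn_act_def sgn_supp_def split: prod.splits)

lemma sgn_act_commute:
  assumes "s \<noteq> t" and "\<not> adjacent s t"
  shows "sgn_act s (sgn_act t k) = sgn_act t (sgn_act s k)"
proof -
  \<comment> \<open>Non-adjacent labels move disjoint sets of indices, except for the pair
    \<open>0\<close>, \<open>1\<close>, where both move 1 and 2 and commute by inspection.\<close>
  have "s = 0 \<and> t = 1 \<or> s = 1 \<and> t = 0 \<or>
      s = 0 \<and> 3 \<le> t \<or> t = 0 \<and> 3 \<le> s \<or> 1 \<le> s \<and> s + 2 \<le> t \<or> 1 \<le> t \<and> t + 2 \<le> s"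
    using assms unfolding adjacent_def by presburger
  moreover have ?thesis if "s = 0 \<and> 3 \<le> t \<or> t = 0 \<and> 3 \<le> s \<or> 1 \<le> s \<and> s + 2 \<le> t \<or> 1 \<le> t \<and> t + 2 \<le> s"
  proof -
    have "sgn_supp s \<inter> sgn_supp t = {}"
      using that by (auto simp: sgn_supp_def)
    thus ?thesis
      using sgn_act_in_supp[of k s] sgn_act_in_supp[of k t]
        sgn_act_notin_supp[of k s] sgn_act_notin_supp[of k t]
        sgn_act_notin_supp[of "sgn_act t k" s] sgn_act_notin_supp[of "sgn_act s k" t]
      by (cases "fst k \<in> sgn_supp s"; cases "fst k \<in> sgn_supp t") (auto simp: disjoint_iff)
  qed
  moreover have ?thesis if "s = 0 \<and> t = 1 \<or> s = 1 \<and> t = 0"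
    using that by (elim disjE conjE) (simp_all add: sgn_act_def split: prod.splits)
  ultimately show ?thesis
    by blast
qed

lemma sgn_act_braid:
  assumes "adjacent s t"
  shows "sgn_act s (sgn_act t (sgn_act s k)) = sgn_act t (sgn_act s (sgn_act t k))"
proof -
  have *: "sgn_act s (sgn_act t (sgn_act s (i, b))) = sgn_act t (sgn_act s (sgn_act t (i, b)))"
    if "1 \<le> s \<and> t = s + 1 \<or> s = 0 \<and> t = 2" for s t i b
  proof -
    consider "i = 1" | "i = 2" | "i = 3" | "i = s" | "i = s + 1" | "i = s + 2"
      | "i \<notin> {1, 2, 3, s, s + 1, s + 2}"
      by blast
    thus ?thesis
      using that by cases (auto simp: sgn_act_def)
  qed
  show ?thesis
    using assms *[of s t "fst k" "snd k"] *[of t s "fst k" "snd k"] by (auto simp: adjacent_def)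
qed

lift_definition act :: "cox \<Rightarrow> nat \<times> bool \<Rightarrow> nat \<times> bool" is "\<lambda>x. foldr sgn_act x"
proof -
  fix x z :: "nat list"
  assume "cox_eq x z"
  thus "foldr sgn_act x = foldr sgn_act z"
  proof (rule cox_eq_invariant)
    fix x z assume "cox_move x z"
    thus "foldr sgn_act x = foldr sgn_act z"
    proof (cases rule: cox_move_cases)
      case (square a b s)
      thus ?thesis
        by (simp add: fun_eq_iff sgn_act_involution)
    next
      case (braid2 a b s t)
      show ?thesis
        unfolding braid2(3,4) by (simp add: fun_eq_iff sgn_act_commute[OF braid2(1,2)])
    next
      case (braid3 a b s t)
      show ?thesis
        unfolding braid3(2,3) by (simp add: fun_eq_iff sgn_act_braid[OF braid3(1)])
    qed
  qed
qed

lemma act_add [simp]: "act (u + w) k = act u (act w k)"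
  by transfer simp

lemma act_zero [simp]: "act 0 k = k"
  by transfer simp

lemma act_cg [simp]: "act (cg s) k = sgn_act s k"
  unfolding cg_def by transfer simp

text \<open>The test for lying outside a parabolic subgroup. The bound on \<open>n\<close> is there
  because the label \<open>0\<close> moves the index 2.\<close>

lemma act_fixes_above: "set x \<subseteq> {..<n} \<Longrightarrow> 2 \<le> n \<Longrightarrow> k > n \<Longrightarrow> act (cw x) (k, b) = (k, b)"
  by (induction x) (auto simp: cw_Cons sgn_act_def)

lemma cg_neq:
  assumes "s \<noteq> t"
  shows "cg s \<noteq> cg t"
proof
  assume "cg s = cg t"
  hence "sgn_act s k = sgn_act t k" for k
    using act_cg by metis
  from this[of "(1, True)"] this[of "(s, True)"] this[of "(t, True)"] show False
    using assms by (auto simp: sgn_act_def split: if_splits)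
qed

lemma cg_not_commute:
  assumes "adjacent s t"
  shows "cg s + cg t \<noteq> cg t + cg s"
proof
  assume "cg s + cg t = cg t + cg s"
  hence "sgn_act s (sgn_act t k) = sgn_act t (sgn_act s k)" for k
    using act_cg act_add by metis
  from this[of "(s, True)"] this[of "(t, True)"] this[of "(3, True)"] show False
    using assms by (auto simp: sgn_act_def adjacent_def split: if_splits)
qed

lemma cg_neq_zero: "cg s \<noteq> 0"
proof
  assume "cg s = 0"
  hence "sgn_act s k = k" for k
    using act_cg act_zero by metis
  from this[of "(1, True)"] this[of "(s, True)"] show False
    by (auto simp: sgn_act_def split: if_splits)
qed

lemma cg_notin_parabolic:
  assumes "set x \<subseteq> {..<n}"
  shows "cg n \<noteq> cw x"
proof
  assume *: "cg n = cw x"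
  show False
  proof (cases "n \<ge> 2")
    case True
    hence "act (cw x) (n + 1, True) = (n + 1, True)"
      using act_fixes_above assms by simp
    thus False
      using True by (simp add: sgn_act_def flip: *)
  next
    \<comment> \<open>Below rank two the only possible label is \<open>0\<close>, so the subgroup
      has at most two elements.\<close>
    case False
    hence "set x \<subseteq> {0}"
      using assms by auto
    hence "cw x = 0 \<or> cw x = cg 0 \<and> n = 1"
      using assms False by (induction x) (auto simp: cw_Cons)
    thus False
      using * cg_neq cg_neq_zero by auto
  qed
qed

section \<open>Length and exchange\<close>

definition clen :: "cox \<Rightarrow> nat" where
  "clen w = (LEAST k. \<exists>x. w = cw x \<and> length x = k)"

lemma clen_le: "clen (cw x) \<le> length x"
  unfolding clen_def by (rule Least_le) blast

lemma clen_witness: obtains x where "w = cw x" "length x = clen w"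
proof -
  have "\<exists>k x. w = cw x \<and> length x = k"
    using cw_surj by blast
  hence "\<exists>x. w = cw x \<and> length x = clen w"
    unfolding clen_def by (rule LeastI_ex)
  thus thesis
    using that by blast
qed

lemma clen_add_le: "clen (u + w) \<le> clen u + clen w"
proof -
  obtain x z where "u = cw x" "length x = clen u" "w = cw z" "length z = clen w"
    using clen_witness by metis
  thus ?thesis
    using clen_le[of "x @ z"] by (simp add: cw_append)
qed

lemma clen_zero [simp]: "clen 0 = 0"
  using clen_le[of "[]"] by simp

lemma clen_eq_0_iff [simp]: "clen w = 0 \<longleftrightarrow> w = 0"
  by (metis clen_zero clen_witness cw_Nil length_0_conv)

lemma clen_cg [simp]: "clen (cg s) = 1"
proof -
  have "clen (cg s) \<le> 1"
    using clen_le[of "[s]"] by (simp add: cw_Cons)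
  moreover have "clen (cg s) \<noteq> 0"
    by (simp add: cg_neq_zero)
  ultimately show ?thesis
    by linarith
qed

lemma clen_uminus [simp]: "clen (- w) = clen w"
proof -
  have "clen (- w) \<le> clen w" for w
    using clen_witness[of w] clen_le cw_rev by (metis length_rev)
  from this[of w] this[of "- w"] show ?thesis
    by simp
qed

text \<open>The sign character. It excludes equal lengths of \<open>w\<close> and
  \<open>cg s + w\<close>, so the length changes by exactly one.\<close>

lift_definition cpar :: "cox \<Rightarrow> bool" is "\<lambda>x. even (length x)"
proof -
  fix x z assume "cox_eq x z"
  thus "even (length x) = even (length z)"
    by (rule cox_eq_invariant) (auto elim!: cox_move_cases)
qed

lemma cpar_clen: "cpar w \<longleftrightarrow> even (clen w)"
proof -
  obtain x where "w = cw x" "length x = clen w"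
    using clen_witness .
  thus ?thesis
    by (metis cpar.abs_eq cw.abs_eq)
qed

lemma cpar_cg_add: "cpar (cg s + w) \<longleftrightarrow> \<not> cpar w"
  unfolding cg_def by transfer simp

lemma clen_cg_add: "clen (cg s + w) = clen w + 1 \<or> clen w = clen (cg s + w) + 1"
proof -
  have "clen (cg s + w) \<le> clen w + 1" "clen w \<le> clen (cg s + w) + 1"
    using clen_add_le[of "cg s" w] clen_add_le[of "cg s" "cg s + w"] by simp_all
  moreover have "even (clen (cg s + w)) \<noteq> even (clen w)"
    using cpar_cg_add cpar_clen by blast
  ultimately show ?thesis
    by presburger
qed

lemma clen_add_cg: "clen (w + cg s) = clen w + 1 \<or> clen w = clen (w + cg s) + 1"
  using clen_cg_add[of s "- w"] clen_uminus[of "cg s + - w"]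
  by (simp only: minus_add cg_uminus minus_minus clen_uminus)

text \<open>The parity of the number of times a reflection occurs in the sequence attached to a word.\<close>

fun refl_parity :: "nat list \<Rightarrow> cox \<Rightarrow> bool" where
  "refl_parity [] r = False"
| "refl_parity (s # x) r = ((r = cg s) \<noteq> refl_parity x (cg s + r + cg s))"

lemma refl_parity_append:
  "refl_parity (x @ z) r = (refl_parity x r \<noteq> refl_parity z (- cw x + r + cw x))"
  by (induction x arbitrary: r) (auto simp: cw_Cons minus_add add.assoc)

lemma cg_conj_eq_iff: "cg s + r + cg s = u \<longleftrightarrow> r = cg s + u + cg s"
  by (metis add.assoc cg_cancel_left cg_cancel_right)

text \<open>A square move adds the same reflection twice, and a braid move lists the same
  reflections in another order. By \<open>refl_parity_append\<close> a block of a word matters only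
  through its own parity function and its group element, so the moves may be checked without
  context.\<close>

lemma refl_parity_cong: "cw x = cw z \<Longrightarrow> refl_parity x = refl_parity z"
proof -
  have ctx: "refl_parity (a @ x @ b) = refl_parity (a @ z @ b)"
    if "refl_parity x = refl_parity z" "cw x = cw z" for a b x z
    using that by (simp add: fun_eq_iff refl_parity_append)
  assume "cw x = cw z"
  hence "cox_eq x z"
    by (simp add: cw_eq_iff)
  thus ?thesis
  proof (rule cox_eq_invariant)
    fix x z assume "cox_move x z"
    thus "refl_parity x = refl_parity z"
    proof (cases rule: cox_move_cases)
      case (square a b s)
      have "refl_parity [s, s] = refl_parity []"
        by (auto simp: fun_eq_iff cg_conj_eq_iff)
      from ctx[OF this, of a b] show ?thesis
        by (simp add: square cw_Cons)
    next
      case (braid2 a b s t)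
      have "cg s + cg t + cg s = cg t"
        using cg_commute[OF braid2(1,2)] by (metis cg_cancel_right)
      moreover have "cg t + cg s + cg t = cg s"
        using cg_commute[OF braid2(1,2)] by (metis cg_cancel_right)
      ultimately have "refl_parity [s, t] = refl_parity [t, s]"
        by (auto simp: fun_eq_iff cg_conj_eq_iff)
      from ctx[OF this, of a b] show ?thesis
        using cg_commute[OF braid2(1,2)] by (simp add: braid2(3,4) cw_Cons)
    next
      case (braid3 a b s t)
      note b = cg_braid[OF braid3(1)]
      have 1: "cg s + (cg t + cg s + cg t) + cg s = cg t" "cg t + (cg s + cg t + cg s) + cg t = cg s"
        using b by (metis add.assoc cg_cancel_left cg_cancel_right)+
      have "(cg t + (cg s + r + cg s) + cg t = cg s) = (r = cg t)"
        "(cg s + (cg t + r + cg t) + cg s = cg t) = (r = cg s)" for r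
        using 1 by (metis cg_conj_eq_iff)+
      hence "refl_parity [s, t, s] r = refl_parity [t, s, t] r" for r
        using b cg_conj_eq_iff[of s r "cg t"] cg_conj_eq_iff[of t r "cg s"] by auto
      hence "refl_parity [s, t, s] = refl_parity [t, s, t]"
        by blast
      from ctx[OF this, of a b] show ?thesis
        using b by (simp add: braid3(2,3) cw_Cons add.assoc)
    qed
  qed
qed

text \<open>A reflection that is counted has the form \<open>p + cg s - p\<close>, where
  \<open>p\<close> is the element of the prefix before some letter \<open>s\<close>; multiplying by
  it removes that letter.\<close>

lemma refl_parity_deletion:
  "refl_parity x r \<Longrightarrow> \<exists>a s b. x = a @ s # b \<and> r + cw x = cw (a @ b)"
proof (induction x arbitrary: r)
  case (Cons s x)
  show ?case
  proof (cases "r = cg s")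
    case True
    hence "s # x = [] @ s # x \<and> r + cw (s # x) = cw ([] @ x)"
      by (simp add: cw_Cons)
    thus ?thesis
      by blast
  next
    case False
    hence "refl_parity x (cg s + r + cg s)"
      using Cons.prems by simp
    then obtain a t b where *: "x = a @ t # b" "cg s + r + cg s + cw x = cw (a @ b)"
      using Cons.IH by blast
    hence "r + cw (s # x) = cw ((s # a) @ b)"
      by (simp add: cw_Cons) (metis add.assoc cg_cancel_left)
    thus ?thesis
      using *(1) by (metis append_Cons)
  qed
qed simp

text \<open>Let \<open>z\<close> be a reduced word of the shortened element. An odd count of
  \<open>cg s\<close> in \<open>z\<close> would let a letter of \<open>z\<close> be deleted and make
  \<open>cw x\<close> shorter than \<open>z\<close>. So \<open>cg s\<close> has odd count in the
  word \<open>s # z\<close> of \<open>cw x\<close>, hence also in \<open>x\<close>, because the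
  count depends on the element only; then deletion applies.\<close>

lemma exchange:
  assumes "clen (cg s + cw x) < clen (cw x)"
  obtains a t b where "x = a @ t # b" "cg s + cw x = cw (a @ b)"
proof -
  obtain z where z: "cg s + cw x = cw z" "length z = clen (cg s + cw x)"
    using clen_witness by metis
  have xz: "cw x = cg s + cw z"
    using z(1) by (metis cg_cancel_left)
  have "\<not> refl_parity z (cg s)"
  proof
    assume "refl_parity z (cg s)"
    then obtain a t b where "z = a @ t # b" "cg s + cw z = cw (a @ b)"
      using refl_parity_deletion by blast
    hence "clen (cw x) \<le> length (a @ b)" "length (a @ b) < length z"
      using xz clen_le[of "a @ b"] by simp_all
    thus False
      using assms z(2) by linarith
  qed
  hence "refl_parity (s # z) (cg s)"
    by simp
  moreover have "cw (s # z) = cw x"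
    using xz by (simp add: cw_Cons)
  ultimately have "refl_parity x (cg s)"
    using refl_parity_cong by metis
  thus thesis
    using refl_parity_deletion that by blast
qed

lemma exchange_right:
  assumes "clen (cw x + cg s) < clen (cw x)"
  obtains a t b where "x = a @ t # b" "cw x + cg s = cw (a @ b)"
proof -
  have eq: "- (cw x + cg s) = cg s + cw (rev x)"
    by (simp add: cw_rev minus_add)
  have "clen (cg s + cw (rev x)) < clen (cw (rev x))"
    using assms unfolding eq[symmetric] by (simp add: cw_rev)
  then obtain a t b where *: "rev x = a @ t # b" "cg s + cw (rev x) = cw (a @ b)"
    using exchange by metis
  have "x = rev b @ t # rev a"
    using *(1) by (metis append.assoc append_Cons append_Nil rev_append rev_rev_ident rev.simps(2))
  moreover have "cw x + cg s = cw (rev b @ rev a)"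
    using *(2) eq by (metis cw_rev minus_minus rev_append)
  ultimately show thesis
    using that by blast
qed

text \<open>In the ascending case apply exchange with \<open>s\<close> to the word
  \<open>x @ [t]\<close> of \<open>w + cg t\<close>: deleting the final \<open>t\<close> gives the
  claim, and deleting a letter of \<open>x\<close> would make \<open>cg s + w\<close> shorter than
  \<open>w\<close>. The descending case is the ascending one for \<open>cg s + w\<close>. This is
  the fact that lets left and right operators commute in \<open>uop_rop_commute\<close>.\<close>

lemma clen_both_sides:
  assumes "clen (cg s + w + cg t) = clen w" and "clen (cg s + w) = clen (w + cg t)"
  shows "cg s + w = w + cg t"
proof -
  have main: "cg s + w = w + cg t"
    if "clen (cg s + w + cg t) = clen w" "clen (cg s + w) = clen w + 1" "clen (w + cg t) = clen w + 1"
    for w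
  proof -
    obtain x where x: "w = cw x" "length x = clen w"
      using clen_witness by metis
    have xt: "cw (x @ [t]) = w + cg t"
      by (simp add: cw_append cw_Cons x)
    have "clen (cg s + cw (x @ [t])) < clen (cw (x @ [t]))"
      using that xt by (simp add: add.assoc)
    then obtain a u b where ab: "x @ [t] = a @ u # b" "cg s + cw (x @ [t]) = cw (a @ b)"
      using exchange by metis
    show ?thesis
    proof (cases b rule: rev_cases)
      case Nil
      hence "cg s + w + cg t = w"
        using ab xt x by (simp add: add.assoc)
      thus ?thesis
        by (metis cg_cancel_right)
    next
      case (snoc b' v)
      hence "x = a @ u # b'" "v = t"
        using ab(1) by auto
      moreover have "cg s + w = cw (a @ b')"
        using ab(2) xt snoc \<open>v = t\<close> by (simp add: cw_append cw_Cons) (metis add.assoc add_right_cancel)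
      ultimately have "clen (cg s + w) < clen w"
        using clen_le[of "a @ b'"] x by simp
      thus ?thesis
        using that by simp
    qed
  qed
  from clen_cg_add[of s w] show ?thesis
  proof
    assume "clen (cg s + w) = clen w + 1"
    thus ?thesis
      using main assms by simp
  next
    assume *: "clen w = clen (cg s + w) + 1"
    have "cg s + (cg s + w) = cg s + w + cg t"
      by (rule main) (use * assms in simp_all)
    thus ?thesis
      by (metis add.assoc cg_cancel_left)
  qed
qed


section \<open>Reduced words\<close>

definition reduced :: "nat list \<Rightarrow> bool" where
  "reduced x \<longleftrightarrow> length x = clen (cw x)"

lemma reduced_ex: obtains x where "w = cw x" "reduced x"
  using clen_witness unfolding reduced_def by metis

lemma reduced_Cons: "reduced (s # x) \<longleftrightarrow> reduced x \<and> clen (cg s + cw x) = clen (cw x) + 1"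
proof -
  have "a + 1 = b \<longleftrightarrow> a = c \<and> b = c + 1" if "b = c + 1 \<or> c = b + 1" "c \<le> a" for a b c :: nat
    using that by linarith
  from this[OF clen_cg_add clen_le] show ?thesis
    by (simp add: reduced_def cw_Cons)
qed

lemma reduced_rev: "reduced (rev x) = reduced x"
  by (simp add: reduced_def cw_rev)

lemma reduced_Nil [simp]: "reduced []"
  by (simp add: reduced_def)

lemma reduced_eqI: "cw x = cw z \<Longrightarrow> length x = length z \<Longrightarrow> reduced x \<Longrightarrow> reduced z"
  by (simp add: reduced_def)

section \<open>The word property, and Coxeter groups of finite rank as subgroups\<close>

inductive braid_move :: "nat list \<Rightarrow> nat list \<Rightarrow> bool" where
  commute: "s \<noteq> t \<Longrightarrow> \<not> adjacent s t \<Longrightarrow> braid_move (a @ [s, t] @ b) (a @ [t, s] @ b)"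
| braid: "adjacent s t \<Longrightarrow> braid_move (a @ [s, t, s] @ b) (a @ [t, s, t] @ b)"

abbreviation braid_eq :: "nat list \<Rightarrow> nat list \<Rightarrow> bool" where
  "braid_eq \<equiv> equivclp braid_move"

lemma braid_eq_Cons: "braid_eq x z \<Longrightarrow> braid_eq (s # x) (s # z)"
proof (rule equivclp_map[where f = "\<lambda>x. s # x"])
  fix x z assume "braid_move x z"
  thus "braid_eq (s # x) (s # z)"
  proof cases
    case (commute u t a b)
    show ?thesis
      using braid_move.commute[OF commute(3,4), of "s # a" b] unfolding commute(1,2)
      by (simp add: r_into_equivclp)
  next
    case (braid u t a b)
    show ?thesis
      using braid_move.braid[OF braid(3), of "s # a" b] unfolding braid(1,2)
      by (simp add: r_into_equivclp)
  qed
qed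

text \<open>Matsumoto's theorem, in the form due to Tits.\<close>

lemma reduced_braid_eq: "cw x = cw z \<Longrightarrow> reduced x \<Longrightarrow> reduced z \<Longrightarrow> braid_eq x z"
proof (induction "length x" arbitrary: x z rule: less_induct)
  case less
  have len: "length z = length x"
    using less.prems by (simp add: reduced_def)
  show ?case
  proof (cases x)
    case Nil
    thus ?thesis
      using len by simp
  next
    case (Cons s x')
    then obtain t z' where z: "z = t # z'"
      using len by (cases z) auto
    have rx': "reduced x'" and rz': "reduced z'"
      using less.prems Cons z reduced_Cons by blast+
    \<comment> \<open>The induction hypothesis for words with a common first letter, which is then
      put back.\<close>
    have cancel: "braid_eq (u # a) (u # b)"
      if "cg u + cw a = cg u + cw b" "reduced (u # a)" "reduced (u # b)" "length a < length x" for u a b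
      using that less.hyps[of a b] braid_eq_Cons reduced_Cons by (metis add_left_cancel)
    have w: "cg s + cw x' = cg t + cw z'"
      using less.prems(1) by (simp add: Cons z cw_Cons)
    show ?thesis
    proof (cases "s = t")
      case True
      thus ?thesis
        using cancel[of s x' z'] less.prems w by (simp add: Cons z)
    next
      case False
      have cz': "cg t + cw x = cw z'"
        using w by (simp add: Cons cw_Cons)
      have "clen (cg t + cw x) < clen (cw x)"
        unfolding cz' using less.prems(2) rz' len z by (simp add: reduced_def)
      then obtain a u b where ab: "x = a @ u # b" "cg t + cw x = cw (a @ b)"
        using exchange by metis
      have "a \<noteq> []"
      proof
        assume "a = []"
        hence "cg t + cw x = cw x'"
          using ab Cons by simp
        hence "cg t + cg s = 0"
          using Cons cw_Cons by (metis add.assoc add_left_imp_eq add_right_imp_eq add.left_neutral)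
        hence "cg t = cg s"
          by (metis cg_add_self add_right_cancel)
        thus False
          using cg_neq False by metis
      qed
      then obtain a' where a: "a = s # a'"
        using ab(1) Cons by (cases a) auto
      \<comment> \<open>\<open>t # s # c\<close> is a further reduced word of the same element. It
        shares its first letter with \<open>z\<close>; the rest of the proof connects it with
        \<open>x\<close>.\<close>
      define c where "c = a' @ b"
      have lc: "length c + 1 = length x'"
        using ab(1) a Cons by (simp add: c_def)
      have wc: "cg t + cw x = cg s + cw c"
        using ab(2) a by (simp add: c_def cw_Cons)
      hence x_tsc: "cw x = cw (t # s # c)"
        by (simp add: cw_Cons) (metis cg_cancel_left)
      have r_tsc: "reduced (t # s # c)"
        by (rule reduced_eqI[OF x_tsc _ less.prems(2)]) (use lc Cons in simp)
      have z_tsc: "braid_eq (t # s # c) z"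
        unfolding z
        by (rule cancel) (use r_tsc less.prems z x_tsc lc Cons in \<open>auto simp: cw_Cons\<close>)
      show ?thesis
      proof (cases "adjacent s t")
        case False
        have comm: "cg s + cg t = cg t + cg s"
          using cg_commute[OF \<open>s \<noteq> t\<close> False] .
        have eq: "cw (s # t # c) = cw (t # s # c)"
          using comm by (simp add: cw_Cons flip: add.assoc)
        have r_stc: "reduced (s # t # c)"
          by (rule reduced_eqI[OF eq[symmetric] _ r_tsc]) simp
        have "braid_eq x (s # t # c)"
          unfolding Cons
          by (rule cancel) (use r_stc less.prems x_tsc eq Cons in \<open>auto simp: cw_Cons\<close>)
        moreover have "braid_move ([] @ [s, t] @ c) ([] @ [t, s] @ c)"
          by (rule braid_move.commute) fact+
        hence "braid_eq (s # t # c) (t # s # c)"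
          by auto
        ultimately show ?thesis
          using z_tsc equivclp_trans by metis
      next
        \<comment> \<open>Now \<open>s\<close> shortens \<open>t # s # c\<close> as well. The
          deleted letter lies in \<open>c\<close>, as the other two positions would force
          \<open>s = t\<close> or make the two generators commute. So the element has reduced words
          beginning with \<open>s, t, s\<close> and with \<open>t, s, t\<close>.\<close>
        case True
        have "cg s + cw (t # s # c) = cw x'"
          using x_tsc Cons by (metis cg_cancel_left cw_Cons)
        moreover have "clen (cw x') < clen (cw (t # s # c))"
          using rx' less.prems(2) Cons x_tsc by (simp add: reduced_def)
        ultimately have "clen (cg s + cw (t # s # c)) < clen (cw (t # s # c))"
          by simp
        then obtain a u b where ab: "t # s # c = a @ u # b" "cg s + cw (t # s # c) = cw (a @ b)"
          using exchange by metis
        consider "a = []" | "a = [t]" | a' where "a = t # s # a'" "c = a' @ u # b"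
        proof (cases a)
          case (Cons v a2)
          thus ?thesis
            using ab(1) that by (cases a2) auto
        qed (use that in blast)
        then obtain a' where a: "a = t # s # a'" "c = a' @ u # b"
        proof cases
          case 1
          hence "cg s + cg t + cw (s # c) = cw (s # c)"
            using ab by (simp add: cw_Cons add.assoc)
          hence "cg s + cg t = 0"
            by (metis add_right_cancel add.left_neutral)
          hence "cg s = cg t"
            by (metis cg_add_self add_right_cancel)
          thus ?thesis
            using cg_neq \<open>s \<noteq> t\<close> by metis
        next
          case 2
          hence "cg s + (cg t + (cg s + cw c)) = cg t + cw c"
            using ab by (simp add: cw_Cons)
          hence "cg s + cg t + cg s = cg t"
            by (simp flip: add.assoc)
          hence "cg s + cg t = cg t + cg s"
            by (metis cg_cancel_right)
          thus ?thesis
            using cg_not_commute[OF True] by simp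
        next
          case 3
          thus ?thesis
            using that by blast
        qed
        define d where "d = a' @ b"
        have ld: "length d + 1 = length c"
          using a by (simp add: d_def)
        have wd: "cg s + cw (t # s # c) = cw (t # s # d)"
          using ab(2) a by (simp add: d_def)
        hence x_stsd: "cw x = cw (s # t # s # d)"
          using x_tsc by (metis cg_cancel_left cw_Cons)
        have x_tstd: "cw x = cw (t # s # t # d)"
          using cg_braid[OF True] unfolding x_stsd by (simp add: cw_Cons flip: add.assoc)
        have r_stsd: "reduced (s # t # s # d)"
          by (rule reduced_eqI[OF x_stsd _ less.prems(2)]) (use lc ld Cons in simp)
        have r_tstd: "reduced (t # s # t # d)"
          by (rule reduced_eqI[OF x_tstd _ less.prems(2)]) (use lc ld Cons in simp)
        have "braid_eq x (s # t # s # d)"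
          unfolding Cons
          by (rule cancel) (use r_stsd less.prems x_stsd Cons in \<open>auto simp: cw_Cons\<close>)
        moreover have "braid_move ([] @ [s, t, s] @ d) ([] @ [t, s, t] @ d)"
          by (rule braid_move.braid) fact
        hence "braid_eq (s # t # s # d) (t # s # t # d)"
          by auto
        moreover have "braid_eq (t # s # t # d) z"
          unfolding z
          by (rule cancel) (use r_tstd less.prems z x_tstd lc ld Cons in \<open>auto simp: cw_Cons\<close>)
        ultimately show ?thesis
          using equivclp_trans by metis
      qed
    qed
  qed
qed

lemma equivclp_restrict:
  assumes "equivclp r x z" and "P x"
    and "\<And>x z. r x z \<Longrightarrow> P x \<longleftrightarrow> P z" and "\<And>x z. r x z \<Longrightarrow> P x \<Longrightarrow> r' x z"
  shows "equivclp r' x z \<and> P z"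
  using assms(1)
proof (induction rule: equivclp_induct)
  case (step y z)
  hence "equivclp r' y z \<and> P z"
    using assms(3,4) by (metis equivclp_sym r_into_equivclp)
  with step show ?case
    using equivclp_trans by metis
qed (simp add: assms(2))

text \<open>Braid moves preserve the set of letters, so Matsumoto's theorem never leaves the labels
  below \<open>n\<close>.\<close>

lemma braid_eq_coxeter_eq:
  assumes "braid_eq x z" and "set x \<subseteq> {..<n}"
  shows "equivclp (coxeter_move n) x z \<and> set z \<subseteq> {..<n}"
proof (rule equivclp_restrict[where P = "\<lambda>x. set x \<subseteq> {..<n}", OF assms])
  fix x z assume "braid_move x z"
  thus "set x \<subseteq> {..<n} \<longleftrightarrow> set z \<subseteq> {..<n}"
    by cases auto
next
  fix x z assume "braid_move x z" "set x \<subseteq> {..<n}"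
  thus "coxeter_move n x z"
    by cases (auto simp: coxeter_move.braid2[simplified] coxeter_move.braid3[simplified])
qed

lemma coxeter_eq_Cons:
  assumes "equivclp (coxeter_move n) x z" and "s < n"
  shows "equivclp (coxeter_move n) (s # x) (s # z)"
proof (rule equivclp_map[OF assms(1), where f = "\<lambda>x. s # x"])
  fix x z assume "coxeter_move n x z"
  thus "equivclp (coxeter_move n) (s # x) (s # z)"
  proof cases
    case (square a b t)
    thus ?thesis
      using coxeter_move.square[of "s # a" n b t] assms(2) by (simp add: r_into_equivclp)
  next
    case (braid2 a b u t)
    thus ?thesis
      using coxeter_move.braid2[of "s # a" n b u t] assms(2) by (simp add: r_into_equivclp)
  next
    case (braid3 a b u t)
    thus ?thesis
      using coxeter_move.braid3[of "s # a" n b u t] assms(2) by (simp add: r_into_equivclp)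
  qed
qed

text \<open>Words are shortened inside the labels below \<open>n\<close>: if \<open>s # z\<close> is
  not reduced, exchange and Matsumoto's theorem turn \<open>z\<close> into a word starting with
  \<open>s\<close>, and one square move cancels the pair.\<close>

lemma coxeter_eq_reduced:
  "set x \<subseteq> {..<n} \<Longrightarrow> \<exists>z. reduced z \<and> set z \<subseteq> {..<n} \<and> equivclp (coxeter_move n) x z"
proof (induction x)
  case (Cons s x)
  then obtain z where z: "reduced z" "set z \<subseteq> {..<n}" "equivclp (coxeter_move n) x z"
    by auto
  have s: "s < n"
    using Cons.prems by simp
  have sxz: "equivclp (coxeter_move n) (s # x) (s # z)"
    by (rule coxeter_eq_Cons) fact+
  show ?case
  proof (cases "reduced (s # z)")
    case True
    thus ?thesis
      using sxz z s by (intro exI[of _ "s # z"]) simp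
  next
    case False
    hence "clen (cg s + cw z) < clen (cw z)"
      using clen_cg_add[of s "cw z"] z(1) reduced_Cons by auto
    then obtain a t b where ab: "z = a @ t # b" "cg s + cw z = cw (a @ b)"
      using exchange by metis
    hence "cw z = cw (s # a @ b)"
      by (metis cg_cancel_left cw_Cons)
    moreover have r: "reduced (s # a @ b)"
      by (rule reduced_eqI[OF calculation _ z(1)]) (simp add: ab(1))
    ultimately have "equivclp (coxeter_move n) z (s # a @ b)"
      using braid_eq_coxeter_eq reduced_braid_eq z(1,2) by blast
    hence "equivclp (coxeter_move n) (s # z) (s # s # a @ b)"
      using coxeter_eq_Cons s by blast
    moreover have "coxeter_move n ([] @ [s, s] @ a @ b) ([] @ a @ b)"
      by (rule coxeter_move.square) (use z(2) s ab(1) in auto)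
    hence "equivclp (coxeter_move n) (s # s # a @ b) (a @ b)"
      by (simp add: r_into_equivclp)
    ultimately have "equivclp (coxeter_move n) (s # x) (a @ b)"
      using sxz equivclp_trans by metis
    moreover have "reduced (a @ b)" "set (a @ b) \<subseteq> {..<n}"
      using r z(2) ab(1) reduced_Cons by auto
    ultimately show ?thesis
      by blast
  qed
qed (auto intro: exI[of _ "[]"])

text \<open>Both words are brought to reduced form inside the labels below \<open>n\<close> and
  compared there by braid moves. Hence the group presented on these labels embeds into
  \<open>cox\<close>, and the sets \<open>W_D n\<close> can be computed in it.\<close>

lemma coxeter_eq_iff:
  assumes "set x \<subseteq> {..<n}" "set z \<subseteq> {..<n}"
  shows "equivclp (coxeter_move n) x z \<longleftrightarrow> cw x = cw z"
proof
  have eq: "cw x = cw z" if "equivclp (coxeter_move n) x z" for x z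
    unfolding cw_eq_iff
    by (rule equivclp_map[OF that, where f = "\<lambda>x. x", simplified])
       (auto intro!: r_into_equivclp simp: cox_move_def)
  show "equivclp (coxeter_move n) x z \<Longrightarrow> cw x = cw z"
    by (rule eq)
  assume xz: "cw x = cw z"
  obtain x' where x': "reduced x'" "set x' \<subseteq> {..<n}" "equivclp (coxeter_move n) x x'"
    using coxeter_eq_reduced assms by blast
  obtain z' where z': "reduced z'" "set z' \<subseteq> {..<n}" "equivclp (coxeter_move n) z z'"
    using coxeter_eq_reduced assms by blast
  have "cw x' = cw z'"
    using xz eq x'(3) z'(3) by metis
  hence "equivclp (coxeter_move n) x' z'"
    using reduced_braid_eq braid_eq_coxeter_eq x' z' by blast
  thus "equivclp (coxeter_move n) x z"
    using x'(3) z'(3) equivclp_sym equivclp_trans by metis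
qed

section \<open>Parabolic subgroups and their identification with the sets
  \<open>W_D n\<close>\<close>

definition parabolic :: "nat \<Rightarrow> cox set" where
  "parabolic n = {cw x | x. set x \<subseteq> {..<n}}"

definition cox_class :: "nat \<Rightarrow> cox \<Rightarrow> nat list set" where
  "cox_class n u = {z. set z \<subseteq> {..<n} \<and> cw z = u}"

lemma parabolic_cw [simp]: "set x \<subseteq> {..<n} \<Longrightarrow> cw x \<in> parabolic n"
  by (auto simp: parabolic_def)

lemma parabolic_add: "u \<in> parabolic n \<Longrightarrow> w \<in> parabolic n \<Longrightarrow> u + w \<in> parabolic n"
proof -
  assume "u \<in> parabolic n" "w \<in> parabolic n"
  then obtain x z where "u = cw x" "w = cw z" "set (x @ z) \<subseteq> {..<n}"
    unfolding parabolic_def by auto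
  thus ?thesis
    using parabolic_cw cw_append by metis
qed

lemma parabolic_uminus: "u \<in> parabolic n \<Longrightarrow> - u \<in> parabolic n"
proof -
  assume "u \<in> parabolic n"
  then obtain x where "u = cw x" "set (rev x) \<subseteq> {..<n}"
    unfolding parabolic_def by auto
  thus ?thesis
    using parabolic_cw cw_rev by metis
qed

lemma parabolic_cg: "s < n \<Longrightarrow> cg s \<in> parabolic n"
  using parabolic_cw[of "[s]" n] by (simp add: cw_Cons)

lemma parabolic_zero [simp]: "0 \<in> parabolic n"
  using parabolic_cw[of "[]" n] by simp

lemma parabolic_reduced: "u \<in> parabolic n \<Longrightarrow> \<exists>x. set x \<subseteq> {..<n} \<and> cw x = u \<and> reduced x"
proof -
  assume "u \<in> parabolic n"
  then obtain x where x: "u = cw x" "set x \<subseteq> {..<n}"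
    by (auto simp: parabolic_def)
  then obtain z where "reduced z" "set z \<subseteq> {..<n}" "equivclp (coxeter_move n) x z"
    using coxeter_eq_reduced by blast
  thus ?thesis
    using x coxeter_eq_iff by auto
qed

lemma cox_class_inj: "inj_on (cox_class n) (parabolic n)"
  by (rule inj_onI) (auto simp: cox_class_def parabolic_def)

lemma W_D_eq: "W_D n = cox_class n ` parabolic n"
proof -
  have "coxeter_rel n `` {x} = cox_class n (cw x)" if "set x \<subseteq> {..<n}" for x
    using that coxeter_eq_iff unfolding coxeter_rel_def cox_class_def by auto
  thus ?thesis
    unfolding W_D_def quotient_def parabolic_def by auto
qed

lemma W_e_eq: "W_e n = cox_class n 0"
proof -
  have "coxeter_rel n `` {[]} = cox_class n (cw [])"
    using coxeter_eq_iff[of "[]" n] unfolding coxeter_rel_def cox_class_def by auto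
  thus ?thesis
    by (simp add: W_e_def)
qed

lemma W_inv_eq: "W_inv (cox_class n u) = cox_class n (- u)"
proof (rule Set.set_eqI)
  fix x
  have "x \<in> W_inv (cox_class n u) \<longleftrightarrow> rev x \<in> cox_class n u"
    unfolding W_inv_def by (metis image_iff rev_rev_ident)
  also have "\<dots> \<longleftrightarrow> set x \<subseteq> {..<n} \<and> - cw x = u"
    by (simp add: cox_class_def cw_rev)
  also have "\<dots> \<longleftrightarrow> x \<in> cox_class n (- u)"
    unfolding cox_class_def mem_Collect_eq by (metis minus_minus)
  finally show "x \<in> W_inv (cox_class n u) \<longleftrightarrow> x \<in> cox_class n (- u)" .
qed

lemma reduced_word_class:
  assumes "u \<in> parabolic n"
  shows "set (reduced_word (cox_class n u)) \<subseteq> {..<n}"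
    and "cw (reduced_word (cox_class n u)) = u"
    and "reduced (reduced_word (cox_class n u))"
proof -
  obtain x where x: "x \<in> cox_class n u" "reduced x"
    using parabolic_reduced[OF assms] by (auto simp: cox_class_def)
  have *: "reduced_word (cox_class n u) \<in> cox_class n u"
    "length (reduced_word (cox_class n u)) \<le> length x"
    unfolding reduced_word_def
    using arg_min_nat_lemma[of "\<lambda>x. x \<in> cox_class n u" x length] x by blast+
  thus "set (reduced_word (cox_class n u)) \<subseteq> {..<n}" "cw (reduced_word (cox_class n u)) = u"
    by (auto simp: cox_class_def)
  thus "reduced (reduced_word (cox_class n u))"
    using *(2) x clen_le[of "reduced_word (cox_class n u)"]
    by (auto simp: reduced_def cox_class_def)
qed

lemma parabolic_cg_not: "cg n \<notin> parabolic n"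
  using cg_notin_parabolic by (auto simp: parabolic_def)

text \<open>Otherwise exchange would delete a letter of \<open>x\<close>, which puts
  \<open>u + cg n\<close> and hence \<open>cg n\<close> into the subgroup.\<close>

lemma parabolic_add_cg_length:
  assumes "u \<in> parabolic n"
  shows "clen (u + cg n) = clen u + 1"
proof (rule ccontr)
  obtain x where x: "set x \<subseteq> {..<n}" "cw x = u"
    using assms by (auto simp: parabolic_def)
  assume "clen (u + cg n) \<noteq> clen u + 1"
  hence "clen (cw x + cg n) < clen (cw x)"
    using clen_add_cg[of u n] x by simp
  then obtain a t b where "x = a @ t # b" "cw x + cg n = cw (a @ b)"
    using exchange_right by metis
  hence "u + cg n \<in> parabolic n"
    using x by auto
  hence "- u + (u + cg n) \<in> parabolic n"
    using assms parabolic_add parabolic_uminus by blast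
  thus False
    using parabolic_cg_not by simp
qed

section \<open>The words of the Jucys-Murphy elements are reduced\<close>

definition JM_word :: "nat \<Rightarrow> nat list" where
  "JM_word i = rev [2..<i] @ [0] @ [1..<i]"

lemma JM_word_2: "JM_word 2 = [0, 1]"
  by (simp add: JM_word_def numeral_2_eq_2)

lemma JM_word_Suc: "2 \<le> n \<Longrightarrow> JM_word (Suc n) = n # JM_word n @ [n]"
  by (simp add: JM_word_def)

lemma JM_word_set: "2 \<le> n \<Longrightarrow> set (JM_word n) \<subseteq> {..<n}"
  by (auto simp: JM_word_def)

text \<open>The sign change of the last coordinate is the invariant that keeps this element out of
  the smaller parabolic subgroup.\<close>

lemma JM_word_act: "2 \<le> n \<Longrightarrow> act (cw (JM_word n)) (n, b) = (n, \<not> b)"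
proof (induction n rule: dec_induct)
  case base
  show ?case
    by (simp add: JM_word_2 cw_Cons sgn_act_def)
next
  case (step n)
  thus ?case
    by (simp add: JM_word_Suc cw_Cons cw_append sgn_act_def)
qed

lemma JM_word_notin:
  assumes "2 \<le> n"
  shows "cw (JM_word (Suc n)) \<notin> parabolic n"
proof
  assume "cw (JM_word (Suc n)) \<in> parabolic n"
  then obtain x where "cw (JM_word (Suc n)) = cw x" "set x \<subseteq> {..<n}"
    by (auto simp: parabolic_def)
  thus False
    using JM_word_act[of "Suc n" True] act_fixes_above[of x n "Suc n" True] assms by simp
qed

lemma JM_word_reduced: "2 \<le> n \<Longrightarrow> reduced (JM_word n)"
proof (induction n rule: dec_induct)
  case base
  have "cg 0 + cg 1 \<noteq> 0"
    using cg_neq[of 0 1] by (metis cg_add_self add_right_cancel zero_neq_one)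
  hence "clen (cg 0 + cg 1) \<noteq> 0"
    by (simp only: clen_eq_0_iff not_False_eq_True)
  moreover have "even (clen (cg 0 + cg 1))"
    using cpar_clen[of "cg 0 + cg 1"] cpar_clen[of "cg 1"] cpar_cg_add[of 0 "cg 1"] by simp
  moreover have "clen (cg 0 + cg 1) \<le> 2"
    using clen_le[of "[0, 1]"] by (simp add: cw_Cons)
  ultimately have "clen (cg 0 + cg 1) = 2"
    by presburger
  thus ?case
    by (simp add: reduced_def JM_word_2 cw_Cons)
next
  case (step n)
  define d where "d = cw (JM_word n)"
  have d: "d \<in> parabolic n"
    using JM_word_set step.hyps by (simp add: d_def)
  have r1: "reduced (JM_word n @ [n])"
    using step.IH parabolic_add_cg_length[OF d]
    by (simp add: reduced_def cw_append cw_Cons d_def)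
  \<comment> \<open>An exchange would delete either the final \<open>n\<close>, which puts the whole
    element into \<open>parabolic n\<close>, or a letter of \<open>JM_word n\<close>, which puts
    \<open>cg n\<close> there.\<close>
  have "clen (cg n + cw (JM_word n @ [n])) = clen (cw (JM_word n @ [n])) + 1"
  proof (rule ccontr)
    assume "clen (cg n + cw (JM_word n @ [n])) \<noteq> clen (cw (JM_word n @ [n])) + 1"
    hence "clen (cg n + cw (JM_word n @ [n])) < clen (cw (JM_word n @ [n]))"
      using clen_cg_add[of n "cw (JM_word n @ [n])"] by simp
    then obtain a t b where ab: "JM_word n @ [n] = a @ t # b"
      "cg n + cw (JM_word n @ [n]) = cw (a @ b)"
      using exchange by metis
    show False
    proof (cases b rule: rev_cases)
      case Nil
      hence "a = JM_word n"
        using ab(1) by auto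
      hence "cw (JM_word (Suc n)) = d"
        using ab(2) Nil step.hyps(1) by (simp add: JM_word_Suc cw_Cons d_def)
      thus False
        using JM_word_notin[OF step.hyps(1)] d by simp
    next
      case (snoc b' v)
      hence ab': "JM_word n = a @ t # b'" "v = n"
        using ab(1) by auto
      have "cg n + d + cg n = cw (a @ b') + cg n"
        using ab(2) snoc ab'(2) by (simp add: cw_append cw_Cons d_def add.assoc)
      hence "cg n + d = cw (a @ b')"
        by simp
      moreover have "cw (a @ b') \<in> parabolic n"
        using JM_word_set[OF step.hyps(1)] ab'(1) by simp
      ultimately have "cg n + d + - d \<in> parabolic n"
        using parabolic_add[OF _ parabolic_uminus[OF d]] by metis
      thus False
        using parabolic_cg_not by (simp add: add.assoc)
    qed
  qed
  thus ?case
    using r1 step.hyps by (simp add: JM_word_Suc reduced_Cons)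
qed


section \<open>The diagram automorphism\<close>

definition flip :: "nat \<Rightarrow> nat" where
  "flip s = (if s = 0 then 1 else if s = 1 then 0 else s)"

lemma flip_flip [simp]: "flip (flip s) = s"
  by (simp add: flip_def)

lemma flip_simps: "flip 0 = 1" "flip (Suc 0) = 0" "2 \<le> s \<Longrightarrow> flip s = s"
  by (simp_all add: flip_def)

lemma flip_eq_iff [simp]: "flip s = flip t \<longleftrightarrow> s = t"
  by (metis flip_flip)

lemma flip_less: "2 \<le> n \<Longrightarrow> s < n \<Longrightarrow> flip s < n"
  by (simp add: flip_def)

lemma adjacent_flip [simp]: "adjacent (flip s) (flip t) \<longleftrightarrow> adjacent s t"
  by (simp add: flip_def adjacent_def eval_nat_numeral)

lift_definition cflip :: "cox \<Rightarrow> cox" is "map flip"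
proof -
  fix x z assume "cox_eq x z"
  thus "cox_eq (map flip x) (map flip z)"
  proof (rule equivclp_map[where f = "map flip"])
    fix x z assume "cox_move x z"
    thus "cox_eq (map flip x) (map flip z)"
    proof (cases rule: cox_move_cases)
      case (square a b s)
      show ?thesis
        using cox_moveI(1)[of "map flip a" "flip s" "map flip b"] unfolding square
        by (simp add: r_into_equivclp)
    next
      case (braid2 a b s t)
      show ?thesis
        using cox_moveI(2)[of "flip s" "flip t" "map flip a" "map flip b"] braid2(1,2)
        unfolding braid2(3,4) by (simp add: r_into_equivclp)
    next
      case (braid3 a b s t)
      show ?thesis
        using cox_moveI(3)[of "flip s" "flip t" "map flip a" "map flip b"] braid3(1)
        unfolding braid3(2,3) by (simp add: r_into_equivclp)
    qed
  qed
qed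

lemma cflip_cw: "cflip (cw x) = cw (map flip x)"
  by transfer simp

lemma cflip_add [simp]: "cflip (u + w) = cflip u + cflip w"
  by transfer simp

lemma cflip_zero [simp]: "cflip 0 = 0"
  by transfer simp

lemma cflip_cg [simp]: "cflip (cg s) = cg (flip s)"
  by (simp add: cg_def cflip_cw)

lemma cflip_cflip [simp]: "cflip (cflip w) = w"
  by transfer (simp add: comp_def)

lemma clen_cflip [simp]: "clen (cflip w) = clen w"
proof -
  have "clen (cflip w) \<le> clen w" for w
    using clen_witness[of w] clen_le cflip_cw by (metis length_map)
  from this[of w] this[of "cflip w"] show ?thesis
    by simp
qed

section \<open>Linear operators on functions on the Coxeter group\<close>

\<comment> \<open>From here on elements of \<open>cox\<close> are opaque, so that
  \<open>transfer\<close> unfolds operators and does not return to words.\<close>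
lifting_forget cox.lifting

typedef (overloaded) 'k lend =
  "{f :: (cox \<Rightarrow> 'k::field) \<Rightarrow> cox \<Rightarrow> 'k.
     (\<forall>x z. f (\<lambda>w. x w + z w) = (\<lambda>w. f x w + f z w)) \<and>
     (\<forall>c x. f (\<lambda>w. c * x w) = (\<lambda>w. c * f x w))}"
  by (rule exI[of _ "\<lambda>v. v"]) simp

setup_lifting type_definition_lend

lift_definition ap :: "'k::field lend \<Rightarrow> (cox \<Rightarrow> 'k) \<Rightarrow> cox \<Rightarrow> 'k" is "\<lambda>f. f" .

lemma ap_fun_add: "ap A (\<lambda>w. x w + z w) = (\<lambda>w. ap A x w + ap A z w)"
  by transfer blast

lemma ap_fun_scale: "ap A (\<lambda>w. c * x w) = (\<lambda>w. c * ap A x w)"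
  by transfer blast

lemma lend_eqI: "(\<And>v w. ap A v w = ap B v w) \<Longrightarrow> A = B"
  by transfer blast

instantiation lend :: (field) ring_1
begin

lift_definition zero_lend :: "'a lend" is "\<lambda>v w. 0" by simp
lift_definition one_lend :: "'a lend" is "\<lambda>v. v" by simp
lift_definition plus_lend :: "'a lend \<Rightarrow> 'a lend \<Rightarrow> 'a lend" is "\<lambda>f g v w. f v w + g v w"
  by (simp add: fun_eq_iff algebra_simps)
lift_definition minus_lend :: "'a lend \<Rightarrow> 'a lend \<Rightarrow> 'a lend" is "\<lambda>f g v w. f v w - g v w"
  by (simp add: fun_eq_iff algebra_simps)
lift_definition uminus_lend :: "'a lend \<Rightarrow> 'a lend" is "\<lambda>f v w. - f v w"
  by (simp add: fun_eq_iff algebra_simps)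
lift_definition times_lend :: "'a lend \<Rightarrow> 'a lend \<Rightarrow> 'a lend" is "\<lambda>f g v. f (g v)"
  by simp

lemma ap_simps [simp]:
  "ap 0 v w = 0" "ap 1 v = v" "ap (A + B) v w = ap A v w + ap B v w"
  "ap (A - B) v w = ap A v w - ap B v w" "ap (- A) v w = - ap A v w"
  "ap (A * B) v = ap A (ap B v)"
  by (transfer, simp)+

instance
proof
  fix a b c :: "'a lend"
  show "a * b * c = a * (b * c)" "1 * a = a" "a * 1 = a"
    by (rule lend_eqI, simp)+
  show "a + b + c = a + (b + c)" "a + b = b + a" "0 + a = a" "- a + a = 0" "a - b = a + - b"
    by (rule lend_eqI, simp)+
  show "(a + b) * c = a * c + b * c"
    by (rule lend_eqI) simp
  show "a * (b + c) = a * b + a * c"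
  proof (rule lend_eqI)
    fix v w
    have "ap (b + c) v = (\<lambda>w. ap b v w + ap c v w)"
      by (simp add: fun_eq_iff)
    thus "ap (a * (b + c)) v w = ap (a * b + a * c) v w"
      by (simp add: ap_fun_add)
  qed
  have "ap (0 :: 'a lend) (\<lambda>w. 1) 0 \<noteq> ap 1 (\<lambda>w. 1) 0"
    by simp
  thus "(0 :: 'a lend) \<noteq> 1"
    by metis
qed

end

lift_definition sc :: "'k::field \<Rightarrow> 'k lend" is "\<lambda>c v w. c * v w"
  by (simp add: fun_eq_iff algebra_simps)

text \<open>Left multiplication by an inverse generator, written in the basis of products of inverse
  generators along reduced words: \<open>delta0 u\<close> goes to \<open>delta0 (cg s + u)\<close>,
  minus \<open>m\<close> times \<open>delta0 u\<close> if the length drops. Inverses are preferred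
  because \<tau> is a coefficient in their basis.\<close>

lift_definition uop :: "'k::field \<Rightarrow> nat \<Rightarrow> 'k lend" is
  "\<lambda>m s v w. v (cg s + w) - (if clen (cg s + w) < clen w then m * v w else 0)"
  by (simp add: fun_eq_iff algebra_simps)

lift_definition rop :: "'k::field \<Rightarrow> nat \<Rightarrow> 'k lend" is
  "\<lambda>m s v w. v (w + cg s) - (if clen (w + cg s) < clen w then m * v w else 0)"
  by (simp add: fun_eq_iff algebra_simps)

lift_definition Sop :: "'k::field lend" is "\<lambda>v w. v (cflip w)"
  by (simp add: fun_eq_iff)

lemma ap_sc [simp]: "ap (sc c) v w = c * v w"
  by transfer simp

lemma ap_uop: "ap (uop m s) v w = v (cg s + w) - (if clen (cg s + w) < clen w then m * v w else 0)"
  by transfer simp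

lemma ap_rop: "ap (rop m s) v w = v (w + cg s) - (if clen (w + cg s) < clen w then m * v w else 0)"
  by transfer simp

lemma ap_Sop [simp]: "ap Sop v w = v (cflip w)"
  by transfer simp

lemma sc_simps [simp]: "sc 0 = 0" "sc 1 = 1"
  by (rule lend_eqI, simp)+

lemma sc_add: "sc (c + d) = sc c + sc d"
  and sc_mult: "sc (c * d) = sc c * sc d"
  and sc_minus: "sc (c - d) = sc c - sc d"
  and sc_uminus: "sc (- c) = - sc c"
  by (rule lend_eqI, simp add: algebra_simps)+

lemma sc_commute: "sc c * A = A * sc c"
proof (rule lend_eqI)
  fix v w
  have "ap (sc c) v = (\<lambda>w. c * v w)"
    by (simp add: fun_eq_iff)
  thus "ap (sc c * A) v w = ap (A * sc c) v w"
    by (simp add: ap_fun_scale)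
qed

lemma Sop_Sop: "Sop * Sop = 1"
  by (rule lend_eqI) simp

lemma Sop_uop: "Sop * uop m s = uop m (flip s) * Sop"
proof (rule lend_eqI)
  fix v :: "cox \<Rightarrow> 'a" and w
  have "cflip (cg (flip s) + w) = cg s + cflip w"
    by simp
  moreover have "clen (cg s + cflip w) = clen (cg (flip s) + w)"
    using clen_cflip calculation by metis
  ultimately show "ap (Sop * uop m s) v w = ap (uop m (flip s) * Sop) v w"
    by (simp add: ap_uop)
qed

lemma uop_square: "uop m s * uop m s = 1 - sc m * uop m s"
proof (rule lend_eqI)
  fix v w
  show "ap (uop m s * uop m s) v w = ap (1 - sc m * uop m s) v w"
    using clen_cg_add[of s w] by (elim disjE) (simp_all add: ap_uop algebra_simps)
qed

text \<open>In the square formed by \<open>w\<close>, \<open>cg s + w\<close>,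
  \<open>w + cg t\<close> and \<open>cg s + w + cg t\<close>, either opposite sides ascend or
  descend together, and the correction terms match, or both pairs of opposite corners have equal
  lengths; then \<open>clen_both_sides\<close> makes \<open>cg s + w\<close> and
  \<open>w + cg t\<close> equal.\<close>

lemma uop_rop_commute: "uop m s * rop m t = rop m t * uop m s"
proof (rule lend_eqI)
  fix v :: "cox \<Rightarrow> 'a" and w
  define a b c where "a = cg s + w" "b = w + cg t" "c = cg s + (w + cg t)"
  have eqs: "cg s + w = a" "w + cg t = b" "cg s + b = c" "a + cg t = c"
    by (simp_all add: a_b_c_def add.assoc)
  have lens: "clen a = clen w + 1 \<or> clen w = clen a + 1" "clen b = clen w + 1 \<or> clen w = clen b + 1"
    "clen c = clen b + 1 \<or> clen b = clen c + 1" "clen c = clen a + 1 \<or> clen a = clen c + 1"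
    using clen_cg_add[of s w] clen_add_cg[of w t] clen_cg_add[of s b] clen_add_cg[of a t] eqs
    by simp_all
  have ab: "a = b" if "clen c = clen w" "clen a = clen b"
    using clen_both_sides[of s w t] that eqs by (simp add: add.assoc)
  have nat: "(p < r \<longleftrightarrow> k < q) \<and> (q < r \<longleftrightarrow> k < p)"
    if "p = r + 1 \<or> r = p + 1" "q = r + 1 \<or> r = q + 1" "k = q + 1 \<or> q = k + 1" "k = p + 1 \<or> p = k + 1"
      "k < r \<or> r < k \<or> p < q \<or> q < p" for p q r k :: nat
    using that by (elim disjE; intro conjI iffI; linarith)
  have "(clen a < clen w \<longleftrightarrow> clen c < clen b) \<and> (clen b < clen w \<longleftrightarrow> clen c < clen a)" if "a \<noteq> b"
    using ab that by (intro nat lens) linarith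
  then consider "a = b" | "clen a < clen w \<longleftrightarrow> clen c < clen b" "clen b < clen w \<longleftrightarrow> clen c < clen a"
    by blast
  thus "ap (uop m s * rop m t) v w = ap (rop m t * uop m s) v w"
  proof cases
    case 1
    hence "b + cg t = c"
      using eqs by simp
    thus ?thesis
      using 1 eqs by (simp add: ap_uop ap_rop)
  qed (simp add: ap_uop ap_rop eqs algebra_simps)
qed

text \<open>The operators commuting with all \<open>rop m t\<close> are determined by the value of their output at
  the identity, since \<open>rop m t\<close> moves the point of evaluation.\<close>

definition left_op :: "'k::field \<Rightarrow> 'k lend \<Rightarrow> bool" where
  "left_op m A \<longleftrightarrow> (\<forall>t. A * rop m t = rop m t * A)"

lemma left_op_simps:
  "left_op m 1" "left_op m (sc c)" "left_op m (uop m s)"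
  "left_op m A \<Longrightarrow> left_op m B \<Longrightarrow> left_op m (A + B)"
  "left_op m A \<Longrightarrow> left_op m B \<Longrightarrow> left_op m (A - B)"
  "left_op m A \<Longrightarrow> left_op m B \<Longrightarrow> left_op m (A * B)"
proof -
  assume AB: "left_op m A" "left_op m B"
  show "left_op m (A + B)" "left_op m (A - B)"
    using AB by (simp_all add: left_op_def algebra_simps)
  have "A * B * rop m t = rop m t * (A * B)" for t
    using AB unfolding left_op_def by (metis mult.assoc)
  thus "left_op m (A * B)"
    by (simp add: left_op_def)
qed (simp_all add: left_op_def sc_commute uop_rop_commute)

lemma left_op_eqI:
  assumes "left_op m A" "left_op m B" and "\<And>v. ap A v 0 = ap B v 0"
  shows "A = B"
proof -
  define C where "C = A - B"
  have C: "left_op m C" "\<And>v. ap C v 0 = 0"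
    using assms by (simp_all add: C_def left_op_simps)
  have "ap C v (cw x) = 0" if "reduced (rev x)" for v x
    using that
  proof (induction x arbitrary: v rule: rev_induct)
    case Nil
    thus ?case
      using C by simp
  next
    case (snoc t x)
    hence r: "reduced (rev x)" "clen (cg t + cw (rev x)) = clen (cw (rev x)) + 1"
      using reduced_Cons by simp_all
    have "clen (cw x + cg t) = clen (cw x) + 1"
      using r(2) clen_uminus[of "cw x + cg t"] by (simp add: cw_rev minus_add)
    hence "ap C v (cw x + cg t) = ap (rop m t) (ap C v) (cw x)"
      by (simp add: ap_rop)
    also have "\<dots> = ap (rop m t * C) v (cw x)"
      by simp
    also have "\<dots> = ap C (ap (rop m t) v) (cw x)"
      using C(1) by (simp flip: ap_simps(6) add: left_op_def)
    finally show ?case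
      using snoc.IH[OF r(1)] by (simp add: cw_append cw_Cons)
  qed
  hence "ap C v w = 0" for v w
    using reduced_ex[of w] reduced_rev by metis
  hence "C = 0"
    by (intro lend_eqI) simp
  thus ?thesis
    by (simp add: C_def)
qed

definition uword :: "'k::field \<Rightarrow> nat list \<Rightarrow> 'k lend" where
  "uword m x = prod_list (map (uop m) x)"

lemma uword_simps [simp]:
  "uword m [] = 1" "uword m (s # x) = uop m s * uword m x"
  "uword m (x @ z) = uword m x * uword m z"
  by (simp_all add: uword_def)

lemma left_op_uword: "left_op m (uword m x)"
  by (induction x) (simp_all add: left_op_simps)

text \<open>Along a reduced word no letter meets a descent, so the correction term of
  \<open>uop\<close> never appears.\<close>

lemma ap_uword_zero:
  assumes "reduced x"
  shows "ap (uword m x) v 0 = v (- cw x)"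
proof -
  have "ap (uword m x) v w = v (- cw x + w)" if "clen (- cw x + w) = length x + clen w" for w
    using that
  proof (induction x arbitrary: w)
    case (Cons s x)
    have eq: "- cw (s # x) + w = - cw x + (cg s + w)"
      by (simp add: cw_Cons minus_add add.assoc)
    have "clen (- cw x + (cg s + w)) \<le> clen (cw x) + clen (cg s + w)"
      using clen_add_le[of "- cw x" "cg s + w"] by simp
    hence *: "clen (cg s + w) = clen w + 1"
      using Cons.prems clen_cg_add[of s w] clen_le[of x] unfolding eq by auto
    hence "ap (uword m (s # x)) v w = ap (uword m x) v (cg s + w)"
      by (simp add: ap_uop)
    also have "\<dots> = v (- cw x + (cg s + w))"
      by (rule Cons.IH) (use Cons.prems * in \<open>simp add: eq\<close>)
    finally show ?case
      by (simp only: eq)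
  qed simp
  from this[of 0] assms show ?thesis
    by (simp add: reduced_def)
qed

text \<open>Evaluation at the identity sees only the group element. The commutation and braid
  relations of \<open>uop\<close> follow as the cases of length two and three.\<close>

lemma uword_cong: "cw x = cw z \<Longrightarrow> reduced x \<Longrightarrow> reduced z \<Longrightarrow> uword m x = uword m z"
  by (rule left_op_eqI[of m]) (simp_all add: left_op_uword ap_uword_zero)

definition delta0 :: "cox \<Rightarrow> cox \<Rightarrow> 'k::field" where
  "delta0 u w = (if w = u then 1 else 0)"

text \<open>The source of linear independence: reduced words of different elements produce different
  delta functions.\<close>

lemma ap_uword_delta: "reduced x \<Longrightarrow> ap (uword m x) (delta0 0) = delta0 (cw x)"
proof (induction x)
  case (Cons s x)
  have "ap (uop m s) (delta0 (cw x)) w = delta0 (cg s + cw x) w" for w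
  proof -
    have "cg s + w = cw x \<longleftrightarrow> w = cg s + cw x"
      by (metis cg_cancel_left)
    thus ?thesis
      using Cons.prems by (auto simp: ap_uop delta0_def reduced_Cons)
  qed
  hence "ap (uop m s) (delta0 (cw x)) = delta0 (cg s + cw x)"
    by blast
  with Cons show ?case
    by (simp add: reduced_Cons cw_Cons)
qed simp

lemma reduced_pair:
  assumes "s \<noteq> t"
  shows "reduced [s, t]"
proof -
  have "cg s + cg t \<noteq> 0"
    using cg_neq[OF assms] by (metis cg_add_self add_right_cancel)
  hence "clen (cg s + cg t) \<noteq> 0"
    by (simp only: clen_eq_0_iff not_False_eq_True)
  thus ?thesis
    using clen_cg_add[of s "cg t"] by (simp add: reduced_def cw_Cons)
qed

lemma reduced_triple:
  assumes "adjacent s t"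
  shows "reduced [s, t, s]"
proof (rule ccontr)
  have st: "s \<noteq> t"
    using assms by (auto simp: adjacent_def)
  assume "\<not> reduced [s, t, s]"
  hence "clen (cg s + cw [t, s]) < clen (cw [t, s])"
    using clen_cg_add[of s "cw [t, s]"] reduced_pair[of t s] st by (simp add: reduced_Cons[of s])
  then obtain a u b where ab: "[t, s] = a @ u # b" "cg s + cw [t, s] = cw (a @ b)"
    using exchange by metis
  hence "a @ b = [s] \<or> a @ b = [t]"
    by (cases a) (auto simp: Cons_eq_append_conv)
  hence "cg s + (cg t + cg s) = cg s \<or> cg s + (cg t + cg s) = cg t"
    using ab(2) by (auto simp: cw_Cons)
  hence "cg t + cg s = 0 \<or> cg s + cg t = cg t + cg s"
    by (metis add.assoc add_left_cancel add_0_right cg_cancel_right)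
  thus False
    using cg_not_commute[OF assms] cg_neq[OF st] by (metis cg_add_self add_right_cancel)
qed

lemma uop_commute: "s \<noteq> t \<Longrightarrow> \<not> adjacent s t \<Longrightarrow> uop m s * uop m t = uop m t * uop m s"
  using uword_cong[of "[s, t]" "[t, s]" m] reduced_pair[of s t] reduced_pair[of t s] cg_commute[of s t]
  by (simp add: cw_Cons)

lemma uop_braid:
  assumes "adjacent s t"
  shows "uop m s * uop m t * uop m s = uop m t * uop m s * uop m t"
  using uword_cong[of "[s, t, s]" "[t, s, t]" m] reduced_triple[of s t] reduced_triple[of t s]
    cg_braid[OF assms] assms adjacent_sym[of s t]
  by (simp add: cw_Cons mult.assoc add.assoc)

definition hop :: "'k::field \<Rightarrow> nat \<Rightarrow> 'k lend" where
  "hop m s = uop m s + sc m"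

lemma hop_uop: "hop m s * uop m s = 1" "uop m s * hop m s = 1"
  by (simp_all add: hop_def algebra_simps uop_square sc_commute[of m "uop m s"])

lemma hop_square: "hop m s * hop m s = 1 + sc m * hop m s"
  by (simp add: hop_def algebra_simps uop_square sc_commute[of m "uop m s"])

lemma hop_commute: "s \<noteq> t \<Longrightarrow> \<not> adjacent s t \<Longrightarrow> hop m s * hop m t = hop m t * hop m s"
  by (simp add: hop_def algebra_simps uop_commute[of s t] sc_commute[of m "uop m s"]
      sc_commute[of m "uop m t"])

lemma inverse_braid:
  fixes a b :: "'a::ring_1"
  assumes "a * b * a = b * a * b" and "a * a' = 1" "a' * a = 1" "b * b' = 1" "b' * b = 1"
  shows "a' * b' * a' = b' * a' * b'"
proof -
  have 1: "(a' * b' * a') * (a * b * a) = 1"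
    using assms(2-) by (metis mult.assoc mult_1_left)
  have 2: "(b * a * b) * (b' * a' * b') = 1"
    using assms(2-) by (metis mult.assoc mult_1_left)
  show ?thesis
    using 1 2 unfolding assms(1) by (metis mult.assoc mult_1_left mult_1_right)
qed

lemma hop_braid: "adjacent s t \<Longrightarrow> hop m s * hop m t * hop m s = hop m t * hop m s * hop m t"
  using inverse_braid[OF uop_braid] hop_uop by blast

lemma Sop_hop: "Sop * hop m s = hop m (flip s) * Sop"
  by (simp add: hop_def algebra_simps Sop_uop sc_commute[of m Sop])

text \<open>The trace \<open>\<tau>\<close>: the coefficient of the identity in the basis of inverses.\<close>

definition tau :: "'k::field lend \<Rightarrow> 'k" where
  "tau A = ap A (delta0 0) 0"

lemma tau_simps [simp]:
  "tau 0 = 0" "tau 1 = 1" "tau (A + B) = tau A + tau B" "tau (A - B) = tau A - tau B"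
  "tau (sc c * A) = c * tau A" "tau (sc c) = c"
  by (simp_all add: tau_def delta0_def)

lemma tau_Sop: "tau (Sop * A * Sop) = tau A"
  for A :: "'k::field lend"
proof -
  have "ap Sop (delta0 0) = (delta0 0 :: cox \<Rightarrow> 'k)"
    by (auto simp: fun_eq_iff delta0_def) (metis cflip_cflip cflip_zero)
  thus ?thesis
    by (simp add: tau_def)
qed

text \<open>Left and right multiplication agree on the delta function at the identity and also under
  evaluation at the identity, so the letter can travel past \<open>A\<close> as a right
  multiplication.\<close>

lemma tau_uop_commute:
  fixes A :: "'k::field lend"
  assumes "left_op m A"
  shows "tau (A * uop m s) = tau (uop m s * A)"
proof -
  have "ap (uop m s) (delta0 0) = ap (rop m s) (delta0 0 :: cox \<Rightarrow> 'k)"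
    by (auto simp: fun_eq_iff ap_uop ap_rop delta0_def)
       (metis cg_add_self cg_cancel_left cg_cancel_right add_0_left add_0_right)+
  hence "tau (A * uop m s) = ap (A * rop m s) (delta0 0) 0"
    by (simp add: tau_def)
  also have "\<dots> = ap (rop m s * A) (delta0 0) 0"
    using assms by (simp only: left_op_def)
  also have "\<dots> = tau (uop m s * A)"
    by (simp add: tau_def ap_uop ap_rop)
  finally show ?thesis .
qed

lemma tau_uword_commute:
  assumes "left_op m A"
  shows "tau (A * uword m x) = tau (uword m x * A)"
  using assms
proof (induction x arbitrary: A)
  case (Cons s x)
  have "tau (A * uword m (s # x)) = tau (uword m x * (A * uop m s))"
    using Cons.IH[of "A * uop m s"] Cons.prems by (simp add: left_op_simps mult.assoc)
  also have "\<dots> = tau (uop m s * (uword m x * A))"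
    using tau_uop_commute[of m "uword m x * A" s] Cons.prems
    by (simp add: left_op_simps left_op_uword mult.assoc)
  finally show ?case
    by (simp add: mult.assoc)
qed simp

section \<open>The algebra of type \<open>B\<close> with trivial parameter at the end node\<close>

lemma left_inverse_eq_right: "x * y = 1 \<Longrightarrow> y * z = 1 \<Longrightarrow> x = z"
  for x y z :: "'a::monoid_mult"
  by (metis mult.assoc mult_1_left mult_1_right)

text \<open>The additive span; the generating predicates to which it is applied already allow scalar
  multiples.\<close>

inductive aspan :: "('b::ring_1 \<Rightarrow> bool) \<Rightarrow> 'b \<Rightarrow> bool" for P where
  aspan_zero: "aspan P 0"
| aspan_base: "P x \<Longrightarrow> aspan P x"
| aspan_add: "aspan P x \<Longrightarrow> aspan P y \<Longrightarrow> aspan P (x + y)"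

lemma aspan_map:
  assumes "aspan P x" and "f 0 = 0" and "\<And>x y. f (x + y) = f x + f y"
    and "\<And>x. P x \<Longrightarrow> aspan Q (f x)"
  shows "aspan Q (f x)"
  using assms(1) by induction (simp_all add: assms aspan.intros)

lemma aspan_mono: "aspan P x \<Longrightarrow> (\<And>x. P x \<Longrightarrow> Q x) \<Longrightarrow> aspan Q x"
  by (induction rule: aspan.induct) (auto intro: aspan.intros)

text \<open>The generators of the algebra of type \<open>B\<close> are \<open>S\<close>, of order two, and \<open>t 1, t 2, \<dots>\<close> with
  inverses \<open>u 1, u 2, \<dots>\<close>. The algebra of type \<open>D\<close> is the even part with respect to the number of
  factors \<open>S\<close>, the generator \<open>1'\<close> being \<open>S t\<^sub>1 S\<close>.\<close>

locale hecke_B =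
  fixes sc :: "'k::field \<Rightarrow> 'b::ring_1" and S :: 'b and u t :: "nat \<Rightarrow> 'b" and m :: 'k
  assumes sc_one: "sc 1 = 1"
    and sc_plus: "sc (c + d) = sc c + sc d"
    and sc_times: "sc (c * d) = sc c * sc d"
    and sc_central: "sc c * x = x * sc c"
    and t_eq: "t i = u i + sc m"
    and S_S: "S * S = 1"
    and u_u: "1 \<le> i \<Longrightarrow> u i * u i = 1 - sc m * u i"
    and S_u: "2 \<le> i \<Longrightarrow> S * u i = u i * S"
    and S_u1: "S * u 1 * S * u 1 = u 1 * S * u 1 * S"
    and u_comm: "1 \<le> i \<Longrightarrow> i + 2 \<le> j \<Longrightarrow> u i * u j = u j * u i"
    and u_braid: "1 \<le> i \<Longrightarrow> u i * u (i + 1) * u i = u (i + 1) * u i * u (i + 1)"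
begin

lemma sc_zero [simp]: "sc 0 = 0"
  using sc_plus[of 0 0] by simp

lemma sc_neg: "sc (- c) = - sc c"
  using sc_plus[of c "- c"] by (simp add: minus_unique)

lemma t_u [simp]: "1 \<le> i \<Longrightarrow> t i * u i = 1" "1 \<le> i \<Longrightarrow> u i * t i = 1"
  by (simp_all add: t_eq algebra_simps u_u sc_central[of m "u i"])

lemma t_u_left [simp]: "1 \<le> i \<Longrightarrow> t i * (u i * x) = x" "1 \<le> i \<Longrightarrow> u i * (t i * x) = x"
  by (simp_all flip: mult.assoc)

lemma S_left [simp]: "S * (S * x) = x"
  by (simp add: S_S flip: mult.assoc)

lemma t_t: "1 \<le> i \<Longrightarrow> t i * t i = 1 + sc m * t i"
  by (simp add: t_eq algebra_simps u_u sc_central[of m "u i"])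

lemma S_t: "2 \<le> i \<Longrightarrow> S * t i = t i * S"
  by (simp add: t_eq algebra_simps S_u sc_central[of m S])

lemma S_t1: "S * t 1 * S * t 1 = t 1 * S * t 1 * S"
proof -
  have 1: "(S * t 1 * S * t 1) * (u 1 * S * u 1 * S) = 1"
    by (simp add: mult.assoc S_S)
  have 2: "(S * u 1 * S * u 1) * (t 1 * S * t 1 * S) = 1"
    by (simp add: mult.assoc S_S)
  show ?thesis
    using left_inverse_eq_right[OF 1] 2 unfolding S_u1 by blast
qed

lemma t_comm: "1 \<le> i \<Longrightarrow> i + 2 \<le> j \<Longrightarrow> t i * t j = t j * t i"
  using u_comm[of i j] by (simp add: t_eq algebra_simps sc_central[of m "u i"] sc_central[of m "u j"])

lemma t_braid: "1 \<le> i \<Longrightarrow> t i * t (i + 1) * t i = t (i + 1) * t i * t (i + 1)"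
  using inverse_braid[OF u_braid, of i "t i" "t (i + 1)"] by simp

text \<open>\<open>p\<close> is the parity of the number of factors \<open>S\<close>. The side
  condition on \<open>S\<close> makes \<open>B 0\<close> the scalars, so that inductions on the rank
  can start or end there.\<close>

inductive B :: "nat \<Rightarrow> bool \<Rightarrow> 'b \<Rightarrow> bool" for n where
  B_zero: "B n p 0"
| B_one: "B n False 1"
| B_add: "B n p x \<Longrightarrow> B n p y \<Longrightarrow> B n p (x + y)"
| B_scale: "B n p x \<Longrightarrow> B n p (sc c * x)"
| B_right_S: "B n (\<not> p) x \<Longrightarrow> 1 \<le> n \<Longrightarrow> B n p (x * S)"
| B_right_t: "B n p x \<Longrightarrow> 1 \<le> i \<Longrightarrow> i < n \<Longrightarrow> B n p (x * t i)"

lemma B_mono: "B n p x \<Longrightarrow> n \<le> k \<Longrightarrow> B k p x"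
  by (induction rule: B.induct) (auto intro: B.intros)

lemma B_mult': "B n p' y \<Longrightarrow> B n p x \<Longrightarrow> B n (p \<noteq> p') (x * y)"
proof (induction arbitrary: p x rule: B.induct)
  case (B_scale p' y c)
  have "x * (sc c * y) = sc c * (x * y)"
    by (metis mult.assoc sc_central)
  thus ?case
    using B_scale B.B_scale by metis
next
  case (B_right_S p' y)
  have "B n (\<not> (p \<noteq> p')) (x * y)"
    using B_right_S.IH[OF B_right_S.prems] by (metis (full_types))
  from B.B_right_S[OF this B_right_S.hyps(2)] show ?case
    by (simp add: mult.assoc)
next
  case (B_right_t p' y i)
  from B.B_right_t[OF B_right_t.IH[OF B_right_t.prems] B_right_t.hyps(2,3)] show ?case
    by (simp add: mult.assoc)
qed (auto intro: B.intros simp: distrib_left)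

lemma B_mult: "B n p x \<Longrightarrow> B n p' y \<Longrightarrow> q = (p \<noteq> p') \<Longrightarrow> B n q (x * y)"
  using B_mult' by blast

lemma B_sc: "B n False (sc c)"
  using B_scale[OF B_one, of n c] by simp

lemma B_neg: "B n p x \<Longrightarrow> B n p (- x)"
  using B_scale[of n p x "-1"] by (simp add: sc_neg sc_one)

lemma B_diff: "B n p x \<Longrightarrow> B n p y \<Longrightarrow> B n p (x - y)"
  using B_add[OF _ B_neg, of n p x y] by simp

lemma B_S: "1 \<le> n \<Longrightarrow> B n True S"
  using B_right_S[of n True 1] B_one by simp

lemma B_t: "1 \<le> i \<Longrightarrow> i < n \<Longrightarrow> B n False (t i)"
  using B_right_t[of n False 1 i] B_one by simp

lemma B_u: "1 \<le> i \<Longrightarrow> i < n \<Longrightarrow> B n False (u i)"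
  using B_diff[OF B_t B_sc, of i n m] by (simp add: t_eq)

lemma B_0_True: "B 0 p x \<Longrightarrow> p \<Longrightarrow> x = 0"
  by (induction rule: B.induct) auto

lemma B_0_False: "B 0 p x \<Longrightarrow> \<not> p \<Longrightarrow> \<exists>c. x = sc c"
  by (induction rule: B.induct) (auto intro: exI[of _ 0] exI[of _ 1] simp: sc_one simp flip: sc_plus sc_times)

lemma commute_B:
  assumes "B n p x" and "1 \<le> n \<Longrightarrow> z * S = S * z" and "\<And>i. 1 \<le> i \<Longrightarrow> i < n \<Longrightarrow> z * t i = t i * z"
  shows "z * x = x * z"
  using assms(1)
proof (induction rule: B.induct)
  case (B_scale p x c)
  thus ?case
    by (metis mult.assoc sc_central)
next
  case (B_right_S p x)
  thus ?case
    using assms(2) by (metis mult.assoc)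
next
  case (B_right_t p x i)
  thus ?case
    using assms(3) by (metis mult.assoc)
qed (simp_all add: distrib_left distrib_right)

lemma t_B_commute:
  assumes "B k p x" "k < n"
  shows "t n * x = x * t n"
proof (rule commute_B[OF assms(1)])
  show "t n * S = S * t n" if "1 \<le> k"
    using S_t[of n] that assms by simp
  show "t n * t i = t i * t n" if "1 \<le> i" "i < k" for i
    using t_comm[of i n] that assms by simp
qed

lemma u_B_commute:
  assumes "B k p x" "k < n"
  shows "u n * x = x * u n"
proof -
  have u: "u n = t n - sc m"
    by (simp add: t_eq)
  show ?thesis
    unfolding u
    by (simp add: left_diff_distrib right_diff_distrib t_B_commute[OF assms] sc_central[of m x])
qed

text \<open>Jucys-Murphy elements of type B, starting with \<open>L 1 = S\<close>; the value at
  index \<open>0\<close> is a filler. \<open>Lam\<close> is the inverse family, and \<open>M\<close>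
  is the mixed one for which \<open>S * M i\<close> represents U_i.\<close>

fun L :: "nat \<Rightarrow> 'b" where
  "L 0 = S"
| "L (Suc n) = (if n = 0 then S else t n * L n * t n)"

fun Lam :: "nat \<Rightarrow> 'b" where
  "Lam 0 = S"
| "Lam (Suc n) = (if n = 0 then S else u n * Lam n * u n)"

fun M :: "nat \<Rightarrow> 'b" where
  "M 0 = S"
| "M (Suc n) = (if n = 0 then S else t n * M n * u n)"

lemma B_L: "1 \<le> n \<Longrightarrow> B n True (L n)"
  and B_Lam: "1 \<le> n \<Longrightarrow> B n True (Lam n)"
  and B_M: "1 \<le> n \<Longrightarrow> B n True (M n)"
proof -
  have *: "B (Suc n) True (a * x * b)" if "B (Suc n) False a" "B n True x" "B (Suc n) False b" for a b x n
    using that B_mono[OF that(2), of "Suc n"] by (auto intro: B_mult)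
  show "B n True (L n)" "B n True (Lam n)" "B n True (M n)" if "1 \<le> n"
    using that by (induction n) (auto intro!: * B_S B_t B_u)
qed

lemma L_S: "1 \<le> n \<Longrightarrow> L n * S = S * L n"
proof (induction n rule: dec_induct)
  case (step n)
  show ?case
  proof (cases "n = 1")
    case True
    thus ?thesis
      using S_t1 by (simp add: mult.assoc)
  next
    case False
    hence n: "2 \<le> n"
      using step.hyps by simp
    have "L (Suc n) * S = t n * (L n * S) * t n"
      using n S_t[OF n] by (simp add: mult.assoc)
    also have "\<dots> = S * L (Suc n)"
      using n S_t[OF n] step.IH by (simp add: mult.assoc) (metis mult.assoc)
    finally show ?thesis .
  qed
qed simp

text \<open>If \<open>i < n - 2\<close>, then \<open>t i\<close> commutes with the outer factors of
  \<open>L n\<close> and, by induction, with \<open>L (n - 1)\<close>. If \<open>i = n - 2\<close>,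
  it is carried through two layers of \<open>L n\<close> by the braid relation on either side of
  \<open>L i\<close>, which itself commutes with \<open>t (i + 1)\<close>.\<close>

lemma L_t: "1 \<le> i \<Longrightarrow> i + 2 \<le> n \<Longrightarrow> L n * t i = t i * L n"
proof (induction n arbitrary: i rule: less_induct)
  case (less n)
  obtain k where n: "n = Suc (Suc k)" "1 \<le> k" "i \<le> k"
    using less.prems by (metis One_nat_def Suc_le_D Suc_le_mono add_2_eq_Suc' le_trans)
  have Ln: "L n = t (k + 1) * L (k + 1) * t (k + 1)"
    using n by simp
  show ?case
  proof (cases "i = k")
    case False
    hence c: "t i * t (k + 1) = t (k + 1) * t i" and "L (k + 1) * t i = t i * L (k + 1)"
      using t_comm[of i "k + 1"] less.IH[of "k + 1" i] less.prems n by auto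
    thus ?thesis
      unfolding Ln by (metis mult.assoc)
  next
    case True
    have Lk: "L (k + 1) = t k * L k * t k"
      using n by simp
    have c: "t (k + 1) * L k = L k * t (k + 1)"
      using t_B_commute[OF B_L] n by simp
    note b = t_braid[OF n(2)]
    have "t k * L n = (t k * t (k + 1) * t k) * L k * t k * t (k + 1)"
      unfolding Ln Lk by (simp add: mult.assoc)
    also have "\<dots> = t (k + 1) * t k * (t (k + 1) * L k) * t k * t (k + 1)"
      unfolding b by (simp add: mult.assoc)
    also have "\<dots> = t (k + 1) * t k * L k * (t (k + 1) * t k * t (k + 1))"
      unfolding c by (simp add: mult.assoc)
    also have "\<dots> = L n * t k"
      unfolding Ln Lk b[symmetric] by (simp add: mult.assoc)
    finally show ?thesis
      using True by simp
  qed
qed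

lemma L_B_commute: "B k p x \<Longrightarrow> k < n \<Longrightarrow> L n * x = x * L n"
  by (rule commute_B) (auto intro: L_S L_t)

lemma L_Lam: "1 \<le> n \<Longrightarrow> L n * Lam n = 1" "1 \<le> n \<Longrightarrow> Lam n * L n = 1"
proof -
  have "L n * Lam n = 1 \<and> Lam n * L n = 1" if "1 \<le> n"
    using that
  proof (induction n rule: dec_induct)
    case (step n)
    hence "L n * (Lam n * x) = x" "Lam n * (L n * x) = x" for x
      by (simp_all flip: mult.assoc)
    thus ?case
      using step by (simp add: mult.assoc)
  qed (simp add: S_S)
  thus "1 \<le> n \<Longrightarrow> L n * Lam n = 1" "1 \<le> n \<Longrightarrow> Lam n * L n = 1"
    by blast+
qed

lemma Lam_B_commute:
  assumes "B k p x" "k < n"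
  shows "Lam n * x = x * Lam n"
proof -
  have n: "1 \<le> n"
    using assms by simp
  have "Lam n * x = Lam n * (x * L n) * Lam n"
    using L_Lam[OF n] by (simp add: mult.assoc)
  also have "\<dots> = Lam n * L n * x * Lam n"
    using L_B_commute[OF assms] by (simp add: mult.assoc)
  finally show ?thesis
    using L_Lam[OF n] by simp
qed

lemma Lam_S: "1 \<le> n \<Longrightarrow> Lam n * S = S * Lam n"
  using Lam_B_commute[of 1 True S n] B_S[of 1] by (cases "n = 1") auto


subsection \<open>Double coset decomposition\<close>

definition low :: "nat \<Rightarrow> bool \<Rightarrow> 'b \<Rightarrow> bool" where
  "low n p z \<longleftrightarrow> B (n - 1) p z"

text \<open>The parameter \<open>g\<close> serves two decompositions: with \<open>t\<close> and
  \<open>L\<close>, used to span the algebra, and with \<open>u\<close> and \<open>Lam\<close>, used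
  for expectations. In \<open>high\<close> one outer factor is enough, since \<open>L n\<close> and
  \<open>Lam n\<close> commute with \<open>B (n - 1)\<close>.\<close>

definition mid :: "(nat \<Rightarrow> 'b) \<Rightarrow> nat \<Rightarrow> bool \<Rightarrow> 'b \<Rightarrow> bool" where
  "mid g n p z \<longleftrightarrow> 2 \<le> n \<and> (\<exists>q x y. B (n - 1) q x \<and> B (n - 1) (q \<noteq> p) y \<and> z = x * g (n - 1) * y)"

definition high :: "(nat \<Rightarrow> 'b) \<Rightarrow> nat \<Rightarrow> bool \<Rightarrow> 'b \<Rightarrow> bool" where
  "high g n p z \<longleftrightarrow> (\<exists>x. B (n - 1) (\<not> p) x \<and> z = x * g n)"

definition K :: "nat \<Rightarrow> bool \<Rightarrow> 'b \<Rightarrow> bool" where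
  "K n p = aspan (\<lambda>z. low n p z \<or> mid t n p z)"

definition Dec :: "nat \<Rightarrow> bool \<Rightarrow> 'b \<Rightarrow> bool" where
  "Dec n p = aspan (\<lambda>z. low n p z \<or> mid t n p z \<or> high L n p z)"

lemma low_left: "low n p z \<Longrightarrow> B (n - 1) q x \<Longrightarrow> low n (q \<noteq> p) (x * z)"
  and low_right: "low n p z \<Longrightarrow> B (n - 1) q x \<Longrightarrow> low n (p \<noteq> q) (z * x)"
  by (auto simp: low_def intro: B_mult)

lemma midI:
  assumes "2 \<le> n" "B (n - 1) q x" "B (n - 1) r y" "p = (q \<noteq> r)" "z = x * g (n - 1) * y"
  shows "mid g n p z"
proof -
  have "r = (q \<noteq> p)"
    using assms(4) by blast
  thus ?thesis
    using assms unfolding mid_def by blast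
qed

lemma midE:
  assumes "mid g n p z"
  obtains q r x y where "2 \<le> n" "B (n - 1) q x" "B (n - 1) r y" "p = (q \<noteq> r)" "z = x * g (n - 1) * y"
  using assms unfolding mid_def by blast

lemma mid_left: "mid g n p z \<Longrightarrow> B (n - 1) q x \<Longrightarrow> mid g n (q \<noteq> p) (x * z)"
  by (erule midE, rule midI[OF _ B_mult[OF _ _ refl]]) (auto simp: mult.assoc)

lemma mid_right: "mid g n p z \<Longrightarrow> B (n - 1) q x \<Longrightarrow> mid g n (p \<noteq> q) (z * x)"
  by (erule midE, rule midI[OF _ _ B_mult[OF _ _ refl]]) (auto simp: mult.assoc)

lemma high_left: "high g n p z \<Longrightarrow> B (n - 1) q x \<Longrightarrow> high g n (q \<noteq> p) (x * z)"
  unfolding high_def by (elim exE conjE, rule exI, rule conjI[OF B_mult]) (auto simp: mult.assoc)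

lemma high_right:
  assumes "high g n p z" "B (n - 1) q x" and "\<And>p x. B (n - 1) p x \<Longrightarrow> g n * x = x * g n"
  shows "high g n (p \<noteq> q) (z * x)"
proof -
  obtain a where *: "B (n - 1) (\<not> p) a" "z = a * g n"
    using assms by (auto simp: high_def)
  have "z * x = a * x * g n"
    using assms(3)[OF assms(2)] by (simp add: *(2) mult.assoc)
  moreover have "B (n - 1) (\<not> (p \<noteq> q)) (a * x)"
    by (rule B_mult[OF *(1) assms(2)]) blast
  ultimately show ?thesis
    unfolding high_def by blast
qed

lemma K_left:
  assumes "K n p z" "B (n - 1) q x"
  shows "K n (q \<noteq> p) (x * z)"
proof -
  have "low n (q \<noteq> p) (x * z) \<or> mid t n (q \<noteq> p) (x * z)"
    if "low n p z \<or> mid t n p z" for z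
    using that low_left[OF _ assms(2)] mid_left[OF _ assms(2)] by blast
  note * = this
  show ?thesis
    unfolding K_def
    by (rule aspan_map[where f = "\<lambda>z. x * z", OF assms(1)[unfolded K_def]])
       (simp, simp add: distrib_left, rule aspan_base, rule *)
qed

lemma K_right:
  assumes "K n p z" "B (n - 1) q x"
  shows "K n (p \<noteq> q) (z * x)"
proof -
  have "low n (p \<noteq> q) (z * x) \<or> mid t n (p \<noteq> q) (z * x)"
    if "low n p z \<or> mid t n p z" for z
    using that low_right[OF _ assms(2)] mid_right[OF _ assms(2)] by blast
  note * = this
  show ?thesis
    unfolding K_def
    by (rule aspan_map[where f = "\<lambda>z. z * x", OF assms(1)[unfolded K_def]])
       (simp, simp add: distrib_right, rule aspan_base, rule *)
qed

lemma Dec_left: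
  assumes "Dec n p z" "B (n - 1) q x"
  shows "Dec n (q \<noteq> p) (x * z)"
proof -
  have "low n (q \<noteq> p) (x * z) \<or> mid t n (q \<noteq> p) (x * z) \<or> high L n (q \<noteq> p) (x * z)"
    if "low n p z \<or> mid t n p z \<or> high L n p z" for z
    using that low_left[OF _ assms(2)] mid_left[OF _ assms(2)] high_left[OF _ assms(2)] by blast
  note * = this
  show ?thesis
    unfolding Dec_def
    by (rule aspan_map[where f = "\<lambda>z. x * z", OF assms(1)[unfolded Dec_def]])
       (simp, simp add: distrib_left, rule aspan_base, rule *)
qed

lemma Dec_right:
  assumes "Dec n p z" "B (n - 1) q x" "1 \<le> n"
  shows "Dec n (p \<noteq> q) (z * x)"
proof -
  have c: "L n * x = x * L n" if "B (n - 1) p x" for p x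
    using L_B_commute that assms(3) by simp
  have h: "high L n (p \<noteq> q) (z * x)" if "high L n p z" for z
    by (rule high_right[OF that assms(2)]) (rule c)
  have "low n (p \<noteq> q) (z * x) \<or> mid t n (p \<noteq> q) (z * x) \<or> high L n (p \<noteq> q) (z * x)"
    if "low n p z \<or> mid t n p z \<or> high L n p z" for z
    using that low_right[OF _ assms(2)] mid_right[OF _ assms(2)] h by blast
  note * = this
  show ?thesis
    unfolding Dec_def
    by (rule aspan_map[where f = "\<lambda>z. z * x", OF assms(1)[unfolded Dec_def]])
       (simp, simp add: distrib_right, rule aspan_base, rule *)
qed

lemma Dec_add: "Dec n p x \<Longrightarrow> Dec n p y \<Longrightarrow> Dec n p (x + y)"
  by (simp add: Dec_def aspan_add)

lemma Dec_intros:
  "B (n - 1) p x \<Longrightarrow> Dec n p x"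
  "2 \<le> n \<Longrightarrow> B (n - 1) q x \<Longrightarrow> B (n - 1) (q \<noteq> p) y \<Longrightarrow> Dec n p (x * t (n - 1) * y)"
  "B (n - 1) (\<not> p) x \<Longrightarrow> Dec n p (x * L n)"
  unfolding Dec_def
  by (rule aspan_base; (auto simp: low_def mid_def high_def)[1])+

text \<open>Each kind of summand moves up one rank by its own relation: the quadratic one for
  \<open>low\<close>, the braid relation for \<open>mid\<close>, and
  \<open>L (Suc n) = t n * L n * t n\<close> for \<open>high\<close>.\<close>

lemma Dec_t_conj:
  assumes "Dec n p y" "1 \<le> n"
  shows "Dec (Suc n) p (t n * y * t n)"
  using assms(1) unfolding Dec_def[of n]
proof (induction rule: aspan.induct)
  case aspan_zero
  show ?case
    using Dec_intros(1)[OF B_zero] by simp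
next
  case (aspan_add x y)
  thus ?case
    by (simp add: distrib_left distrib_right Dec_add)
next
  case (aspan_base y)
  thus ?case
  proof (elim disjE)
    assume "low n p y"
    hence y: "B (n - 1) p y"
      by (simp add: low_def)
    hence yn: "B n p y"
      using B_mono by simp
    have "t n * y * t n = y * (t n * t n)"
      using t_B_commute[OF y] assms(2) by (simp add: mult.assoc)
    also have "\<dots> = y + (sc m * y) * t n * 1"
      unfolding t_t[OF assms(2)] by (simp add: distrib_left) (metis mult.assoc sc_central)
    finally show ?thesis
      using Dec_intros(1)[of "Suc n" p y] Dec_intros(2)[of "Suc n" p "sc m * y" p 1]
        yn assms(2) B_one B_scale by (simp add: Dec_add)
  next
    assume "mid t n p y"
    then obtain q a b where *: "2 \<le> n" "B (n - 1) q a" "B (n - 1) (q \<noteq> p) b" "y = a * t (n - 1) * b"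
      unfolding mid_def by blast
    have b: "t n * t (n - 1) * t n = t (n - 1) * t n * t (n - 1)"
      using t_braid[of "n - 1"] *(1) by simp
    have "t n * y * t n = a * (t n * t (n - 1) * t n) * b"
      using t_B_commute[OF *(2), of n] t_B_commute[OF *(3), of n] *(1) unfolding *(4)
      by (simp add: mult.assoc) (metis mult.assoc)
    also have "\<dots> = (a * t (n - 1)) * t n * (t (n - 1) * b)"
      unfolding b by (simp add: mult.assoc)
    finally have "t n * y * t n = (a * t (n - 1)) * t n * (t (n - 1) * b)" .
    moreover have Bt: "B n False (t (n - 1))"
      by (rule B_t) (use *(1) in linarith)+
    have "B n q (a * t (n - 1))" "B n (q \<noteq> p) (t (n - 1) * b)"
      by (rule B_mult[OF B_mono[OF *(2)] Bt] B_mult[OF Bt B_mono[OF *(3)]]; simp)+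
    ultimately show ?thesis
      using Dec_intros(2)[of "Suc n"] assms(2) by simp
  next
    assume "high L n p y"
    then obtain x where x: "B (n - 1) (\<not> p) x" "y = x * L n"
      by (auto simp: high_def)
    have "t n * y * t n = x * L (Suc n)"
      using t_B_commute[OF x(1), of n] x(2) assms(2) by (simp flip: mult.assoc)
    thus ?thesis
      using Dec_intros(3)[of "Suc n" p x] B_mono[OF x(1), of n] by simp
  qed
qed

text \<open>A summand \<open>a * t n * b\<close> requires \<open>t n * b * t n\<close> with
  \<open>b\<close> in \<open>B n\<close>, hence the decomposition of \<open>b\<close> one rank
  below; this is where \<open>IH\<close> enters. For \<open>high\<close> the quadratic relation
  absorbs the doubled \<open>t n\<close>.\<close>

lemma Dec_right_t:
  assumes "Dec (Suc n) p x" "1 \<le> n" and IH: "\<And>p y. B n p y \<Longrightarrow> Dec n p y"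
  shows "Dec (Suc n) p (x * t n)"
  using assms(1) unfolding Dec_def[of "Suc n"]
proof (induction rule: aspan.induct)
  case aspan_zero
  show ?case
    by (simp add: aspan.intros)
next
  case (aspan_add x y)
  thus ?case
    by (simp add: distrib_right aspan.intros)
next
  case (aspan_base z)
  hence "Dec (Suc n) p (z * t n)"
  proof (elim disjE)
    assume "low (Suc n) p z"
    thus ?thesis
      using Dec_intros(2)[of "Suc n" p z p 1] assms(2) B_one by (simp add: low_def)
  next
    assume "mid t (Suc n) p z"
    then obtain q a b where *: "B n q a" "B n (q \<noteq> p) b" "z = a * t n * b"
      unfolding mid_def diff_Suc_1 by blast
    have "Dec (Suc n) (q \<noteq> p) (t n * b * t n)"
      using Dec_t_conj IH *(2) assms(2) by blast
    hence "Dec (Suc n) (q \<noteq> (q \<noteq> p)) (a * (t n * b * t n))"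
      by (rule Dec_left) (use *(1) in simp)
    moreover have "(q \<noteq> (q \<noteq> p)) = p"
      by blast
    ultimately show ?thesis
      using *(3) by (simp add: mult.assoc)
  next
    assume "high L (Suc n) p z"
    then obtain a where *: "B n (\<not> p) a" "z = a * L (Suc n)"
      by (auto simp: high_def)
    have "z * t n = a * t n * L n * (t n * t n)"
      using *(2) assms(2) by (simp add: mult.assoc)
    also have "\<dots> = a * t n * L n + (sc m * a) * L (Suc n)"
      unfolding t_t[OF assms(2)] using assms(2)
      by (simp add: distrib_left mult.assoc) (metis mult.assoc sc_central)
    finally show ?thesis
      using Dec_intros(2)[of "Suc n" "\<not> p" a p "L n"] Dec_intros(3)[of "Suc n" p "sc m * a"]
        *(1) assms(2) B_L[of n] B_scale by (auto intro: Dec_add)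
  qed
  thus ?case
    by (simp add: Dec_def)
qed

lemma B_Dec: "1 \<le> n \<Longrightarrow> B n p x \<Longrightarrow> Dec n p x"
proof (induction n arbitrary: p x rule: dec_induct)
  case base
  \<comment> \<open>In rank one \<open>mid\<close> is empty, and multiplication by \<open>S\<close>
    exchanges the two remaining kinds.\<close>
  have S: "Dec 1 p (x * S)" if "Dec 1 (\<not> p) x" for p x
    using that unfolding Dec_def[of _ "\<not> p"]
  proof (induction rule: aspan.induct)
    case aspan_zero
    show ?case
      using Dec_intros(1)[OF B_zero] by simp
  next
    case (aspan_add x y)
    thus ?case
      by (simp add: distrib_right Dec_add)
  next
    case (aspan_base z)
    then consider "B 0 (\<not> p) z" | a where "B 0 p a" "z = a * S"
      by (auto simp: low_def mid_def high_def)
    thus ?case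
    proof cases
      case 1
      thus ?thesis
        using Dec_intros(3)[of 1 p z] by simp
    next
      case 2
      thus ?thesis
        using Dec_intros(1)[of 1 p a] by (simp add: mult.assoc S_S)
    qed
  qed
  show ?case
    using base
  proof (induction rule: B.induct)
    case (B_scale p x c)
    thus ?case
      using Dec_left[of 1 p x False "sc c"] B_sc by simp
  next
    case (B_right_S p x)
    thus ?case
      using S[of p x] by simp
  qed (auto intro: Dec_add Dec_intros(1) B_zero B_one)
next
  case (step n)
  show ?case
    using step.prems
  proof (induction rule: B.induct)
    case (B_scale p x c)
    thus ?case
      using Dec_left[of "Suc n" p x False "sc c"] B_sc by simp
  next
    case (B_right_S p x)
    have "Dec (Suc n) ((\<not> p) \<noteq> True) (x * S)"
      by (rule Dec_right) (use B_right_S B_S step.hyps in simp_all)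
    thus ?case
      by simp
  next
    case (B_right_t p x i)
    show ?case
    proof (cases "i = n")
      case True
      thus ?thesis
        using Dec_right_t step.IH step.hyps B_right_t.IH by blast
    next
      case False
      hence "Dec (Suc n) (p \<noteq> False) (x * t i)"
        by (intro Dec_right) (use B_right_t B_t in simp_all)
      thus ?thesis
        by simp
    qed
  qed (auto intro: Dec_add Dec_intros(1) B_zero B_one)
qed

end

subsection \<open>Uniqueness of Markov traces\<close>

context hecke_B
begin

lemma B_1: "B n p x \<Longrightarrow> n = 1 \<Longrightarrow> \<exists>c. x = (if p then sc c * S else sc c)"
proof (induction rule: B.induct)
  case (B_zero p)
  show ?case
    by (rule exI[of _ 0]) simp
next
  case B_one
  show ?case
    by (rule exI[of _ 1]) (simp add: sc_one)
next
  case (B_add p x y)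
  then obtain c d where "x = (if p then sc c * S else sc c)" "y = (if p then sc d * S else sc d)"
    by blast
  thus ?case
    by (intro exI[of _ "c + d"]) (simp add: sc_plus distrib_right)
next
  case (B_scale p x c)
  then obtain d where "x = (if p then sc d * S else sc d)"
    by blast
  thus ?case
    by (intro exI[of _ "c * d"]) (simp add: sc_times mult.assoc)
next
  case (B_right_S p x)
  then obtain d where "x = (if \<not> p then sc d * S else sc d)"
    by blast
  thus ?case
    by (intro exI[of _ d]) (simp add: mult.assoc S_S)
qed simp

text \<open>The tail L_(k+1) ... L_n. Together with U_1 ... U_k, which is \<open>V k\<close>, and a
  power of \<open>S\<close> it forms the products \<open>V k * Sp (n - k) * Xp n k\<close>, through
  which L_1 ... L_n is turned into U_1 ... U_n one factor at a time.\<close>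

definition Xp :: "nat \<Rightarrow> nat \<Rightarrow> 'b" where
  "Xp n k = prod_list (map L [Suc k..<Suc n])"

definition V :: "nat \<Rightarrow> 'b" where
  "V n = prod_list (map (\<lambda>i. S * M i) [1..<Suc n])"

definition Sp :: "nat \<Rightarrow> 'b" where
  "Sp e = (if odd e then S else 1)"

lemma Xp_self [simp]: "Xp n n = 1"
  by (simp add: Xp_def)

lemma Xp_step: "k < n \<Longrightarrow> Xp n k = L (Suc k) * Xp n (Suc k)"
  unfolding Xp_def by (subst upt_conv_Cons) auto

lemma B_Xp: "k \<le> n \<Longrightarrow> B n (odd (n - k)) (Xp n k)"
proof (induction k rule: inc_induct)
  case base
  show ?case
    using B_one by simp
next
  case (step k)
  have "B n True (L (Suc k))"
    using B_mono[OF B_L[of "Suc k"], of n] step.hyps by simp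
  from B_mult[OF this step.IH, of "odd (n - k)"] show ?case
    using step.hyps by (simp add: Xp_step Suc_diff_Suc[symmetric])
qed

lemma Xp_commute: "B k p x \<Longrightarrow> k \<le> n \<Longrightarrow> Xp n k * x = x * Xp n k"
proof -
  assume x: "B k p x" and "k \<le> n"
  have "Xp n j * x = x * Xp n j" if "k \<le> j" "j \<le> n" for j
    using that(2,1)
  proof (induction j rule: inc_induct)
    case (step j)
    have "Xp n j * x = L (Suc j) * (Xp n (Suc j) * x)"
      using step.hyps by (simp add: Xp_step mult.assoc)
    also have "\<dots> = L (Suc j) * x * Xp n (Suc j)"
      using step.IH step.prems by (simp add: mult.assoc)
    also have "\<dots> = x * Xp n j"
      using L_B_commute[OF x, of "Suc j"] step.hyps step.prems by (simp add: Xp_step mult.assoc)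
    finally show ?case .
  qed simp
  thus ?thesis
    using \<open>k \<le> n\<close> by blast
qed

lemma V_Suc: "V (Suc n) = V n * (S * M (Suc n))"
  by (simp add: V_def)

lemma V_zero [simp]: "V 0 = 1"
  by (simp add: V_def)

lemma B_V: "B n False (V n)"
proof (induction n)
  case (Suc n)
  have "B (Suc n) False (S * M (Suc n))"
    by (rule B_mult[OF B_S B_M]) simp_all
  thus ?case
    unfolding V_Suc using B_mult[OF B_mono[OF Suc]] by force
qed (simp add: B_one)

lemma Sp_Suc: "Sp (Suc e) = S * Sp e"
  by (simp add: Sp_def S_S)

lemma B_Sp: "1 \<le> n \<Longrightarrow> B n (odd e) (Sp e)"
  by (simp add: Sp_def B_S B_one)

text \<open>Passing from \<open>M n\<close> to \<open>M (Suc n)\<close> conjugates by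
  \<open>t n\<close>, and error terms have to stay of the first two kinds. For \<open>mid\<close>
  this is the identity \<open>ttu\<close>, a form of the braid relation.\<close>

lemma t_conj_K:
  assumes "K n p z" "1 \<le> n"
  shows "K (Suc n) p (t n * z * u n)"
  unfolding K_def
proof (rule aspan_map[where f = "\<lambda>z. t n * z * u n", OF assms(1)[unfolded K_def]])
  fix z assume "low n p z \<or> mid t n p z"
  hence "low (Suc n) p (t n * z * u n) \<or> mid t (Suc n) p (t n * z * u n)"
  proof
    assume "low n p z"
    hence z: "B (n - 1) p z"
      by (simp add: low_def)
    have "t n * z * u n = z"
      using t_B_commute[OF z, of n] assms(2) by (simp add: mult.assoc)
    thus ?thesis
      using B_mono[OF z, of n] by (simp add: low_def)
  next
    assume "mid t n p z"
    then obtain q r x y where *: "2 \<le> n" "B (n - 1) q x" "B (n - 1) r y" "p = (q \<noteq> r)"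
      "z = x * t (n - 1) * y"
      by (rule midE)
    have n1: "1 \<le> n - 1" "n - 1 < n"
      using *(1) by auto
    have b: "t (n - 1) * t n * t (n - 1) = t n * t (n - 1) * t n"
      using t_braid[OF n1(1)] *(1) by simp
    have "t n * t (n - 1) * u n = u (n - 1) * (t (n - 1) * t n * t (n - 1)) * u n"
      using n1 by (simp add: mult.assoc)
    also have "\<dots> = u (n - 1) * t n * t (n - 1)"
      unfolding b using assms(2) by (simp add: mult.assoc)
    finally have ttu: "t n * t (n - 1) * u n = u (n - 1) * t n * t (n - 1)" .
    have "t n * z * u n = x * (t n * t (n - 1) * u n) * y"
      using t_B_commute[OF *(2), of n] u_B_commute[OF *(3), of n] assms(2) *(5)
      by (simp add: mult.assoc) (metis mult.assoc)
    also have "\<dots> = (x * u (n - 1)) * t n * (t (n - 1) * y)"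
      unfolding ttu by (simp add: mult.assoc)
    finally have "t n * z * u n = (x * u (n - 1)) * t n * (t (n - 1) * y)" .
    moreover have "B n q (x * u (n - 1))" "B n r (t (n - 1) * y)"
      using B_mult[OF B_mono[OF *(2), of n] B_u[OF n1]] B_mult[OF B_t[OF n1] B_mono[OF *(3), of n]]
      by simp_all
    ultimately have "mid t (Suc n) p (t n * z * u n)"
      using *(4) assms(2) by (intro midI) auto
    thus ?thesis ..
  qed
  thus "aspan (\<lambda>z. low (Suc n) p z \<or> mid t (Suc n) p z) (t n * z * u n)"
    by (rule aspan_base)
qed (simp_all add: distrib_left distrib_right)

text \<open>Expanding \<open>t\<^sub>k\<inverse> = t\<^sub>k - m\<close> in the definition of \<open>M n\<close>.\<close>

lemma M_L: "1 \<le> n \<Longrightarrow> \<exists>k. K n True k \<and> M n = L n + k"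
proof (induction n rule: dec_induct)
  case base
  show ?case
    by (rule exI[of _ 0]) (simp add: K_def aspan_zero)
next
  case (step n)
  then obtain k where k: "K n True k" "M n = L n + k"
    by blast
  have u: "u n = t n - sc m"
    by (simp add: t_eq)
  have "t n * L n * u n = L (Suc n) - sc m * t n * L n"
    unfolding u using step.hyps
    by (simp add: right_diff_distrib) (metis mult.assoc sc_central)
  hence "M (Suc n) = L (Suc n) + (sc (- m) * t n * L n + t n * k * u n)"
    using k(2) step.hyps by (simp add: distrib_left distrib_right sc_neg)
  moreover have "K (Suc n) True (sc (- m) * t n * L n)"
    unfolding K_def using step.hyps B_sc B_L
    by (intro aspan_base disjI2 midI[of _ False _ True]) auto
  hence "K (Suc n) True (sc (- m) * t n * L n + t n * k * u n)"
    using t_conj_K[OF k(1) step.hyps(1)] unfolding K_def by (rule aspan_add)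
  ultimately show ?case
    by blast
qed

end

text \<open>The difference of two Markov traces in one rank, once it vanishes one rank below. Only
  even arguments are constrained, so \<open>phi_mid\<close> takes two factors of equal parity.
  \<open>\<epsilon>\<close> admits values in an extension of the scalars.\<close>

locale markov_zero = hecke_B sc S u t m
  for sc :: "'k::field \<Rightarrow> 'b::ring_1" and S u t m +
  fixes \<phi> :: "'b \<Rightarrow> 'r::field" and \<epsilon> :: "'k \<Rightarrow> 'r" and n :: nat
  assumes phi_add: "B n False x \<Longrightarrow> B n False y \<Longrightarrow> \<phi> (x + y) = \<phi> x + \<phi> y"
    and phi_scale: "B n False x \<Longrightarrow> \<phi> (sc c * x) = \<epsilon> c * \<phi> x"
    and phi_trace: "B n False x \<Longrightarrow> B n False y \<Longrightarrow> \<phi> (x * y) = \<phi> (y * x)"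
    and phi_low: "B (n - 1) False x \<Longrightarrow> \<phi> x = 0"
    and phi_mid: "B (n - 1) p x \<Longrightarrow> B (n - 1) p y \<Longrightarrow> \<phi> (x * t (n - 1) * y) = 0"
    and n_ge_2: "2 \<le> n"
begin

lemma phi_zero: "\<phi> 0 = 0"
proof -
  have "\<phi> 0 + \<phi> 0 = \<phi> 0"
    using phi_add[OF B_zero B_zero] by (simp only: add_0_left)
  thus ?thesis
    by (simp only: add_cancel_left_left)
qed

text \<open>The first factor of the tail is
  \<open>L (Suc (Suc k)) = t (Suc k) * L (Suc k) * t (Suc k)\<close>. Its right-hand
  \<open>t (Suc k)\<close> commutes with the later factors and returns to the front by the trace
  property, so the tail becomes one factor shorter.\<close>

lemma phi_pull_t:
  assumes "Suc k < n" "B (Suc k) p z" "p = odd (n - Suc k)"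
  shows "\<phi> (z * Xp n (Suc k)) =
    \<phi> (t (Suc k) * z * t (Suc k) * L (Suc k) * Xp n (Suc (Suc k)))"
    and "B n False (t (Suc k) * z * t (Suc k) * L (Suc k) * Xp n (Suc (Suc k)))"
proof -
  define s X where "s = t (Suc k)" and "X = Xp n (Suc (Suc k))"
  have s: "B n False s"
    unfolding s_def using assms(1) by (intro B_t) auto
  have sX: "X * s = s * X"
    unfolding s_def X_def using assms(1) by (intro Xp_commute[OF B_t]) auto
  have par: "odd (n - Suc (Suc k)) = (\<not> p)"
    using assms(1,3) by (simp add: Suc_diff_Suc[symmetric])
  have "B n p (z * s)"
    using B_mult[OF B_mono[OF assms(2), of n] s] assms(1) by simp
  moreover have "B n True (L (Suc k))"
    using B_mono[OF B_L[of "Suc k"], of n] assms(1) by simp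
  ultimately have "B n (\<not> p) (z * s * L (Suc k))"
    by (rule B_mult) simp
  moreover have "B n (\<not> p) X"
    using B_Xp[of "Suc (Suc k)" n] assms(1) par by (simp add: X_def)
  ultimately have B1: "B n False (z * s * L (Suc k) * X)"
    by (rule B_mult) simp
  have "z * Xp n (Suc k) = z * s * L (Suc k) * (s * X)"
    using assms(1) by (simp add: Xp_step s_def X_def mult.assoc)
  also have "\<dots> = (z * s * L (Suc k) * X) * s"
    unfolding sX[symmetric] by (simp add: mult.assoc)
  finally show "\<phi> (z * Xp n (Suc k)) =
    \<phi> (t (Suc k) * z * t (Suc k) * L (Suc k) * Xp n (Suc (Suc k)))"
    using phi_trace[OF B1 s] by (simp add: s_def X_def mult.assoc)
  show "B n False (t (Suc k) * z * t (Suc k) * L (Suc k) * Xp n (Suc (Suc k)))"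
    using B_mult[OF s B1, of False] by (simp add: s_def X_def mult.assoc)
qed

text \<open>Downward induction from \<open>k = n - 1\<close>, where this is \<open>phi_mid\<close>:
  after \<open>phi_pull_t\<close> the braid relation turns
  \<open>t (Suc k) * t k * t (Suc k)\<close> into \<open>t k * t (Suc k) * t k\<close>, which gives
  an instance for \<open>Suc k\<close>.\<close>

lemma phi_mid_Xp:
  "k \<le> n - 1 \<Longrightarrow> 1 \<le> k \<Longrightarrow> B k p x \<Longrightarrow> B k q y \<Longrightarrow> (p \<noteq> q) = odd (n - Suc k) \<Longrightarrow>
    \<phi> (x * t k * y * Xp n (Suc k)) = 0"
proof (induction k arbitrary: p q x y rule: inc_induct)
  case base
  have "p = q"
    using base.prems n_ge_2 by simp
  thus ?case
    using phi_mid base.prems n_ge_2 by simp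
next
  case (step k)
  define s X where "s = t (Suc k)" and "X = Xp n (Suc (Suc k))"
  have k: "Suc k < n"
    using step.hyps by simp
  have Bt: "B (Suc k) False (t k)"
    using step.prems by (intro B_t) auto
  have xk: "B (Suc k) p (x * t k)"
    by (rule B_mult[OF B_mono[OF step.prems(2)] Bt]) simp_all
  have yk: "B (Suc k) q y"
    using B_mono[OF step.prems(3)] by simp
  have "B (Suc k) (p \<noteq> q) (x * t k * y)"
    by (rule B_mult[OF xk yk]) simp
  hence "\<phi> (x * t k * y * Xp n (Suc k)) = \<phi> (s * (x * t k * y) * s * L (Suc k) * X)"
    unfolding s_def X_def using phi_pull_t(1)[OF k] step.prems(4) by blast
  also have "s * (x * t k * y) * s = x * (s * t k * s) * y"
    using t_B_commute[OF step.prems(2), of "Suc k"] t_B_commute[OF step.prems(3), of "Suc k"]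
    unfolding s_def by (simp add: mult.assoc) (metis mult.assoc)
  also have "s * t k * s = t k * s * t k"
    using t_braid[OF step.prems(1)] by (simp add: s_def)
  also have "x * (t k * s * t k) * y * L (Suc k) * X = (x * t k) * s * (t k * y * L (Suc k)) * X"
    by (simp add: mult.assoc)
  also have "\<phi> \<dots> = 0"
    unfolding s_def X_def
  proof (rule step.IH[OF _ xk])
    have "B (Suc k) q (t k * y)"
      by (rule B_mult[OF Bt yk]) simp
    thus "B (Suc k) (\<not> q) (t k * y * L (Suc k))"
      by (rule B_mult[OF _ B_L]) simp_all
    show "(p \<noteq> (\<not> q)) = odd (n - Suc (Suc k))"
      using step.prems(4) k by (auto simp: Suc_diff_Suc[symmetric])
  qed simp
  finally show ?case .
qed

text \<open>The same descent. Here \<open>t (Suc k)\<close> meets itself across \<open>x\<close>,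
  and the quadratic relation leaves one term of the same kind for \<open>Suc k\<close> and one
  covered by \<open>phi_mid_Xp\<close>.\<close>

lemma phi_low_Xp:
  "k \<le> n - 1 \<Longrightarrow> B k p x \<Longrightarrow> p = odd (n - Suc k) \<Longrightarrow> \<phi> (x * Xp n (Suc k)) = 0"
proof (induction k arbitrary: p x rule: inc_induct)
  case base
  thus ?case
    using phi_low n_ge_2 by simp
next
  case (step k)
  define s X where "s = t (Suc k)" and "X = Xp n (Suc (Suc k))"
  have k: "Suc k < n"
    using step.hyps by simp
  have par: "(\<not> p) = odd (n - Suc (Suc k))"
    using step.prems k by (simp add: Suc_diff_Suc[symmetric])
  have xk: "B (Suc k) p x"
    using B_mono[OF step.prems(1)] by simp
  have "s * x * s = x * (s * s)"
    using t_B_commute[OF step.prems(1), of "Suc k"] by (simp add: s_def mult.assoc)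
  also have "\<dots> = x + sc m * x * s"
    unfolding s_def by (simp add: t_t distrib_left) (metis mult.assoc sc_central)
  finally have eq: "s * x * s * L (Suc k) * X = x * L (Suc k) * X + (sc m * x) * s * L (Suc k) * X"
    by (simp add: distrib_right)
  have BL: "B (Suc k) True (L (Suc k))"
    by (rule B_L) simp
  have BX: "B n (\<not> p) X"
    using B_Xp[of "Suc (Suc k)" n] k par by (simp add: X_def)
  have x1: "B (Suc k) (\<not> p) (x * L (Suc k))"
    by (rule B_mult[OF xk BL]) simp
  have x2: "B (Suc k) p (sc m * x)"
    by (rule B_scale[OF xk])
  have b1: "B n False (x * L (Suc k) * X)"
    by (rule B_mult[OF B_mono[OF x1] BX]) (use k in simp_all)
  have s: "B n False s"
    unfolding s_def using k by (intro B_t) auto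
  have "B n p ((sc m * x) * s)"
    by (rule B_mult[OF B_mono[OF x2] s]) (use k in simp_all)
  hence "B n (\<not> p) ((sc m * x) * s * L (Suc k))"
    by (rule B_mult[OF _ B_mono[OF BL]]) (use k in simp_all)
  hence b2: "B n False ((sc m * x) * s * L (Suc k) * X)"
    by (rule B_mult[OF _ BX]) simp
  have "\<phi> (x * Xp n (Suc k)) = \<phi> (s * x * s * L (Suc k) * X)"
    unfolding s_def X_def using phi_pull_t(1)[OF k xk step.prems(2)] .
  also have "\<dots> = \<phi> (x * L (Suc k) * X) + \<phi> ((sc m * x) * s * L (Suc k) * X)"
    unfolding eq by (rule phi_add[OF b1 b2])
  also have "\<phi> (x * L (Suc k) * X) = 0"
    unfolding X_def by (rule step.IH[OF x1 par])
  also have "\<phi> ((sc m * x) * s * L (Suc k) * X) = 0"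
    unfolding X_def s_def
    by (rule phi_mid_Xp[OF _ _ x2 BL]) (use k par in auto)
  finally show ?case
    by simp
qed

lemma phi_aspan:
  assumes "aspan P x" and "\<And>x. P x \<Longrightarrow> B k p x \<and> \<phi> (x * Xp n k) = 0"
    and "k \<le> n" "p = odd (n - k)"
  shows "\<phi> (x * Xp n k) = 0"
proof -
  have BX: "B n p (Xp n k)"
    using B_Xp assms by simp
  have "B k p x \<and> \<phi> (x * Xp n k) = 0"
    using assms(1)
  proof (induction rule: aspan.induct)
    case (aspan_add x y)
    have "B n False (z * Xp n k)" if "B k p z" for z
      by (rule B_mult[OF B_mono[OF that assms(3)] BX]) simp
    thus ?case
      using aspan_add phi_add B_add by (simp add: distrib_right)
  qed (use assms(2) phi_zero B_zero in auto)
  thus ?thesis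
    by blast
qed

lemma phi_low_mid:
  assumes "low (Suc k) p x \<or> mid t (Suc k) p x" "Suc k \<le> n" "p = odd (n - Suc k)"
  shows "B (Suc k) p x \<and> \<phi> (x * Xp n (Suc k)) = 0"
  using assms(1)
proof
  assume "low (Suc k) p x"
  thus ?thesis
    using phi_low_Xp assms(2,3) B_mono by (simp add: low_def)
next
  assume "mid t (Suc k) p x"
  then obtain q r y z where "2 \<le> Suc k" "B (Suc k - 1) q y" "B (Suc k - 1) r z" "p = (q \<noteq> r)"
    "x = y * t (Suc k - 1) * z"
    by (rule midE)
  hence *: "1 \<le> k" "B k q y" "B k r z" "p = (q \<noteq> r)" "x = y * t k * z"
    by simp_all
  have "B (Suc k) q (y * t k)"
    by (rule B_mult[OF B_mono[OF *(2)] B_t]) (use *(1) in simp_all)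
  hence "B (Suc k) p x"
    unfolding *(5) by (rule B_mult[OF _ B_mono[OF *(3)]]) (use *(4) in simp_all)
  moreover have "\<phi> (x * Xp n (Suc k)) = 0"
    unfolding *(5) by (rule phi_mid_Xp[OF _ *(1,2,3)]) (use assms(2,3) *(4) in simp_all)
  ultimately show ?thesis ..
qed

lemma phi_K:
  assumes "K (Suc k) p x" "Suc k \<le> n" "p = odd (n - Suc k)"
  shows "\<phi> (x * Xp n (Suc k)) = 0"
  using assms unfolding K_def by (intro phi_aspan[OF _ phi_low_mid]) auto

text \<open>Replacing \<open>M (Suc k)\<close> by \<open>L (Suc k)\<close> costs an error in
  \<open>K\<close>, which \<open>phi_K\<close> kills. The power of \<open>S\<close> keeps every
  intermediate product even.\<close>

lemma phi_V:
  assumes "even n" "1 \<le> k" "k \<le> n"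
  shows "\<phi> (V k * Sp (n - k) * Xp n k) = \<phi> (Xp n 0)"
  using assms(2,3)
proof (induction k rule: dec_induct)
  case base
  have "odd (n - 1)"
    using assms(1) n_ge_2 by simp
  thus ?case
    using n_ge_2 Xp_step[of 0 n] by (simp add: V_def S_S Sp_def)
next
  case (step k)
  obtain x where x: "K (Suc k) True x" "M (Suc k) = L (Suc k) + x"
    using M_L[of "Suc k"] by auto
  define p where "p = odd (n - Suc k)"
  have BSp: "B k p (Sp (n - Suc k))"
    unfolding p_def by (rule B_Sp) (use step.hyps in simp)
  have VS: "B k True (V k * S)"
    by (rule B_mult[OF B_V B_S]) (use step.hyps in simp_all)
  have BX: "B n p (Xp n (Suc k))"
    unfolding p_def by (rule B_Xp) (use step.prems in simp)
  have L_Sp: "L (Suc k) * Sp (n - Suc k) = Sp (n - Suc k) * L (Suc k)"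
    by (rule L_B_commute[OF BSp]) simp
  have SSp: "S * Sp (n - Suc k) = Sp (n - k)"
    using step.prems by (simp add: Suc_diff_Suc[symmetric] Sp_Suc)
  have X: "L (Suc k) * Xp n (Suc k) = Xp n k"
    using Xp_step[of k n] step.prems by simp
  have "V k * S * L (Suc k) * Sp (n - Suc k) * Xp n (Suc k) =
      V k * S * (L (Suc k) * Sp (n - Suc k)) * Xp n (Suc k)"
    by (simp only: mult.assoc)
  also have "\<dots> = V k * (S * Sp (n - Suc k)) * (L (Suc k) * Xp n (Suc k))"
    unfolding L_Sp by (simp only: mult.assoc)
  also have "\<dots> = V k * Sp (n - k) * Xp n k"
    unfolding SSp X ..
  finally have "V k * S * L (Suc k) * Sp (n - Suc k) * Xp n (Suc k) = V k * Sp (n - k) * Xp n k" .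
  hence eq: "V (Suc k) * Sp (n - Suc k) * Xp n (Suc k) =
    V k * Sp (n - k) * Xp n k + V k * S * x * Sp (n - Suc k) * Xp n (Suc k)"
    unfolding V_Suc x(2) by (simp add: distrib_left distrib_right mult.assoc)
  have Kx: "K (Suc k) p (V k * S * x * Sp (n - Suc k))"
    using K_right[OF K_left[OF x(1), of True "V k * S"], of p "Sp (n - Suc k)"] VS BSp by simp
  have b1: "B n False (V k * Sp (n - k) * Xp n k)"
  proof (rule B_mult[OF B_mult[OF B_mono[OF B_V] B_Sp refl] B_Xp])
    show "False = ((False \<noteq> odd (n - k)) \<noteq> odd (n - k))"
      by simp
  qed (use step.prems n_ge_2 in simp_all)
  have "B n False (V (Suc k) * Sp (n - Suc k) * Xp n (Suc k))"
  proof (rule B_mult[OF B_mult[OF B_mono[OF B_V] B_Sp refl] B_Xp])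
    show "False = ((False \<noteq> odd (n - Suc k)) \<noteq> odd (n - Suc k))"
      by simp
  qed (use step.prems n_ge_2 in simp_all)
  hence b2: "B n False (V k * S * x * Sp (n - Suc k) * Xp n (Suc k))"
    using B_diff[OF _ b1] unfolding eq by fastforce
  show ?case
    unfolding eq phi_add[OF b1 b2]
    using step.IH step.prems phi_K[OF Kx] by (simp add: p_def)
qed

text \<open>Induction on \<open>k\<close> for arguments \<open>z * Xp n k\<close>: in the
  decomposition of \<open>z\<close> only the \<open>high\<close> summand survives, and its factor
  \<open>L k\<close> joins the tail. At \<open>k = 0\<close> there remains a multiple of L_1 ...
  L_n. For odd \<open>n\<close> parity makes the coefficient 0; for even \<open>n\<close> the value
  is that at \<open>V n\<close>.\<close>

theorem phi_vanishes:
  assumes V: "even n \<Longrightarrow> \<phi> (V n) = 0" and "B n False x"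
  shows "\<phi> x = 0"
proof -
  have "\<phi> (z * Xp n k) = 0" if "k \<le> n" "B k p z" "p = odd (n - k)" for k p z
    using that
  proof (induction k arbitrary: p z)
    case 0
    show ?case
    proof (cases p)
      case True
      thus ?thesis
        using B_0_True[OF 0(2)] phi_zero by simp
    next
      case False
      then obtain c where "z = sc c"
        using B_0_False 0 by blast
      moreover have "even n"
        using 0 False by simp
      hence "\<phi> (Xp n 0) = 0"
        using phi_V[of n] V n_ge_2 by (simp add: Sp_def)
      moreover have "B n False (Xp n 0)"
        using B_Xp[of 0 n] \<open>even n\<close> by simp
      ultimately show ?thesis
        using phi_scale by simp
    qed
  next
    case (Suc k)
    have "aspan (\<lambda>z. low (Suc k) p z \<or> mid t (Suc k) p z \<or> high L (Suc k) p z) z"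
      using B_Dec[of "Suc k" p z] Suc.prems by (simp add: Dec_def)
    thus ?case
    proof (rule phi_aspan)
      fix x assume "low (Suc k) p x \<or> mid t (Suc k) p x \<or> high L (Suc k) p x"
      then consider "low (Suc k) p x \<or> mid t (Suc k) p x" | y where "B k (\<not> p) y" "x = y * L (Suc k)"
        by (auto simp: high_def)
      thus "B (Suc k) p x \<and> \<phi> (x * Xp n (Suc k)) = 0"
      proof cases
        case 1
        thus ?thesis
          using phi_low_mid Suc.prems by blast
      next
        case 2
        have "B (Suc k) p x"
          unfolding 2(2) by (rule B_mult[OF B_mono[OF 2(1)] B_L]) simp_all
        moreover have "\<phi> (y * Xp n k) = 0"
          by (rule Suc.IH[OF _ 2(1)]) (use Suc.prems in \<open>auto simp: Suc_diff_Suc[symmetric] Suc_le_eq\<close>)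
        ultimately show ?thesis
          using 2(2) Xp_step[of k n] Suc.prems by (simp add: mult.assoc)
      qed
    qed (use Suc.prems in simp_all)
  qed
  from this[of n False x] assms(2) show ?thesis
    by simp
qed

end

subsection \<open>The trace of the element \<open>\<delta>\<close>\<close>

text \<open>The parts of even and odd degree of \<open>\<Prod>\<^sub>i (1 + y \<xi>\<^sub>i + a \<xi>\<^sub>i\<^sup>2)\<close>.\<close>

primrec parity_prod :: "'b::ring_1 \<Rightarrow> 'b \<Rightarrow> (nat \<Rightarrow> 'b) \<Rightarrow> nat \<Rightarrow> 'b \<times> 'b" where
  "parity_prod y a \<xi> 0 = (1, 0)"
| "parity_prod y a \<xi> (Suc n) =
    (fst (parity_prod y a \<xi> n) * (1 + a * (\<xi> (Suc n) * \<xi> (Suc n))) + y * snd (parity_prod y a \<xi> n) * \<xi> (Suc n),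
     snd (parity_prod y a \<xi> n) * (1 + a * (\<xi> (Suc n) * \<xi> (Suc n))) + y * fst (parity_prod y a \<xi> n) * \<xi> (Suc n))"

definition even_prod :: "'b::ring_1 \<Rightarrow> 'b \<Rightarrow> (nat \<Rightarrow> 'b) \<Rightarrow> nat \<Rightarrow> 'b" where
  "even_prod y a \<xi> n = fst (parity_prod y a \<xi> n)"

definition odd_prod :: "'b::ring_1 \<Rightarrow> 'b \<Rightarrow> (nat \<Rightarrow> 'b) \<Rightarrow> nat \<Rightarrow> 'b" where
  "odd_prod y a \<xi> n = snd (parity_prod y a \<xi> n)"

lemma even_prod_Suc:
  "even_prod y a \<xi> (Suc n) =
    even_prod y a \<xi> n * (1 + a * (\<xi> (Suc n) * \<xi> (Suc n))) + y * odd_prod y a \<xi> n * \<xi> (Suc n)"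
  and odd_prod_Suc:
  "odd_prod y a \<xi> (Suc n) =
    odd_prod y a \<xi> n * (1 + a * (\<xi> (Suc n) * \<xi> (Suc n))) + y * even_prod y a \<xi> n * \<xi> (Suc n)"
  by (simp_all add: even_prod_def odd_prod_def)

lemma parity_prod_0 [simp]: "even_prod y a \<xi> 0 = 1" "odd_prod y a \<xi> 0 = 0"
  by (simp_all add: even_prod_def odd_prod_def)

definition full_prod :: "'b::ring_1 \<Rightarrow> 'b \<Rightarrow> (nat \<Rightarrow> 'b) \<Rightarrow> nat \<Rightarrow> 'b" where
  "full_prod y a \<xi> n = prod_list (map (\<lambda>i. 1 + y * \<xi> i + a * (\<xi> i * \<xi> i)) [1..<Suc n])"

lemma full_prod_0 [simp]: "full_prod y a \<xi> 0 = 1"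
  by (simp add: full_prod_def)

lemma full_prod_Suc:
  "full_prod y a \<xi> (Suc n) =
    full_prod y a \<xi> n * (1 + y * \<xi> (Suc n) + a * (\<xi> (Suc n) * \<xi> (Suc n)))"
  by (simp add: full_prod_def)

text \<open>Replacing \<open>y\<close> by \<open>- y\<close> changes the sign of the odd part only.
  Commutation can therefore be checked on factorised products, at the cost of a division by
  2.\<close>

lemma full_prod_parity:
  assumes "\<And>x. y * x = x * y"
  shows "full_prod y a \<xi> n + full_prod (- y) a \<xi> n = even_prod y a \<xi> n + even_prod y a \<xi> n"
proof -
  have "full_prod y a \<xi> n = even_prod y a \<xi> n + odd_prod y a \<xi> n \<and>
    full_prod (- y) a \<xi> n = even_prod y a \<xi> n - odd_prod y a \<xi> n"
  proof (induction n)
    case (Suc n)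
    show ?case
      unfolding full_prod_Suc even_prod_Suc odd_prod_Suc conjunct1[OF Suc] conjunct2[OF Suc]
      by (simp add: assms[of "even_prod y a \<xi> n"] assms[of "odd_prod y a \<xi> n"] algebra_simps)
  qed simp
  thus ?thesis
    by simp
qed

lemma full_prod_commute_step:
  assumes "\<And>x. y * x = x * y" "\<And>x. a * x = x * a"
    and "w * full_prod y a \<xi> n = full_prod y a \<xi> n * w" "w * \<xi> (Suc n) = \<xi> (Suc n) * w"
  shows "w * full_prod y a \<xi> (Suc n) = full_prod y a \<xi> (Suc n) * w"
proof -
  define x f where "x = \<xi> (Suc n)" and "f = full_prod y a \<xi> n"
  have wx: "w * x = x * w" and wf: "w * f = f * w"
    using assms by (simp_all add: x_def f_def)
  have 1: "w * (y * x) = y * x * w"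
    using wx assms(1) by (metis mult.assoc)
  have 2: "w * (a * (x * x)) = a * (x * x) * w"
    using wx assms(2) by (metis mult.assoc)
  have "w * (1 + y * x + a * (x * x)) = (1 + y * x + a * (x * x)) * w"
    unfolding distrib_left distrib_right 1 2 by simp
  thus ?thesis
    unfolding full_prod_Suc x_def[symmetric] f_def[symmetric] using wf by (metis mult.assoc)
qed

text \<open>Two neighbouring factors multiply to an expression symmetric in \<open>x\<close> and
  \<open>z\<close>, hence to a polynomial in \<open>e = x + z\<close> and \<open>d = x * z\<close>,
  spelled out in \<open>eq\<close>. This lets \<open>w\<close> commute with the product although it
  need not commute with either factor.\<close>

lemma full_prod_commute_pair:
  assumes y: "\<And>x. y * x = x * y" and a: "\<And>x. a * x = x * a"
    and "w * full_prod y a \<xi> n = full_prod y a \<xi> n * w"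
    and e1: "w * (\<xi> (Suc n) + \<xi> (Suc (Suc n))) = (\<xi> (Suc n) + \<xi> (Suc (Suc n))) * w"
    and e2: "w * (\<xi> (Suc n) * \<xi> (Suc (Suc n))) = \<xi> (Suc n) * \<xi> (Suc (Suc n)) * w"
    and xz: "\<xi> (Suc n) * \<xi> (Suc (Suc n)) = \<xi> (Suc (Suc n)) * \<xi> (Suc n)"
  shows "w * full_prod y a \<xi> (Suc (Suc n)) = full_prod y a \<xi> (Suc (Suc n)) * w"
proof -
  define x z f where "x = \<xi> (Suc n)" and "z = \<xi> (Suc (Suc n))" and "f = full_prod y a \<xi> n"
  define e d where "e = x + z" and "d = x * z"
  have we: "w * e = e * w" and wd: "w * d = d * w" and zx: "z * x = x * z" and wf: "w * f = f * w"
    using assms by (simp_all add: e_def d_def x_def z_def f_def)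
  have zx': "z * (x * v) = x * (z * v)" for v
    using zx by (metis mult.assoc)
  have c: "x * y = y * x" "z * y = y * z" "x * a = a * x" "z * a = a * z" "a * y = y * a"
    "x * (y * v) = y * (x * v)" "z * (y * v) = y * (z * v)" "x * (a * v) = a * (x * v)"
    "z * (a * v) = a * (z * v)" "a * (y * v) = y * (a * v)" for v
    using y a by (metis mult.assoc)+
  have eq: "(1 + y * x + a * (x * x)) * (1 + y * z + a * (z * z)) =
    1 + y * e + y * (y * d) + a * (e * e - d - d) + y * (a * (d * e)) + a * (a * (d * d))"
    unfolding e_def d_def by (simp add: algebra_simps c zx zx')
  have s: "w * (y * v) = y * v * w" "w * (a * v) = a * v * w" if "w * v = v * w" for v
    using that y a by (metis mult.assoc)+
  have t: "w * (v * v') = v * v' * w" if "w * v = v * w" "w * v' = v' * w" for v v'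
    using that by (metis mult.assoc)
  have "w * (e * e - d - d) = (e * e - d - d) * w"
    unfolding left_diff_distrib right_diff_distrib wd t[OF we we] ..
  hence "w * ((1 + y * x + a * (x * x)) * (1 + y * z + a * (z * z))) =
    ((1 + y * x + a * (x * x)) * (1 + y * z + a * (z * z))) * w"
    unfolding eq using we wd t[OF wd we] t[OF wd wd] s by (simp only: distrib_left distrib_right s) simp
  thus ?thesis
    unfolding full_prod_Suc x_def[symmetric] z_def[symmetric] f_def[symmetric]
    using wf by (metis mult.assoc)
qed

text \<open>\<open>tau_u\<close>, \<open>tau_u1\<close> and \<open>tau_Lam\<close> express that the
  trace vanishes on the two upper double cosets, and \<open>tau_S\<close> is the share of the trace
  property that is available for odd elements.\<close>

locale hecke_B_trace = hecke_B sc S u t m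
  for sc :: "'k::field \<Rightarrow> 'b::ring_1" and S u t m +
  fixes \<tau> :: "'b \<Rightarrow> 'k"
  assumes tau_add: "\<tau> (x + y) = \<tau> x + \<tau> y"
    and tau_scale: "\<tau> (sc c * x) = c * \<tau> x"
    and tau_one: "\<tau> 1 = 1"
    and tau_trace: "B n False x \<Longrightarrow> B n False y \<Longrightarrow> \<tau> (x * y) = \<tau> (y * x)"
    and tau_S: "\<tau> (S * x * S) = \<tau> x"
    and tau_u: "2 \<le> n \<Longrightarrow> B n False x \<Longrightarrow> \<tau> (x * u n) = 0"
    and tau_u1: "\<tau> (u 1) = 0"
    and tau_Lam: "2 \<le> n \<Longrightarrow> B (n - 1) True x \<Longrightarrow> \<tau> (x * Lam n) = 0"
begin

section \<open>Conditional expectation onto the algebra one rank below\<close>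

lemma tau_zero: "\<tau> 0 = 0"
  using tau_scale[of 0 0] by simp

lemma tau_neg: "\<tau> (- x) = - \<tau> x"
  using tau_scale[of "-1" x] by (simp add: sc_neg sc_one)

lemma tau_diff: "\<tau> (x - y) = \<tau> x - \<tau> y"
  using tau_add[of x "- y"] by (simp add: tau_neg)

text \<open>The kernel of the conditional expectation onto \<open>B (n - 1)\<close>. It is built
  with \<open>u\<close> because \<open>t (n - 1)\<close> has the component \<open>m\<close> in
  \<open>B (n - 1)\<close>.\<close>

definition N :: "nat \<Rightarrow> bool \<Rightarrow> 'b \<Rightarrow> bool" where
  "N n p = aspan (\<lambda>z. mid u n p z \<or> high Lam n p z)"

lemma N_add: "N n p x \<Longrightarrow> N n p y \<Longrightarrow> N n p (x + y)"
  by (simp add: N_def aspan_add)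

lemma N_left:
  assumes "N n p z" "B (n - 1) q x"
  shows "N n (q \<noteq> p) (x * z)"
proof -
  have "mid u n (q \<noteq> p) (x * z) \<or> high Lam n (q \<noteq> p) (x * z)" if "mid u n p z \<or> high Lam n p z" for z
    using that mid_left[OF _ assms(2)] high_left[OF _ assms(2)] by blast
  note * = this
  show ?thesis
    unfolding N_def
    by (rule aspan_map[where f = "\<lambda>z. x * z", OF assms(1)[unfolded N_def]])
       (simp, simp add: distrib_left, rule aspan_base, rule *)
qed

lemma N_scale: "N n p z \<Longrightarrow> N n p (sc c * z)"
  using N_left[of n p z False "sc c"] B_sc by simp

lemma N_neg: "N n p z \<Longrightarrow> N n p (- z)"
  using N_scale[of n p z "-1"] by (simp add: sc_neg sc_one)

lemma N_diff: "N n p x \<Longrightarrow> N n p y \<Longrightarrow> N n p (x - y)"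
  using N_add[OF _ N_neg, of n p x y] by simp

lemma N_mid: "2 \<le> n \<Longrightarrow> B (n - 1) q x \<Longrightarrow> B (n - 1) r y \<Longrightarrow> p = (q \<noteq> r) \<Longrightarrow> N n p (x * u (n - 1) * y)"
  unfolding N_def by (intro aspan_base disjI1 midI) auto

lemma N_high: "B (n - 1) (\<not> p) x \<Longrightarrow> N n p (x * Lam n)"
  unfolding N_def by (intro aspan_base disjI2) (auto simp: high_def)

text \<open>For even factors the trace property moves \<open>y\<close> to the front and
  \<open>tau_u\<close> applies. Odd factors are made even by inserting \<open>S\<close> on both
  sides of \<open>u n\<close>, with which it commutes for \<open>n \<ge> 2\<close>; in rank one they
  are multiples of \<open>S\<close>, and \<open>tau_S\<close> is used.\<close>

lemma tau_mid: "1 \<le> n \<Longrightarrow> B n p x \<Longrightarrow> B n p y \<Longrightarrow> \<tau> (x * u n * y) = 0"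
proof -
  assume n: "1 \<le> n" and x: "B n p x" and y: "B n p y"
  show ?thesis
  proof (cases "n = 1")
    case True
    obtain c d where "x = (if p then sc c * S else sc c)" "y = (if p then sc d * S else sc d)"
      using B_1[OF x True] B_1[OF y True] by blast
    hence "x * u n * y = sc (c * d) * (S * u 1 * S) \<or> x * u n * y = sc (c * d) * u 1"
      using True sc_central[of d "u 1"] sc_central[of d "S * u 1 "] by (simp add: sc_times mult.assoc split: if_splits)
         (metis mult.assoc)
    thus ?thesis
      using tau_S[of "u 1"] tau_u1 by (auto simp: tau_scale)
  next
    case False
    hence n2: "2 \<le> n"
      using n by simp
    have even: "\<tau> (x * u n * y) = 0" if x: "B n False x" and y: "B n False y" for x y
    proof -
      have "B (Suc n) False (x * u n)" "B (Suc n) False y"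
        using B_mult[OF B_mono[OF x, of "Suc n"] B_u[of n "Suc n"], of False] n B_mono[OF y, of "Suc n"]
        by simp_all
      hence "\<tau> (x * u n * y) = \<tau> (y * (x * u n))"
        by (rule tau_trace)
      also have "\<dots> = \<tau> ((y * x) * u n)"
        by (simp add: mult.assoc)
      also have "\<dots> = 0"
        by (rule tau_u[OF n2 B_mult[OF y x]]) simp
      finally show ?thesis .
    qed
    show ?thesis
    proof (cases p)
      case True
      have "x * u n * y = (x * S) * u n * (S * y)"
        using S_u[OF n2] by (simp add: mult.assoc)
      moreover have "B n False (x * S)" "B n False (S * y)"
        using B_mult[OF x B_S[OF n], of False] B_mult[OF B_S[OF n] y, of False] True by simp_all
      ultimately show ?thesis
        using even by metis
    next
      case False
      thus ?thesis
        using even x y by simp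
    qed
  qed
qed

lemma tau_N:
  assumes "1 \<le> n" "N n p z" "B (n - 1) p x"
  shows "\<tau> (x * z) = 0"
  using assms(2) unfolding N_def
proof (induction rule: aspan.induct)
  case (aspan_base z)
  thus ?case
  proof
    assume "mid u n p z"
    then obtain q r a b where *: "2 \<le> n" "B (n - 1) q a" "B (n - 1) r b" "p = (q \<noteq> r)"
      "z = a * u (n - 1) * b"
      by (rule midE)
    have "B (n - 1) r (x * a)"
      by (rule B_mult[OF assms(3) *(2)]) (use *(4) in auto)
    hence "\<tau> ((x * a) * u (n - 1) * b) = 0"
      using *(1,3) by (intro tau_mid) auto
    thus ?thesis
      by (simp add: *(5) mult.assoc)
  next
    assume "high Lam n p z"
    then obtain a where *: "B (n - 1) (\<not> p) a" "z = a * Lam n"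
      by (auto simp: high_def)
    have b: "B (n - 1) True (x * a)"
      by (rule B_mult[OF assms(3) *(1)]) auto
    show ?thesis
    proof (cases "n = 1")
      case True
      hence "x * a = 0"
        using B_0_True[OF b[simplified True, simplified]] by simp
      thus ?thesis
        by (simp add: *(2) tau_zero flip: mult.assoc)
    next
      case False
      thus ?thesis
        using tau_Lam[OF _ b] assms(1) by (simp add: *(2) mult.assoc)
    qed
  qed
qed (simp_all add: tau_zero tau_add distrib_left)

text \<open>The braid relation settles \<open>mid\<close>, and
  \<open>Lam (Suc n) = u n * Lam n * u n\<close> settles \<open>high\<close>.\<close>

lemma N_conj:
  assumes "1 \<le> n" "N n p z"
  shows "N (Suc n) p (u n * z * u n)"
  using assms(2) unfolding N_def[of n]
proof (induction rule: aspan.induct)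
  case aspan_zero
  show ?case
    by (simp add: N_def aspan.intros)
next
  case (aspan_add x y)
  thus ?case
    by (simp add: distrib_left distrib_right N_add)
next
  case (aspan_base z)
  thus ?case
  proof
    assume "mid u n p z"
    then obtain q r x y where *: "2 \<le> n" "B (n - 1) q x" "B (n - 1) r y" "p = (q \<noteq> r)"
      "z = x * u (n - 1) * y"
      by (rule midE)
    have n1: "1 \<le> n - 1" "n - 1 < n"
      using *(1) by auto
    have b: "u n * u (n - 1) * u n = u (n - 1) * u n * u (n - 1)"
      using u_braid[OF n1(1)] *(1) by simp
    have "u n * z * u n = x * (u n * u (n - 1) * u n) * y"
      using u_B_commute[OF *(2), of n] u_B_commute[OF *(3), of n] assms(1) *(5)
      by (simp add: mult.assoc) (metis mult.assoc)
    also have "\<dots> = (x * u (n - 1)) * u n * (u (n - 1) * y)"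
      unfolding b by (simp add: mult.assoc)
    finally have eq: "u n * z * u n = (x * u (n - 1)) * u n * (u (n - 1) * y)" .
    have "B n q (x * u (n - 1))" "B n r (u (n - 1) * y)"
      using B_mult[OF B_mono[OF *(2), of n] B_u[OF n1]] B_mult[OF B_u[OF n1] B_mono[OF *(3), of n]]
      by simp_all
    thus ?thesis
      unfolding eq using N_mid[of "Suc n" q "x * u (n - 1)" r "u (n - 1) * y" p] *(4) assms(1) by simp
  next
    assume "high Lam n p z"
    then obtain x where x: "B (n - 1) (\<not> p) x" "z = x * Lam n"
      by (auto simp: high_def)
    have "u n * z * u n = x * Lam (Suc n)"
      using u_B_commute[OF x(1), of n] x(2) assms(1) by (simp flip: mult.assoc)
    thus ?thesis
      using N_high[of "Suc n" p x] B_mono[OF x(1), of n] by simp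
  qed
qed

lemma u_square: "1 \<le> n \<Longrightarrow> u n * (u n * x) = x - sc m * u n * x"
  by (simp add: u_u left_diff_distrib flip: mult.assoc)

text \<open>\<open>CN n c z\<close> expresses that the conditional expectation of \<open>z\<close> is the scalar \<open>c\<close>.\<close>

definition CN :: "nat \<Rightarrow> 'k \<Rightarrow> 'b \<Rightarrow> bool" where
  "CN n c z \<longleftrightarrow> N n False (z - sc c)"

text \<open>Conjugating the scalar gives \<open>c\<close> times the square of \<open>u n\<close>,
  which differs from \<open>c\<close> by a multiple of \<open>u n\<close>, a term of expectation
  0.\<close>

lemma CN_conj:
  assumes "1 \<le> n" "CN n c z"
  shows "CN (Suc n) c (u n * z * u n)"
proof -
  have "u n * sc c * u n = sc c * (u n * u n)"
    by (metis mult.assoc sc_central)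
  also have "\<dots> = sc c - sc (c * m) * u n"
    using assms(1) by (simp add: u_u right_diff_distrib sc_times mult.assoc)
  finally have "u n * z * u n - sc c = u n * (z - sc c) * u n - sc (c * m) * u n * 1"
    by (simp add: left_diff_distrib right_diff_distrib)
  moreover have "N (Suc n) False (sc (c * m) * u n * 1)"
    using N_mid[of "Suc n" False "sc (c * m)" False 1 False] assms(1) B_sc B_one by simp
  ultimately show ?thesis
    unfolding CN_def using N_conj[OF assms(1) assms(2)[unfolded CN_def]] N_diff by metis
qed

lemma tau_CN:
  assumes "1 \<le> n" "CN n c z" "B (n - 1) False x"
  shows "\<tau> (x * z) = c * \<tau> x"
proof -
  have "\<tau> (x * (z - sc c)) = 0"
    by (rule tau_N[OF assms(1) assms(2)[unfolded CN_def] assms(3)])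
  thus ?thesis
    by (simp add: right_diff_distrib tau_diff tau_scale flip: sc_central)
qed

lemma Lam_u_N:
  assumes "1 \<le> n" "B n True x"
  shows "N (Suc n) False (x * Lam (Suc n) * u n)"
proof -
  have "x * Lam (Suc n) * u n = x * u n * (Lam n * (u n * u n))"
    using assms(1) by (simp add: mult.assoc)
  also have "\<dots> = x * u n * Lam n - sc m * x * u n * Lam n * u n"
    using assms(1) by (simp add: u_u right_diff_distrib mult.assoc) (metis mult.assoc sc_central)
  also have "\<dots> = x * u n * Lam n - (sc m * x) * Lam (Suc n)"
    using assms(1) by (simp add: mult.assoc)
  finally show ?thesis
    using N_mid[of "Suc n" True x True "Lam n" False] N_high[of "Suc n" False "sc m * x"]
      assms B_Lam[OF assms(1)] B_scale by (simp add: N_diff)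
qed

lemma Lam_conj:
  assumes "1 \<le> n" "B n p z"
  shows "Lam (Suc n) * (u n * z * u n) = u n * (Lam n * z) * u n - sc m * (u n * Lam n * u n * z * u n)"
  using assms(1) by (simp add: mult.assoc u_square right_diff_distrib) (metis mult.assoc sc_central)

text \<open>Up to a multiple of \<open>Lam n * Lam (Suc n) * u n\<close>, which has expectation 0,
  the square is conjugated from one rank below. Since \<open>Lam n\<close> itself has expectation 0,
  the factor \<open>1 + y Lam + a Lam^2\<close> has expectation 1 + a; this is the constant
  \<rho>.\<close>

lemma Lam_square_CN: "1 \<le> n \<Longrightarrow> CN n 1 (Lam n * Lam n)"
proof (induction n rule: dec_induct)
  case base
  show ?case
    by (simp add: CN_def S_S sc_one N_def aspan_zero)
next
  case (step n)
  have n: "1 \<le> n"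
    using step.hyps by simp
  have L: "B n True (Lam n)"
    by (rule B_Lam[OF n])
  have "Lam (Suc n) * Lam (Suc n) = Lam (Suc n) * (u n * Lam n * u n)"
    using n by simp
  also have "\<dots> = u n * (Lam n * Lam n) * u n - sc m * (Lam (Suc n) * Lam n * u n)"
    unfolding Lam_conj[OF n L] using n by (simp add: mult.assoc)
  also have "Lam (Suc n) * Lam n = Lam n * Lam (Suc n)"
    by (rule Lam_B_commute[OF L]) simp
  finally have "Lam (Suc n) * Lam (Suc n) - sc 1 =
    (u n * (Lam n * Lam n) * u n - sc 1) - sc m * (Lam n * Lam (Suc n) * u n)"
    by simp
  thus ?case
    using CN_conj[OF n step.IH] Lam_u_N[OF n L] N_scale N_diff unfolding CN_def by metis
qed

lemma M_conj:
  assumes "1 \<le> n"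
  shows "M (Suc n) = u n * M n * u n + sc m * M n * u n * 1"
  using assms by (simp add: t_eq distrib_right)

lemma M_N: "1 \<le> n \<Longrightarrow> N n True (M n)"
proof (induction n rule: dec_induct)
  case base
  show ?case
    using N_high[of 1 True 1] B_one by simp
next
  case (step n)
  have "N (Suc n) True (sc m * M n * u n * 1)"
    using N_mid[of "Suc n" True "sc m * M n" False 1 True] B_scale[OF B_M[OF step.hyps(1)]]
      B_one step.hyps by simp
  thus ?case
    unfolding M_conj[OF step.hyps(1)] using N_conj[OF step.hyps(1) step.IH] N_add by blast
qed

lemma Lam_M: "1 \<le> n \<Longrightarrow> Lam (Suc n) * M (Suc n) = u n * (Lam n * M n) * u n"
  by (simp add: mult.assoc)

text \<open>The \<open>u n\<close> that ends \<open>Lam (Suc n)\<close> cancels the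
  \<open>t n\<close> that starts \<open>M (Suc n)\<close>, which leaves the same product one rank
  below between two factors \<open>u n\<close>.\<close>

lemma Lam_M_CN: "1 \<le> n \<Longrightarrow> CN n 1 (Lam n * M n)"
proof (induction n rule: dec_induct)
  case base
  show ?case
    by (simp add: CN_def S_S sc_one N_def aspan_zero)
next
  case (step n)
  thus ?case
    unfolding Lam_M[OF step.hyps(1)] by (intro CN_conj) auto
qed

text \<open>After the cancellation of \<open>Lam_M\<close> the second \<open>Lam (Suc n)\<close>
  meets \<open>u n * z * u n\<close> with \<open>z = Lam n * M n\<close>. The quadratic relation
  produces the conjugate of the case below and terms in which \<open>z\<close>, commuting with
  \<open>Lam (Suc n)\<close>, can be moved to the left.\<close>

lemma Lam2_M_N: "1 \<le> n \<Longrightarrow> N n True (Lam n * Lam n * M n)"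
proof (induction n rule: dec_induct)
  case base
  show ?case
    using N_high[of 1 True 1] B_one by (simp add: S_S)
next
  case (step n)
  have n: "1 \<le> n"
    using step.hyps by simp
  define z where "z = Lam n * M n"
  have z: "B n False z"
    unfolding z_def by (rule B_mult[OF B_Lam B_M]) (use n in auto)
  have "Lam (Suc n) * Lam (Suc n) * M (Suc n) = Lam (Suc n) * (u n * z * u n)"
    using n by (simp only: Lam_M[OF n] z_def mult.assoc)
  also have "\<dots> = u n * (Lam n * z) * u n - sc m * (Lam (Suc n) * z * u n)"
    unfolding Lam_conj[OF n z] using n by (simp add: mult.assoc)
  also have "Lam (Suc n) * z = z * Lam (Suc n)"
    by (rule Lam_B_commute[OF z]) simp
  also have "z * Lam (Suc n) * u n = z * u n * Lam n - sc m * z * Lam (Suc n)"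
    using n by (simp add: u_u right_diff_distrib mult.assoc) (metis mult.assoc sc_central)
  finally have eq: "Lam (Suc n) * Lam (Suc n) * M (Suc n) =
    u n * (Lam n * z) * u n - sc m * (z * u n * Lam n - sc m * z * Lam (Suc n))" .
  have "N (Suc n) True (z * u n * Lam n)"
    using N_mid[of "Suc n" False z True "Lam n" True] z B_Lam[OF n] n by simp
  moreover have "N (Suc n) True (sc m * z * Lam (Suc n))"
    using N_high[of "Suc n" True "sc m * z"] B_scale[OF z] by simp
  moreover have "N (Suc n) True (u n * (Lam n * z) * u n)"
    using N_conj[OF n step.IH] by (simp add: z_def mult.assoc)
  ultimately show ?case
    unfolding eq by (intro N_diff N_scale)
qed

text \<open>Of the three terms of a factor \<open>1 + y Lam + a Lam^2\<close>, multiplied by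
  \<open>M\<close>, only the middle one has an expectation; so each U_i contributes one
  \<open>y\<close>.\<close>

lemma M_pieces:
  assumes "1 \<le> n" "B n True g" "B n False h"
  shows "\<tau> (g * M (Suc n)) = 0" "\<tau> (g * (Lam (Suc n) * Lam (Suc n)) * M (Suc n)) = 0"
    "\<tau> (h * Lam (Suc n) * M (Suc n)) = \<tau> h"
  using tau_N[OF _ M_N, of "Suc n" g] tau_N[OF _ Lam2_M_N, of "Suc n" g]
    tau_CN[OF _ Lam_M_CN, of "Suc n" h] assms
  by (simp_all add: mult.assoc del: Lam.simps M.simps)

section \<open>Values of the trace against the image of delta\<close>

definition Pl :: "'k \<Rightarrow> 'k \<Rightarrow> nat \<Rightarrow> 'b" where
  "Pl y a n = even_prod (sc y) (sc a) Lam n"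

definition Ql :: "'k \<Rightarrow> 'k \<Rightarrow> nat \<Rightarrow> 'b" where
  "Ql y a n = odd_prod (sc y) (sc a) Lam n"

lemma PQl_0 [simp]: "Pl y a 0 = 1" "Ql y a 0 = 0"
  by (simp_all add: Pl_def Ql_def even_prod_def odd_prod_def)

lemma PQl_Suc:
  "Pl y a (Suc n) = Pl y a n + sc a * Pl y a n * (Lam (Suc n) * Lam (Suc n)) + sc y * Ql y a n * Lam (Suc n)"
  "Ql y a (Suc n) = Ql y a n + sc a * Ql y a n * (Lam (Suc n) * Lam (Suc n)) + sc y * Pl y a n * Lam (Suc n)"
  unfolding Pl_def Ql_def
  by (simp_all add: even_prod_Suc odd_prod_Suc distrib_left sc_central[of a] mult.assoc del: Lam.simps)

lemma B_PQl: "B n False (Pl y a n) \<and> B n True (Ql y a n)"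
proof (induction n)
  case (Suc n)
  have L: "B (Suc n) True (Lam (Suc n))"
    by (rule B_Lam) simp
  have LL: "B (Suc n) False (Lam (Suc n) * Lam (Suc n))"
    by (rule B_mult[OF L L]) simp
  have P: "B (Suc n) False (Pl y a n)" and Q: "B (Suc n) True (Ql y a n)"
    using Suc B_mono by auto
  show ?case
    unfolding PQl_Suc
    by (intro conjI B_add P Q B_mult[OF B_scale[OF P] LL] B_mult[OF B_scale[OF Q] LL]
        B_mult[OF B_scale[OF P] L] B_mult[OF B_scale[OF Q] L]) simp_all
qed (simp add: B_one B_zero)

text \<open>The last factor commutes with \<open>x\<close> and may be replaced by its
  expectation.\<close>

lemma tau_Pl_embed:
  assumes "B n False x"
  shows "\<tau> (Pl y a (Suc n) * x) = (1 + a) * \<tau> (Pl y a n * x)"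
proof -
  define l where "l = Lam (Suc n)"
  have lx: "l * x = x * l"
    unfolding l_def by (rule Lam_B_commute[OF assms]) simp
  have lx': "l * (x * v) = x * (l * v)" for v
    using lx by (metis mult.assoc)
  have Px: "B n False (Pl y a n * x)" and Qx: "B n True (Ql y a n * x)"
    using B_mult[OF conjunct1[OF B_PQl] assms] B_mult[OF conjunct2[OF B_PQl] assms] by auto
  have "Pl y a (Suc n) * x =
    Pl y a n * x + sc a * (Pl y a n * x * (l * l)) + sc y * (Ql y a n * x * l)"
    unfolding PQl_Suc l_def[symmetric] by (simp add: distrib_right mult.assoc lx lx')
  moreover have "\<tau> (Pl y a n * x * (l * l)) = \<tau> (Pl y a n * x)"
    using tau_CN[OF _ Lam_square_CN, of "Suc n" "Pl y a n * x"] Px by (simp add: l_def del: Lam.simps)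
  moreover have "\<tau> (Ql y a n * x * l) = 0"
    using tau_N[of "Suc n" True l "Ql y a n * x"]
      N_high[of "Suc n" True 1] B_one Qx by (simp add: l_def del: Lam.simps)
  ultimately show ?thesis
    by (simp add: tau_add tau_scale algebra_simps)
qed

text \<open>With \<open>t n = u n + m\<close> the constant term of the last factor contributes
  \<open>m\<close>. In the other two terms \<open>t n\<close> cancels a \<open>u n\<close> of
  \<open>Lam (Suc n)\<close>, and what remains has expectation 0.\<close>

lemma tau_Pl_gen:
  assumes "1 \<le> n" "B n False x"
  shows "\<tau> (Pl y a (Suc n) * x * t n) = m * \<tau> (Pl y a n * x)"
proof -
  define l k where "l = Lam (Suc n)" and "k = Lam n"
  have lx: "l * x = x * l"
    unfolding l_def by (rule Lam_B_commute[OF assms(2)]) simp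
  have lx': "l * (x * v) = x * (l * v)" for v
    using lx by (metis mult.assoc)
  have k: "B n True k"
    unfolding k_def by (rule B_Lam[OF assms(1)])
  have kk: "B n False (k * k)"
    by (rule B_mult[OF k k]) simp
  have lk: "l * k = k * l"
    unfolding l_def by (rule Lam_B_commute[OF k]) simp
  have l: "l = u n * k * u n"
    using assms(1) by (simp add: l_def k_def)
  have lt: "l * t n = u n * k"
    unfolding l using assms(1) by (simp add: mult.assoc)
  have lu: "l * u n = u n * k - sc m * l"
    unfolding l using assms(1)
    by (simp add: mult.assoc u_u right_diff_distrib) (metis mult.assoc sc_central)
  have llt: "l * l * t n = u n * (k * k) - sc m * (k * l)"
  proof -
    have "l * l * t n = l * u n * k"
      by (simp add: mult.assoc lt)
    also have "\<dots> = u n * (k * k) - sc m * (l * k)"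
      unfolding lu by (simp add: left_diff_distrib mult.assoc)
    finally show ?thesis
      unfolding lk .
  qed
  define p q where "p = Pl y a n * x" and "q = Ql y a n * x"
  have p: "B n False p" and q: "B n True q"
    unfolding p_def q_def
    using B_mult[OF conjunct1[OF B_PQl] assms(2)] B_mult[OF conjunct2[OF B_PQl] assms(2)] by auto
  have "Pl y a (Suc n) * x = p + sc a * (p * (l * l)) + sc y * (q * l)"
    unfolding PQl_Suc l_def[symmetric] p_def q_def by (simp add: distrib_right mult.assoc lx lx')
  hence "Pl y a (Suc n) * x * t n = p * t n + sc a * (p * (l * l * t n)) + sc y * (q * (l * t n))"
    by (simp add: distrib_right mult.assoc)
  also have "\<dots> = p * u n * 1 + sc m * p + sc a * (p * u n * (k * k) - sc m * (p * k * l)) + sc y * (q * u n * k)"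
  proof -
    have pm: "p * (sc m * v) = sc m * (p * v)" for v
      by (metis mult.assoc sc_central)
    show ?thesis
      unfolding llt lt unfolding t_eq
      by (simp add: distrib_left right_diff_distrib mult.assoc pm sc_central[of m p])
  qed
  finally have eq: "Pl y a (Suc n) * x * t n =
    p * u n * 1 + sc m * p + sc a * (p * u n * (k * k) - sc m * (p * k * l)) + sc y * (q * u n * k)" .
  have "\<tau> (p * u n * 1) = 0" "\<tau> (p * u n * (k * k)) = 0" "\<tau> (q * u n * k) = 0"
    using tau_mid[OF assms(1) p B_one] tau_mid[OF assms(1) p kk] tau_mid[OF assms(1) q k] by auto
  moreover have "\<tau> (p * k * l) = 0"
    using tau_N[of "Suc n" True l "p * k"] N_high[of "Suc n" True 1] B_one B_mult[OF p k, of True]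
    by (simp add: l_def del: Lam.simps)
  ultimately show ?thesis
    unfolding eq by (simp add: tau_add tau_diff tau_scale p_def)
qed

text \<open>As the evaluation needs an even element, odd \<open>n\<close> uses the odd part of the
  product and a compensating \<open>S\<close>. One more factor alternates the two forms and extracts
  a \<open>y\<close>; \<open>tau_S\<close> brings the compensating \<open>S\<close> to the
  front.\<close>

lemma tau_Pl_V:
  assumes "1 \<le> n"
  shows "(even n \<longrightarrow> \<tau> (Pl y a n * V n) = y ^ n) \<and> (odd n \<longrightarrow> \<tau> (Ql y a n * V n * S) = y ^ n)"
  using assms
proof (induction n rule: dec_induct)
  case base
  have "Ql y a 1 = sc y * S" "V 1 = 1"
    using PQl_Suc(2)[of y a 0] by (simp_all add: V_def S_S)
  thus ?case
    using tau_scale[of y 1] by (simp add: mult.assoc S_S tau_one)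
next
  case (step n)
  define l g where "l = Lam (Suc n)" and "g = V n * S"
  have g: "B n True g"
    unfolding g_def by (rule B_mult[OF B_V B_S]) (use step.hyps in auto)
  have lg: "l * g = g * l"
    unfolding l_def by (rule Lam_B_commute[OF g]) simp
  have S: "B n True S"
    by (rule B_S) (use step.hyps in simp)
  have P: "B n False (Pl y a n)" and Q: "B n True (Ql y a n)"
    using B_PQl by blast+
  have V': "V (Suc n) = g * M (Suc n)"
    by (simp add: V_Suc g_def mult.assoc)
  have expand: "(p + sc a * p * (l * l) + sc y * q * l) * V (Suc n) =
    p * g * M (Suc n) + sc a * (p * g * (l * l) * M (Suc n)) + sc y * (q * g * l * M (Suc n))" for p q
  proof -
    have "l * (g * v) = g * (l * v)" for v
      using lg by (metis mult.assoc)
    thus ?thesis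
      unfolding V' by (simp add: distrib_right mult.assoc)
  qed
  have main: "\<tau> ((p + sc a * p * (l * l) + sc y * q * l) * V (Suc n)) = y * \<tau> (q * g)"
    if "B n False p" "B n True q" for p q
    unfolding expand
    using M_pieces[OF step.hyps(1) B_mult[OF that(1) g] B_mult[OF that(2) g]]
    by (simp add: tau_add tau_scale l_def del: Lam.simps M.simps)
  show ?case
  proof (cases "even n")
    case False
    have "\<tau> (Pl y a (Suc n) * V (Suc n)) = y * \<tau> (Ql y a n * g)"
      unfolding PQl_Suc l_def[symmetric] by (rule main[OF P Q])
    thus ?thesis
      using step.IH False by (simp add: g_def mult.assoc)
  next
    case True
    have SP: "B n True (S * Pl y a n)" and SQ: "B n False (S * Ql y a n)"
      using B_mult[OF S P] B_mult[OF S Q] by auto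
    have "\<tau> (Ql y a (Suc n) * V (Suc n) * S) = \<tau> (S * (S * Ql y a (Suc n) * V (Suc n)) * S)"
      by (simp add: mult.assoc)
    also have "\<dots> = \<tau> (S * Ql y a (Suc n) * V (Suc n))"
      by (rule tau_S)
    also have "S * Ql y a (Suc n) = S * Ql y a n + sc a * (S * Ql y a n) * (l * l) + sc y * (S * Pl y a n) * l"
    proof -
      have "S * (sc c * v) = sc c * (S * v)" for c v
        by (metis mult.assoc sc_central)
      thus ?thesis
        unfolding PQl_Suc l_def[symmetric] by (simp add: distrib_left mult.assoc)
    qed
    also have "\<tau> (\<dots> * V (Suc n)) = y * \<tau> (S * Pl y a n * g)"
      by (rule main[OF SQ SP])
    also have "S * Pl y a n * g = S * (Pl y a n * V n) * S"
      by (simp add: g_def mult.assoc)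
    finally show ?thesis
      using step.IH True by (simp add: tau_S)
  qed
qed

lemma tau_Pl: "\<tau> (Pl y a n) = (1 + a) ^ n"
proof (induction n)
  case (Suc n)
  thus ?case
    using tau_Pl_embed[OF B_one, of y a n] by simp
qed (simp add: tau_one)


subsection \<open>Centrality\<close>

text \<open>From \<open>z = u i * x * u i\<close> come \<open>t i * z = x * u i\<close> and
  \<open>z * t i = u i * x\<close>; as \<open>t i - u i\<close> is a scalar, the sum and the product
  commute with \<open>t i\<close>.\<close>

lemma t_Lam_pair:
  assumes "1 \<le> i"
  defines "x \<equiv> Lam i" and "z \<equiv> Lam (Suc i)"
  shows "t i * (x + z) = (x + z) * t i" "t i * (x * z) = x * z * t i" "x * z = z * x"
proof -
  have z: "z = u i * x * u i"
    using assms by simp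
  have xz: "z * x = x * z"
    unfolding z_def by (rule Lam_B_commute[of i True]) (use B_Lam assms(1) in \<open>auto simp: x_def\<close>)
  thus "x * z = z * x" ..
  have tz: "t i * z = x * u i" and zt: "z * t i = u i * x"
    unfolding z using assms(1) by (simp_all add: mult.assoc)
  show "t i * (x + z) = (x + z) * t i"
    unfolding distrib_left distrib_right tz zt
    by (simp add: t_eq distrib_left distrib_right sc_central[of m x])
  have "t i * (x * z) = t i * z * x"
    by (simp add: mult.assoc xz)
  also have "\<dots> = x * (z * t i)"
    by (simp add: tz zt mult.assoc)
  finally show "t i * (x * z) = x * z * t i"
    by (simp add: mult.assoc)
qed

lemma commute_full_prod:
  assumes "1 \<le> i" "i < n"
  shows "t i * full_prod (sc y) (sc a) Lam n = full_prod (sc y) (sc a) Lam n * t i"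
proof -
  have c: "sc c * x = x * sc c" for c x
    by (rule sc_central)
  have comm: "t i * full_prod (sc y) (sc a) Lam j = full_prod (sc y) (sc a) Lam j * t i" if "j < i" for j
    using that
  proof (induction j)
    case (Suc j)
    have "t i * Lam (Suc j) = Lam (Suc j) * t i"
      by (rule t_B_commute[OF B_Lam]) (use Suc.prems in auto)
    thus ?case
      using Suc by (intro full_prod_commute_step c) auto
  qed (simp add: full_prod_def)
  have "t i * full_prod (sc y) (sc a) Lam (Suc (Suc (i - 1))) =
    full_prod (sc y) (sc a) Lam (Suc (Suc (i - 1))) * t i"
    using t_Lam_pair[OF assms(1)] comm[of "i - 1"] assms(1)
    by (intro full_prod_commute_pair c) (simp_all del: Lam.simps)
  hence base: "t i * full_prod (sc y) (sc a) Lam (Suc i) = full_prod (sc y) (sc a) Lam (Suc i) * t i"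
    using assms(1) by simp
  have "Suc i \<le> n"
    using assms by simp
  thus ?thesis
  proof (induction n rule: dec_induct)
    case (step n)
    have "Lam (Suc n) * t i = t i * Lam (Suc n)"
      by (rule Lam_B_commute[OF B_t]) (use step.hyps assms in auto)
    thus ?case
      using step.IH by (intro full_prod_commute_step c) auto
  qed (rule base)
qed

lemma S_commute_full_prod:
  "S * full_prod (sc y) (sc a) Lam n = full_prod (sc y) (sc a) Lam n * S"
proof (induction n)
  case (Suc n)
  thus ?case
    using Lam_S[of "Suc n"] by (intro full_prod_commute_step sc_central) auto
qed (simp add: full_prod_def)

text \<open>\<open>Pl\<close> is half the sum of the full products for \<open>y\<close> and
  \<open>- y\<close>. These commute with \<open>t i\<close> because only the factors
  \<open>i\<close> and \<open>i + 1\<close> are affected, and their product is symmetric.\<close>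

lemma Pl_central:
  assumes "(2 :: 'k) \<noteq> 0" "B n p x"
  shows "Pl y a n * x = x * Pl y a n"
proof (rule commute_B[OF assms(2)])
  have two: "Pl y a n + Pl y a n = full_prod (sc y) (sc a) Lam n + full_prod (sc (- y)) (sc a) Lam n"
    using full_prod_parity[of "sc y" "sc a" Lam n] sc_central[of y] sc_central[of a]
    by (simp add: Pl_def sc_neg)
  have half: "Pl y a n = sc (1 / 2) * (Pl y a n + Pl y a n)"
  proof -
    have "sc (1 / 2) * (Pl y a n + Pl y a n) = sc (1 / 2 + 1 / 2) * Pl y a n"
      by (simp only: sc_plus distrib_left distrib_right)
    thus ?thesis
      using assms(1) by (simp add: sc_one)
  qed
  have *: "Pl y a n * w = w * Pl y a n"
    if "\<And>y. w * full_prod (sc y) (sc a) Lam n = full_prod (sc y) (sc a) Lam n * w" for w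
  proof -
    have "(Pl y a n + Pl y a n) * w = w * (Pl y a n + Pl y a n)"
      unfolding two using that[of y] that[of "- y"] by (simp add: distrib_left distrib_right)
    thus ?thesis
      by (subst (1 2) half) (metis mult.assoc sc_central)
  qed
  show "Pl y a n * S = S * Pl y a n"
    by (rule *) (rule S_commute_full_prod)
  show "Pl y a n * t i = t i * Pl y a n" if "1 \<le> i" "i < n" for i
    by (rule *) (rule commute_full_prod[OF that])
qed

end

section \<open>Finiteness of the parabolic subgroups\<close>

global_interpretation lend: hecke_B sc Sop "uop m" "hop m" m for m :: "'k::field"
proof
  fix c d :: 'k and x :: "'k lend" and i j :: nat
  show "sc 1 = (1 :: 'k lend)" "sc (c + d) = sc c + sc d" "sc (c * d) = sc c * sc d"
    "sc c * x = x * sc c" "Sop * Sop = (1 :: 'k lend)" "hop m i = uop m i + sc m"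
    "uop m i * uop m i = 1 - sc m * uop m i"
    by (simp_all add: sc_add sc_mult Sop_Sop hop_def uop_square) (rule sc_commute)
  show "Sop * uop m i = uop m i * Sop" if "2 \<le> i"
    using that by (simp add: Sop_uop flip_simps)
  \<comment> \<open>\<open>S_u1\<close> is the commutation of the generators 1' and 1, because
    conjugation by \<open>Sop\<close> exchanges them.\<close>
  have 01: "Sop * uop m 1 = uop m 0 * Sop" "Sop * uop m 0 = uop m 1 * Sop"
    by (simp_all add: Sop_uop flip_simps)
  have "uop m 0 * uop m 1 = uop m 1 * uop m 0"
    by (rule uop_commute) (simp_all add: adjacent_def)
  moreover have "Sop * uop m 1 * Sop = uop m 0"
    unfolding 01 by (simp add: mult.assoc Sop_Sop)
  ultimately show "Sop * uop m 1 * Sop * uop m 1 = uop m 1 * Sop * uop m 1 * Sop"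
    by (metis mult.assoc)
  show "uop m i * uop m j = uop m j * uop m i" if "1 \<le> i" "i + 2 \<le> j"
    using that by (intro uop_commute) (auto simp: adjacent_def)
  show "uop m i * uop m (i + 1) * uop m i = uop m (i + 1) * uop m i * uop m (i + 1)" if "1 \<le> i"
    using that by (intro uop_braid) (simp add: adjacent_def)
qed

section \<open>From a finite spanning set of operators to a finite group\<close>

definition span_of :: "'k::field lend set \<Rightarrow> 'k lend \<Rightarrow> bool" where
  "span_of Y = aspan (\<lambda>z. \<exists>c y. y \<in> Y \<and> z = sc c * y)"

lemma span_of_mono: "span_of Y x \<Longrightarrow> Y \<subseteq> Y' \<Longrightarrow> span_of Y' x"
  unfolding span_of_def by (erule aspan_mono) blast

lemma span_of_mult:
  assumes "span_of Y x" "span_of Z z"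
  shows "span_of {y * g * z | y z. y \<in> Y \<and> z \<in> Z} (x * g * z)"
  unfolding span_of_def
proof (rule aspan_map[where f = "\<lambda>x. x * g * z", OF assms(1)[unfolded span_of_def]])
  fix x assume "\<exists>c y. y \<in> Y \<and> x = sc c * y"
  then obtain c y where y: "y \<in> Y" "x = sc c * y"
    by blast
  show "aspan (\<lambda>w. \<exists>c v. v \<in> {y * g * z | y z. y \<in> Y \<and> z \<in> Z} \<and> w = sc c * v) (x * g * z)"
  proof (rule aspan_map[where f = "\<lambda>z. x * g * z", OF assms(2)[unfolded span_of_def]])
    fix w assume "\<exists>d z. z \<in> Z \<and> w = sc d * z"
    then obtain d z where z: "z \<in> Z" "w = sc d * z"
      by blast
    have "x * g * w = sc (c * d) * (y * g * z)"
      unfolding y z sc_mult by (metis mult.assoc sc_commute)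
    thus "aspan (\<lambda>w. \<exists>c v. v \<in> {y * g * z | y z. y \<in> Y \<and> z \<in> Z} \<and> w = sc c * v) (x * g * w)"
      using y z by (intro aspan_base) blast
  qed (simp_all add: distrib_left)
qed (simp_all add: distrib_right)

text \<open>By the decomposition, \<open>B (Suc n)\<close> is spanned by a finite spanning set
  \<open>Y\<close> of \<open>B n\<close> and the products of two elements of \<open>Y\<close> with
  \<open>hop m n\<close> or \<open>L (Suc n)\<close> between them.\<close>

lemma lend_B_finite_span:
  "\<exists>Y. finite Y \<and> (\<forall>y\<in>Y. \<exists>p. lend.B m n p y) \<and> (\<forall>p x. lend.B m n p x \<longrightarrow> span_of Y x)"
proof (induction n)
  case 0
  have "span_of {1} x" if B: "lend.B m 0 p x" for p x
  proof (cases p)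
    case True
    hence "x = 0"
      using lend.B_0_True[OF B] by simp
    thus ?thesis
      by (simp add: span_of_def aspan_zero)
  next
    case False
    then obtain c where "x = sc c"
      using lend.B_0_False[OF B] by blast
    thus ?thesis
      unfolding span_of_def by (intro aspan_base) auto
  qed
  thus ?case
    using lend.B_one[of m 0] by (intro exI[of _ "{1}"]) blast
next
  case (Suc n)
  then obtain Y where Y: "finite Y" "\<And>y. y \<in> Y \<Longrightarrow> \<exists>p. lend.B m n p y"
    "\<And>p x. lend.B m n p x \<Longrightarrow> span_of Y x"
    by blast
  define A where "A g = {y * g * z | y z. y \<in> Y \<and> z \<in> Y}" for g
  have A_fin: "finite (A g)" for g
  proof -
    have "A g = (\<lambda>(y, z). y * g * z) ` (Y \<times> Y)"
      by (auto simp: A_def)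
    thus ?thesis
      using Y(1) by simp
  qed
  define Y' where "Y' = Y \<union> (if 1 \<le> n then A (hop m n) else {}) \<union> A (lend.L m (Suc n))"
  have YB: "\<exists>p. lend.B m (Suc n) p y" if "y \<in> Y'" for y
  proof -
    have *: "\<exists>p. lend.B m (Suc n) p y" if "y \<in> Y" for y
      using Y(2)[OF that] lend.B_mono[of m n _ y "Suc n"] by auto
    have "\<exists>p. lend.B m (Suc n) p (y * g * z)" if "y \<in> Y" "z \<in> Y" "lend.B m (Suc n) q g" for y z q g
      using *[OF that(1)] *[OF that(2)] that(3) lend.B_mult' by blast
    moreover have "lend.B m (Suc n) True (lend.L m (Suc n))"
      by (rule lend.B_L) simp
    moreover have "1 \<le> n \<Longrightarrow> lend.B m (Suc n) False (hop m n)"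
      by (rule lend.B_t) simp_all
    ultimately show ?thesis
      using that * unfolding Y'_def A_def by (auto split: if_splits)
  qed
  have "span_of Y' x" if "lend.B m (Suc n) p x" for p x
  proof -
    have "lend.Dec m (Suc n) p x"
      by (rule lend.B_Dec[OF _ that]) simp
    thus ?thesis
      unfolding lend.Dec_def
    proof (induction rule: aspan.induct)
      case (aspan_base z)
      then consider "lend.low m (Suc n) p z" | "lend.mid m (hop m) (Suc n) p z"
        | "lend.high m (lend.L m) (Suc n) p z"
        by blast
      thus ?case
      proof cases
        case 1
        hence "span_of Y z"
          using Y(3) by (simp add: lend.low_def)
        thus ?thesis
          by (rule span_of_mono) (auto simp: Y'_def)
      next
        case 2
        then obtain q r x y where *: "2 \<le> Suc n" "lend.B m (Suc n - 1) q x" "lend.B m (Suc n - 1) r y"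
          "z = x * hop m (Suc n - 1) * y"
          by (rule lend.midE)
        hence "span_of (A (hop m n)) z"
          using span_of_mult[of Y x Y y "hop m n"] Y(3) by (simp add: A_def)
        thus ?thesis
          by (rule span_of_mono) (use *(1) in \<open>auto simp: Y'_def\<close>)
      next
        case 3
        then obtain x where "lend.B m n (\<not> p) x" "z = x * lend.L m (Suc n)"
          by (auto simp: lend.high_def)
        hence "span_of (A (lend.L m (Suc n))) z"
          using span_of_mult[of Y x Y 1 "lend.L m (Suc n)"] Y(3) Y(3)[OF lend.B_one]
          by (simp add: A_def del: lend.L.simps)
        thus ?thesis
          by (rule span_of_mono) (auto simp: Y'_def)
      qed
    qed (simp_all add: span_of_def aspan.intros)
  qed
  moreover have "finite Y'"
    unfolding Y'_def using Y(1) A_fin by simp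
  ultimately show ?case
    using YB by blast
qed

definition fsupp :: "(cox \<Rightarrow> 'k::field) \<Rightarrow> bool" where
  "fsupp v \<longleftrightarrow> finite {w. v w \<noteq> 0}"

lemma fsupp_uop:
  fixes v :: "cox \<Rightarrow> 'k::field"
  assumes "fsupp v"
  shows "fsupp (ap (uop m s) v)"
proof -
  have "{w. ap (uop m s) v w \<noteq> 0} \<subseteq> (\<lambda>w. cg s + w) ` {w. v w \<noteq> 0} \<union> {w. v w \<noteq> 0}"
  proof
    fix w assume "w \<in> {w. ap (uop m s) v w \<noteq> 0}"
    hence "v (cg s + w) \<noteq> 0 \<or> v w \<noteq> 0"
      by (auto simp: ap_uop split: if_splits)
    moreover have "w = cg s + (cg s + w)"
      by simp
    ultimately show "w \<in> (\<lambda>w. cg s + w) ` {w. v w \<noteq> 0} \<union> {w. v w \<noteq> 0}"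
      by blast
  qed
  thus ?thesis
    using assms unfolding fsupp_def by (meson finite_UnI finite_imageI finite_subset)
qed

lemma fsupp_lin: "fsupp v \<Longrightarrow> fsupp w \<Longrightarrow> fsupp (\<lambda>z. c * v z + d * w z)"
proof -
  assume "fsupp v" "fsupp w"
  moreover have "{z. c * v z + d * w z \<noteq> 0} \<subseteq> {z. v z \<noteq> 0} \<union> {z. w z \<noteq> 0}"
    by auto
  ultimately show ?thesis
    unfolding fsupp_def by (meson finite_UnI finite_subset)
qed

lemma fsupp_hop: "fsupp v \<Longrightarrow> fsupp (ap (hop m s) v)"
proof -
  assume v: "fsupp v"
  have "ap (hop m s) v = (\<lambda>z. 1 * ap (uop m s) v z + m * v z)"
    by (simp add: hop_def fun_eq_iff)
  thus ?thesis
    using fsupp_lin[OF fsupp_uop[OF v] v] by metis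
qed

lemma fsupp_Sop: "fsupp v \<Longrightarrow> fsupp (ap Sop v)"
proof -
  assume v: "fsupp v"
  have "{w. v (cflip w) \<noteq> 0} \<subseteq> cflip ` {w. v w \<noteq> 0}"
    by (force intro: image_eqI[of _ cflip "cflip _"])
  thus ?thesis
    using v unfolding fsupp_def by (simp add: finite_surj)
qed

lemma fsupp_B: "lend.B m n p x \<Longrightarrow> fsupp v \<Longrightarrow> fsupp (ap x v)"
proof (induction arbitrary: v rule: lend.B.induct)
  case (B_zero p)
  show ?case
    by (simp add: fsupp_def)
next
  case (B_add p x y)
  have "ap (x + y) v = (\<lambda>z. 1 * ap x v z + 1 * ap y v z)"
    by (simp add: fun_eq_iff)
  thus ?case
    using fsupp_lin B_add by metis
next
  case (B_scale p x c)
  have "ap (sc c * x) v = (\<lambda>z. c * ap x v z + 0 * ap x v z)"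
    by (simp add: fun_eq_iff)
  thus ?case
    using fsupp_lin B_scale by metis
qed (simp_all add: fsupp_hop fsupp_Sop)

lemma Sop_uop_Sop: "Sop * uop m 1 * Sop = uop m 0"
  by (simp add: Sop_uop flip_simps mult.assoc Sop_Sop)

lemma Sop_hop_Sop: "Sop * hop m 1 * Sop = hop m 0"
  by (simp add: Sop_hop flip_simps mult.assoc Sop_Sop)

lemma lend_B_uop: "2 \<le> n \<Longrightarrow> s < n \<Longrightarrow> lend.B m n False (uop m s)"
proof (cases "s = 0")
  case True
  assume n: "2 \<le> n"
  have "lend.B m n True (Sop * uop m 1)"
    by (rule lend.B_mult[OF lend.B_S lend.B_u]) (use n in auto)
  thus ?thesis
    unfolding True Sop_uop_Sop[symmetric] by (rule lend.B_mult[OF _ lend.B_S]) (use n in auto)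
qed (simp add: lend.B_u)

lemma lend_B_hop: "2 \<le> n \<Longrightarrow> s < n \<Longrightarrow> lend.B m n False (hop m s)"
  using lend.B_add[OF lend_B_uop lend.B_sc, of n s m m] by (simp only: hop_def)

lemma lend_B_uword: "2 \<le> n \<Longrightarrow> set x \<subseteq> {..<n} \<Longrightarrow> lend.B m n False (uword m x)"
proof (induction x)
  case (Cons s x)
  thus ?case
    using lend.B_mult[OF lend_B_uop, of n s m False "uword m x" False] by simp
qed (simp add: lend.B_one)

text \<open>Parameter 0 over the rationals is a convenient choice. A finite spanning set of
  operators sends \<open>delta0 0\<close> to functions supported in one finite set \<open>F\<close>,
  while reduced words reach the delta function of every element of the subgroup. The sums over
  \<open>W_D n\<close> in the definitions rely on this finiteness.\<close>

lemma finite_parabolic: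
  assumes "2 \<le> n"
  shows "finite (parabolic n)"
proof -
  from lend_B_finite_span[of "0 :: rat" n]
  obtain Y where Y: "finite Y" "\<forall>y\<in>Y. \<exists>p. lend.B (0 :: rat) n p y"
    "\<forall>p x. lend.B (0 :: rat) n p x \<longrightarrow> span_of Y x"
    by (elim exE conjE)
  define F where "F = (\<Union>y\<in>Y. {w. ap y (delta0 0) w \<noteq> 0})"
  have "fsupp (delta0 0 :: cox \<Rightarrow> rat)"
    by (simp add: fsupp_def delta0_def)
  hence "finite F"
    using Y(1,2) fsupp_B unfolding F_def fsupp_def by blast
  moreover have "parabolic n \<subseteq> F"
  proof
    fix w assume "w \<in> parabolic n"
    then obtain x where x: "set x \<subseteq> {..<n}" "cw x = w" "reduced x"
      using parabolic_reduced by blast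
    have zero: "ap z (delta0 0) w = 0" if "span_of Y z" "w \<notin> F" for z
      using that unfolding span_of_def by (induction rule: aspan.induct) (auto simp: F_def)
    have "span_of Y (uword 0 x)"
      using Y(3) lend_B_uword[OF assms x(1)] by blast
    thus "w \<in> F"
      using zero[of "uword 0 x"] ap_uword_delta[OF x(3), of "0 :: rat"] x(2)
      by (cases "w \<in> F") (simp_all add: delta0_def)
  qed
  ultimately show ?thesis
    by (rule finite_subset[rotated])
qed


section \<open>Evaluation of the free algebra\<close>

lemma poly_mapping_sum_single:
  fixes f :: "'a \<Rightarrow>\<^sub>0 'b::comm_monoid_add"
  shows "f = (\<Sum>x\<in>Poly_Mapping.keys f. Poly_Mapping.single x (Poly_Mapping.lookup f x))"
proof (rule poly_mapping_eqI)
  fix k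
  show "Poly_Mapping.lookup f k =
    Poly_Mapping.lookup (\<Sum>x\<in>Poly_Mapping.keys f. Poly_Mapping.single x (Poly_Mapping.lookup f x)) k"
    by (simp add: lookup_sum lookup_single when_def not_in_keys_iff_lookup_eq_zero)
qed

lemma poly_mapping_add_induct:
  fixes f :: "'a \<Rightarrow>\<^sub>0 'b::comm_monoid_add"
  assumes "P 0" and "\<And>x c. x \<in> Poly_Mapping.keys f \<Longrightarrow> P (Poly_Mapping.single x c)"
    and "\<And>g h. P g \<Longrightarrow> P h \<Longrightarrow> P (g + h)"
  shows "P f"
proof -
  have "P (\<Sum>x\<in>A. Poly_Mapping.single x (Poly_Mapping.lookup f x))" if "finite A" "A \<subseteq> Poly_Mapping.keys f" for A
    using that by (induction rule: finite_induct) (auto intro: assms)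
  thus ?thesis
    using poly_mapping_sum_single[of f] by (metis finite_keys order_refl)
qed

definition fhom :: "('k::field \<Rightarrow> 'l::field) \<Rightarrow> bool" where
  "fhom s \<longleftrightarrow> s 1 = 1 \<and> (\<forall>x y. s (x + y) = s x + s y) \<and> (\<forall>x y. s (x * y) = s x * s y)"

lemma fhom_simps:
  assumes "fhom s"
  shows "s 0 = 0" "s 1 = 1" "s (x + y) = s x + s y" "s (x * y) = s x * s y" "s (- x) = - s x"
    "s (x - y) = s x - s y" "s (inverse x) = inverse (s x)" "s x = 0 \<longleftrightarrow> x = 0"
proof -
  show add: "s (x + y) = s x + s y" and mult: "s (x * y) = s x * s y" and one: "s 1 = 1" for x y
    using assms by (simp_all add: fhom_def)
  have "s 0 + s 0 = s 0"
    using add[of 0 0] by (simp only: add_0_left)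
  thus zero: "s 0 = 0"
    by (simp only: add_cancel_left_left)
  show neg: "s (- x) = - s x" for x
    using add[of x "- x"] zero by (simp add: minus_unique)
  show "s (x - y) = s x - s y"
    using add[of x "- y"] neg by simp
  have inv: "s x * s (inverse x) = 1" if "x \<noteq> 0" for x
    using mult[of x "inverse x"] one that by simp
  show iff: "s x = 0 \<longleftrightarrow> x = 0"
    using inv[of x] zero by (cases "x = 0") auto
  show "s (inverse x) = inverse (s x)"
    using inv[of x] zero by (cases "x = 0") (auto simp: inverse_unique)
qed

lemma fhom_id: "fhom (\<lambda>c. c)"
  by (simp add: fhom_def)

text \<open>Semilinear evaluation: \<open>s\<close> acts on coefficients as the identity, the bar or
  the embedding of scalars, and \<open>h\<close> on words, multiplicatively for \<open>hw\<close>
  and in reversed order for \<open>hw_rev\<close>.\<close>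

definition ev :: "('k::field \<Rightarrow> 'l::field) \<Rightarrow> (word \<Rightarrow> 'l lend) \<Rightarrow> (word \<Rightarrow>\<^sub>0 'k) \<Rightarrow> 'l lend" where
  "ev s h f = (\<Sum>x\<in>Poly_Mapping.keys f. sc (s (Poly_Mapping.lookup f x)) * h x)"

lemma ev_zero [simp]: "ev s h 0 = 0"
  by (simp add: ev_def)

lemma ev_add: "fhom s \<Longrightarrow> ev s h (f + g) = ev s h f + ev s h g"
  unfolding ev_def
  by (rule setsum_keys_plus_distrib) (simp_all add: fhom_simps sc_add distrib_right)

lemma ev_single: "fhom s \<Longrightarrow> ev s h (Poly_Mapping.single x c) = sc (s c) * h x"
  by (simp add: ev_def fhom_simps)

lemma ev_uminus: "fhom s \<Longrightarrow> ev s h (- f) = - ev s h f"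
  using ev_add[of s h f "- f"] by (simp add: minus_unique)

lemma ev_diff: "fhom s \<Longrightarrow> ev s h (f - g) = ev s h f - ev s h g"
  using ev_add[of s h f "- g"] ev_uminus by fastforce

lemma ev_mult:
  assumes s: "fhom s" and h: "\<And>x z. h (x + z) = h x * h z"
  shows "ev s h (f * g) = ev s h f * ev s h g"
proof (induction f rule: poly_mapping_add_induct)
  case (2 x c)
  show ?case
  proof (induction g rule: poly_mapping_add_induct)
    case (2 z d)
    have "sc (s c) * h x * (sc (s d) * h z) = sc (s c) * sc (s d) * (h x * h z)"
      by (metis mult.assoc sc_commute)
    thus ?case
      by (simp add: mult_single ev_single[OF s] h fhom_simps[OF s] sc_mult)
  qed (simp_all add: ev_add[OF s] distrib_left distrib_right)
qed (simp_all add: ev_add[OF s] distrib_left distrib_right)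

lemma ev_mult_rev:
  assumes s: "fhom s" and h: "\<And>x z. h (x + z) = h z * h x"
  shows "ev s h (f * g) = ev s h g * ev s h f"
proof (induction f rule: poly_mapping_add_induct)
  case (2 x c)
  show ?case
  proof (induction g rule: poly_mapping_add_induct)
    case (2 z d)
    have "sc (s d) * h z * (sc (s c) * h x) = sc (s c) * sc (s d) * (h z * h x)"
      by (metis mult.assoc sc_commute)
    thus ?case
      by (simp add: mult_single ev_single[OF s] h fhom_simps[OF s] sc_mult)
  qed (simp_all add: ev_add[OF s] distrib_left distrib_right)
qed (simp_all add: ev_add[OF s] distrib_left distrib_right)

definition hw :: "(nat \<Rightarrow> 'b::monoid_mult) \<Rightarrow> word \<Rightarrow> 'b" where
  "hw g x = prod_list (map g (letters x))"

definition hw_rev :: "(nat \<Rightarrow> 'b::monoid_mult) \<Rightarrow> word \<Rightarrow> 'b" where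
  "hw_rev g x = prod_list (map g (rev (letters x)))"

lemma hw_add: "hw g (x + z) = hw g x * hw g z"
  and hw_rev_add: "hw_rev g (x + z) = hw_rev g z * hw_rev g x"
  by (simp_all add: hw_def hw_rev_def plus_word_def)

lemma hw_simps [simp]: "hw g 0 = 1" "hw_rev g 0 = 1" "hw g (Word [s]) = g s" "hw_rev g (Word [s]) = g s"
  by (simp_all add: hw_def hw_rev_def zero_word_def)


section \<open>The presented algebra\<close>

definition FA :: "nat \<Rightarrow> (word \<Rightarrow>\<^sub>0 'k::field) set" where
  "FA n = {f. \<forall>x\<in>Poly_Mapping.keys f. set (letters x) \<subseteq> {..<n}}"

lemma FA_closed:
  "0 \<in> FA n" "1 \<in> FA n" "f \<in> FA n \<Longrightarrow> g \<in> FA n \<Longrightarrow> f + g \<in> FA n" "f \<in> FA n \<Longrightarrow> - f \<in> FA n"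
  "f \<in> FA n \<Longrightarrow> g \<in> FA n \<Longrightarrow> f - g \<in> FA n" "f \<in> FA n \<Longrightarrow> g \<in> FA n \<Longrightarrow> f * g \<in> FA n"
  "const_F c \<in> FA n" "s < n \<Longrightarrow> gen_F s \<in> FA n"
  "set (letters x) \<subseteq> {..<n} \<Longrightarrow> Poly_Mapping.single x c \<in> FA n"
proof -
  show "f \<in> FA n \<Longrightarrow> g \<in> FA n \<Longrightarrow> f + g \<in> FA n"
    using keys_add[of f g] by (auto simp: FA_def)
  show "f \<in> FA n \<Longrightarrow> g \<in> FA n \<Longrightarrow> f - g \<in> FA n"
    using keys_diff[of f g] by (auto simp: FA_def)
  show "f \<in> FA n \<Longrightarrow> g \<in> FA n \<Longrightarrow> f * g \<in> FA n"
    using keys_mult[of f g] by (fastforce simp: FA_def plus_word_def)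
qed (auto simp: FA_def const_F_def gen_F_def zero_word_def split: if_splits)

lemma free_algebra_simps [simp]:
  "carrier (free_algebra n) = FA n" "mult (free_algebra n) = (*)" "one (free_algebra n) = 1"
  "zero (free_algebra n) = 0" "add (free_algebra n) = (+)"
  by (simp_all add: free_algebra_def FA_def)

lemma ring_free_algebra: "ring (free_algebra n)"
proof (rule ringI)
  show "abelian_group (free_algebra n)"
  proof (rule abelian_groupI)
    fix x assume "x \<in> carrier (free_algebra n)"
    thus "\<exists>y\<in>carrier (free_algebra n). y \<oplus>\<^bsub>free_algebra n\<^esub> x = \<zero>\<^bsub>free_algebra n\<^esub>"
      by (intro bexI[of _ "- x"]) (auto simp: FA_closed)
  qed (auto simp: FA_closed add_ac)
  show "monoid (free_algebra n)"
    by (rule monoidI) (auto simp: FA_closed mult.assoc)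
qed (auto simp: distrib_left distrib_right)

lemma free_algebra_uminus: "f \<in> FA n \<Longrightarrow> \<ominus>\<^bsub>free_algebra n\<^esub> f = - f"
  using abelian_group.minus_equality[OF ring.is_abelian_group[OF ring_free_algebra[of n]], of "- f" f]
  by (simp add: FA_closed)

lemma hecke_relators_FA: "hecke_relators q n \<subseteq> FA n"
  by (auto simp: hecke_relators_def intro!: FA_closed)

lemma hecke_ideal: "ideal (hecke_ideal q n) (free_algebra n)"
  unfolding hecke_ideal_def
  by (rule ring.genideal_ideal[OF ring_free_algebra]) (simp add: hecke_relators_FA)

lemma hecke_ideal_FA: "f \<in> hecke_ideal q n \<Longrightarrow> f \<in> FA n"
  using ideal.Icarr[OF hecke_ideal] by fastforce

lemma hecke_ideal_relator: "r \<in> hecke_relators q n \<Longrightarrow> r \<in> hecke_ideal q n"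
  unfolding hecke_ideal_def
  using ring.genideal_self[OF ring_free_algebra, of "hecke_relators q n" n] hecke_relators_FA by auto

lemma hecke_ideal_closed:
  "0 \<in> hecke_ideal q n"
  "f \<in> hecke_ideal q n \<Longrightarrow> g \<in> hecke_ideal q n \<Longrightarrow> f + g \<in> hecke_ideal q n"
  "f \<in> hecke_ideal q n \<Longrightarrow> - f \<in> hecke_ideal q n"
  "f \<in> hecke_ideal q n \<Longrightarrow> g \<in> hecke_ideal q n \<Longrightarrow> f - g \<in> hecke_ideal q n"
  "f \<in> hecke_ideal q n \<Longrightarrow> g \<in> FA n \<Longrightarrow> g * f \<in> hecke_ideal q n"
  "f \<in> hecke_ideal q n \<Longrightarrow> g \<in> FA n \<Longrightarrow> f * g \<in> hecke_ideal q n"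
proof -
  interpret I: ideal "hecke_ideal q n" "free_algebra n"
    by (rule hecke_ideal)
  note S = I.additive_subgroup_axioms
  show "0 \<in> hecke_ideal q n"
    using additive_subgroup.zero_closed[OF S] by simp
  show add: "f \<in> hecke_ideal q n \<Longrightarrow> g \<in> hecke_ideal q n \<Longrightarrow> f + g \<in> hecke_ideal q n" for f g
    using additive_subgroup.a_closed[OF S] by simp
  show left: "f \<in> hecke_ideal q n \<Longrightarrow> g \<in> FA n \<Longrightarrow> g * f \<in> hecke_ideal q n" for f g
    using I.I_l_closed by simp
  show "f \<in> hecke_ideal q n \<Longrightarrow> g \<in> FA n \<Longrightarrow> f * g \<in> hecke_ideal q n"
    using I.I_r_closed by simp
  show neg: "f \<in> hecke_ideal q n \<Longrightarrow> - f \<in> hecke_ideal q n" for f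
    using left[OF _ FA_closed(4)[OF FA_closed(2)], of f] by simp
  show "f \<in> hecke_ideal q n \<Longrightarrow> g \<in> hecke_ideal q n \<Longrightarrow> f - g \<in> hecke_ideal q n"
    using add[of f "- g"] neg by simp
qed

text \<open>\<open>F\<close> is merely additive, which covers homomorphisms and antihomomorphisms
  alike. The elements all of whose two-sided multiples are killed by \<open>F\<close> form an ideal
  containing the relators.\<close>

lemma hecke_ideal_kernel:
  fixes F :: "(word \<Rightarrow>\<^sub>0 'k::field) \<Rightarrow> 'a::ab_group_add"
  assumes add: "\<And>f g. F (f + g) = F f + F g"
    and rel: "\<And>r a b. r \<in> hecke_relators q n \<Longrightarrow> a \<in> FA n \<Longrightarrow> b \<in> FA n \<Longrightarrow> F (a * r * b) = 0"
    and f: "f \<in> hecke_ideal q n"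
  shows "F f = 0"
proof -
  have "F 0 + F 0 = F 0"
    using add[of 0 0] by (simp only: add_0_left)
  hence zero: "F 0 = 0"
    by (simp only: add_cancel_left_left)
  have neg: "F (- f) = - F f" for f
    using add[of f "- f"] zero by (simp add: minus_unique)
  define J where "J = {f \<in> FA n. \<forall>a\<in>FA n. \<forall>b\<in>FA n. F (a * f * b) = 0}"
  have "ideal J (free_algebra n)"
  proof (rule idealI[OF ring_free_algebra])
    show "subgroup J (add_monoid (free_algebra n))"
    proof (rule group.subgroupI)
      show "Group.group (add_monoid (free_algebra n))"
        by (rule abelian_group.a_group[OF ring.is_abelian_group[OF ring_free_algebra]])
      show "J \<subseteq> carrier (add_monoid (free_algebra n))"
        by (auto simp: J_def)
      show "J \<noteq> {}"
      proof -
        have "0 \<in> J"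
          using zero FA_closed(1) by (simp add: J_def)
        thus ?thesis
          by blast
      qed
      fix f assume f: "f \<in> J"
      show "inv\<^bsub>add_monoid (free_algebra n)\<^esub> f \<in> J"
        using f free_algebra_uminus[of f n] neg by (auto simp: J_def a_inv_def FA_closed)
      fix g assume "g \<in> J"
      thus "f \<otimes>\<^bsub>add_monoid (free_algebra n)\<^esub> g \<in> J"
        using f add by (auto simp: J_def FA_closed distrib_left distrib_right)
    qed
    fix f g :: "word \<Rightarrow>\<^sub>0 'k"
    assume f: "f \<in> J" and g: "g \<in> carrier (free_algebra n)"
    have "F (a * (g * f) * b) = 0" "F (a * (f * g) * b) = 0" if "a \<in> FA n" "b \<in> FA n" for a b
    proof -
      have "a * g \<in> FA n" "g * b \<in> FA n"
        using that g by (simp_all add: FA_closed)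
      hence "F ((a * g) * f * b) = 0" "F (a * f * (g * b)) = 0"
        using f that by (simp_all add: J_def)
      thus "F (a * (g * f) * b) = 0" "F (a * (f * g) * b) = 0"
        by (simp_all add: mult.assoc)
    qed
    thus "g \<otimes>\<^bsub>free_algebra n\<^esub> f \<in> J" "f \<otimes>\<^bsub>free_algebra n\<^esub> g \<in> J"
      using f g by (auto simp: J_def FA_closed)
  qed
  moreover have "hecke_relators q n \<subseteq> J"
    using rel hecke_relators_FA[of q n] by (auto simp: J_def)
  ultimately have "hecke_ideal q n \<subseteq> J"
    unfolding hecke_ideal_def by (rule ring.genideal_minimal[OF ring_free_algebra])
  hence "F (1 * f * 1) = 0"
    using f FA_closed(2) unfolding J_def by blast
  thus ?thesis
    by simp
qed

definition hecke_gens :: "'k::field \<Rightarrow> nat \<Rightarrow> (nat \<Rightarrow> 'k lend) \<Rightarrow> bool" where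
  "hecke_gens m n g \<longleftrightarrow>
     (\<forall>s<n. g s * g s = 1 + sc m * g s) \<and>
     (\<forall>s<n. \<forall>t<n. s \<noteq> t \<longrightarrow> \<not> adjacent s t \<longrightarrow> g s * g t = g t * g s) \<and>
     (\<forall>s<n. \<forall>t<n. adjacent s t \<longrightarrow> g s * g t * g s = g t * g s * g t)"

lemma hecke_gens_hop: "hecke_gens m n (hop m)"
  unfolding hecke_gens_def by (auto intro: hop_square hop_commute hop_braid)

lemma hecke_gens_uop: "hecke_gens (- m) n (uop m)"
  unfolding hecke_gens_def by (auto simp: sc_uminus uop_square intro: uop_commute uop_braid)

lemma ev_gen_const:
  assumes "fhom s" "\<And>s. h (Word [s]) = g s" "h 0 = 1"
  shows "ev s h (gen_F i) = g i" "ev s h (const_F c) = sc (s c)"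
  using assms by (simp_all add: gen_F_def const_F_def ev_single fhom_simps)

lemma quadratic_relator:
  fixes g :: "'k::field lend"
  assumes "g * g = 1 + sc (q - inverse q) * g" "q \<noteq> 0"
  shows "(g - sc q) * (g + sc (inverse q)) = 0" "(g + sc (inverse q)) * (g - sc q) = 0"
proof -
  have "sc q * sc (inverse q) = (1 :: 'k lend)" "sc (inverse q) * sc q = (1 :: 'k lend)"
    using assms(2) by (simp_all flip: sc_mult)
  thus "(g - sc q) * (g + sc (inverse q)) = 0" "(g + sc (inverse q)) * (g - sc q) = 0"
    using assms(1) sc_commute[of q g] sc_commute[of "inverse q" g]
    by (simp_all add: algebra_simps sc_minus)
qed

text \<open>Reversal sends each relator to itself up to a sign or the order of two commuting
  factors, so one system of operators serves both evaluations.\<close>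

lemma ev_ideal:
  assumes s: "fhom s" and q: "q \<noteq> 0" and g: "hecke_gens (s q - inverse (s q)) n g"
    and f: "f \<in> hecke_ideal q n"
  shows "ev s (hw g) f = 0" and "ev s (hw_rev g) f = 0"
proof -
  note 1 = ev_gen_const[OF s, of "hw g" g] ev_gen_const[OF s, of "hw_rev g" g]
  note 2 = ev_add[OF s] ev_diff[OF s] ev_mult[where h = "hw g", OF s hw_add]
    ev_mult_rev[where h = "hw_rev g", OF s hw_rev_add]
  have sq: "s q \<noteq> 0" "s (inverse q) = inverse (s q)"
    using s q by (simp_all add: fhom_simps)
  have quad: "(g i - sc (s q)) * (g i + sc (inverse (s q))) = 0"
    "(g i + sc (inverse (s q))) * (g i - sc (s q)) = 0" if "i < n" for i
    using quadratic_relator[of "g i" "s q"] g that sq(1) by (simp_all add: hecke_gens_def)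
  have zero: "ev s (hw g) r = 0 \<and> ev s (hw_rev g) r = 0" if r: "r \<in> hecke_relators q n" for r
    using r unfolding hecke_relators_def
  proof (elim UnE CollectE exE conjE)
    fix i assume "i < n" "r = (gen_F i - const_F q) * (gen_F i + const_F (inverse q))"
    thus ?thesis
      using quad by (simp add: 1 2 sq)
  next
    fix i j assume "i < n" "j < n" "i \<noteq> j" "\<not> adjacent i j" "r = gen_F i * gen_F j - gen_F j * gen_F i"
    moreover from this have "g i * g j = g j * g i"
      using g unfolding hecke_gens_def by blast
    ultimately show ?thesis
      by (simp add: 1 2)
  next
    fix i j assume "i < n" "j < n" "adjacent i j"
      "r = gen_F i * gen_F j * gen_F i - gen_F j * gen_F i * gen_F j"
    moreover from this have "g i * g j * g i = g j * g i * g j"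
      using g unfolding hecke_gens_def by blast
    ultimately show ?thesis
      by (simp add: 1 2 mult.assoc)
  qed
  show "ev s (hw g) f = 0"
    by (rule hecke_ideal_kernel[of "ev s (hw g)" q n f]) (simp_all add: 2 zero f)
  show "ev s (hw_rev g) f = 0"
    by (rule hecke_ideal_kernel[of "ev s (hw_rev g)" q n f]) (simp_all add: 2 zero f)
qed

section \<open>Bases of the presented algebra\<close>

abbreviation wprod :: "(nat \<Rightarrow> 'b::monoid_mult) \<Rightarrow> nat list \<Rightarrow> 'b" where
  "wprod g x \<equiv> prod_list (map g x)"

text \<open>The inverse of the generator modulo the ideal, as read off from the quadratic
  relation.\<close>

definition inv_F :: "'k::field \<Rightarrow> nat \<Rightarrow> (word \<Rightarrow>\<^sub>0 'k)" where
  "inv_F q s = gen_F s - const_F (q - inverse q)"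

lemma inv_F_FA: "s < n \<Longrightarrow> inv_F q s \<in> FA n"
  unfolding inv_F_def by (intro FA_closed)

lemma wprod_FA: "(\<And>s. s < n \<Longrightarrow> g s \<in> FA n) \<Longrightarrow> set x \<subseteq> {..<n} \<Longrightarrow> wprod g x \<in> FA n"
  by (induction x) (auto intro: FA_closed)

lemma sum_FA: "(\<And>w. w \<in> A \<Longrightarrow> g w \<in> FA n) \<Longrightarrow> (\<Sum>w\<in>A. g w) \<in> FA n"
  by (induction A rule: infinite_finite_induct) (auto intro: FA_closed)

lemma const_F_commute: "const_F c * f = f * const_F c"
  by (induction f rule: poly_mapping_add_induct)
     (simp_all add: const_F_def mult_single distrib_left distrib_right mult.commute[of c])

lemma const_F_simps:
  "const_F (c + d) = const_F c + const_F d" "const_F (c - d) = const_F c - const_F d"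
  "const_F (c * d) = const_F c * const_F d" "const_F 0 = 0" "const_F 1 = 1"
  by (simp_all add: const_F_def single_add single_diff mult_single)

definition cong_gens :: "'k::field \<Rightarrow> nat \<Rightarrow> 'k \<Rightarrow> (nat \<Rightarrow> (word \<Rightarrow>\<^sub>0 'k)) \<Rightarrow> bool" where
  "cong_gens q n \<kappa> g \<longleftrightarrow>
     (\<forall>s<n. g s \<in> FA n) \<and>
     (\<forall>s<n. g s * g s - 1 - const_F \<kappa> * g s \<in> hecke_ideal q n) \<and>
     (\<forall>s<n. \<forall>t<n. s \<noteq> t \<longrightarrow> \<not> adjacent s t \<longrightarrow> g s * g t - g t * g s \<in> hecke_ideal q n) \<and>
     (\<forall>s<n. \<forall>t<n. adjacent s t \<longrightarrow> g s * g t * g s - g t * g s * g t \<in> hecke_ideal q n)"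

lemma cong_gens_gen:
  fixes q :: "'k::field"
  assumes "q \<noteq> 0"
  shows "cong_gens q n (q - inverse q) gen_F"
proof -
  have "gen_F s * gen_F s - 1 - const_F (q - inverse q) * gen_F s \<in> hecke_ideal q n" if "s < n" for s
  proof -
    have "const_F q * const_F (inverse q) = (1 :: word \<Rightarrow>\<^sub>0 'k)"
      using assms by (simp flip: const_F_simps)
    hence "gen_F s * gen_F s - 1 - const_F (q - inverse q) * gen_F s =
      (gen_F s - const_F q) * (gen_F s + const_F (inverse q))"
      using const_F_commute[of "inverse q" "gen_F s"] by (simp add: algebra_simps const_F_simps)
    moreover have "(gen_F s - const_F q) * (gen_F s + const_F (inverse q)) \<in> hecke_ideal q n"
      using that by (intro hecke_ideal_relator) (auto simp: hecke_relators_def)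
    ultimately show ?thesis
      by simp
  qed
  moreover have "gen_F s * gen_F t - gen_F t * gen_F s \<in> hecke_ideal q n"
    if "s < n" "t < n" "s \<noteq> t" "\<not> adjacent s t" for s t
    using that by (intro hecke_ideal_relator) (auto simp: hecke_relators_def)
  moreover have "gen_F s * gen_F t * gen_F s - gen_F t * gen_F s * gen_F t \<in> hecke_ideal q n"
    if "s < n" "t < n" "adjacent s t" for s t
    using that by (intro hecke_ideal_relator) (auto simp: hecke_relators_def)
  ultimately show ?thesis
    unfolding cong_gens_def using FA_closed(8) by blast
qed

lemma cong_gens_inv:
  fixes q :: "'k::field"
  assumes "q \<noteq> 0"
  shows "cong_gens q n (inverse q - q) (inv_F q)"
proof -
  define c :: "word \<Rightarrow>\<^sub>0 'k" where "c = const_F (q - inverse q)"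
  note G = cong_gens_gen[OF assms, of n, unfolded cong_gens_def]
  have comm: "gen_F s * c = c * gen_F s" "gen_F s * (c * g) = c * (gen_F s * g)" for s g
    unfolding c_def by (metis const_F_commute mult.assoc)+
  have inv: "inv_F q s = gen_F s - c" for s
    by (simp add: inv_F_def c_def)
  have neg: "const_F (inverse q - q) = - c"
    unfolding c_def using const_F_simps(2)[of 0 "q - inverse q"] by (simp add: const_F_simps(4))
  have quad: "gen_F s * gen_F s - 1 - c * gen_F s \<in> hecke_ideal q n" if "s < n" for s
    using G that unfolding c_def by blast
  have "inv_F q s * inv_F q s - 1 - const_F (inverse q - q) * inv_F q s \<in> hecke_ideal q n" if "s < n" for s
  proof -
    have "inv_F q s * inv_F q s - 1 - const_F (inverse q - q) * inv_F q s =
      gen_F s * gen_F s - 1 - c * gen_F s"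
      unfolding inv neg by (simp add: algebra_simps comm)
    thus ?thesis
      using quad[OF that] by (simp only:)
  qed
  moreover have "inv_F q s * inv_F q t - inv_F q t * inv_F q s \<in> hecke_ideal q n"
    if "s < n" "t < n" "s \<noteq> t" "\<not> adjacent s t" for s t
  proof -
    have "inv_F q s * inv_F q t - inv_F q t * inv_F q s = gen_F s * gen_F t - gen_F t * gen_F s"
      unfolding inv by (simp add: algebra_simps comm)
    moreover have "gen_F s * gen_F t - gen_F t * gen_F s \<in> hecke_ideal q n"
      using G that by blast
    ultimately show ?thesis
      by (simp only:)
  qed
  moreover have "inv_F q s * inv_F q t * inv_F q s - inv_F q t * inv_F q s * inv_F q t \<in> hecke_ideal q n"
    if "s < n" "t < n" "adjacent s t" for s t
  proof -
    \<comment> \<open>Shifting both generators by the central \<open>c\<close> changes the braid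
      relator by \<open>c\<close> times the difference of the two quadratic relators.\<close>
    have eq: "inv_F q s * inv_F q t * inv_F q s - inv_F q t * inv_F q s * inv_F q t =
      (gen_F s * gen_F t * gen_F s - gen_F t * gen_F s * gen_F t) -
      c * ((gen_F s * gen_F s - 1 - c * gen_F s) - (gen_F t * gen_F t - 1 - c * gen_F t))"
      unfolding inv by (simp add: algebra_simps comm)
    have c: "c \<in> FA n"
      unfolding c_def by (rule FA_closed)
    have r: "gen_F s * gen_F t * gen_F s - gen_F t * gen_F s * gen_F t \<in> hecke_ideal q n"
      using G that by blast
    show ?thesis
      unfolding eq
      by (rule hecke_ideal_closed(4)[OF r
            hecke_ideal_closed(5)[OF hecke_ideal_closed(4)[OF quad quad] c]]) fact+
  qed
  ultimately show ?thesis
    unfolding cong_gens_def using inv_F_FA by blast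
qed

text \<open>At this point the operators are not known to detect the ideal, so the congruence comes
  from Matsumoto's theorem, one braid move at a time.\<close>

lemma wprod_cong:
  assumes g: "cong_gens q n \<kappa> g" and "set x \<subseteq> {..<n}" "cw x = cw z" "reduced x" "reduced z"
  shows "wprod g x - wprod g z \<in> hecke_ideal q n"
proof -
  have FA: "wprod g x \<in> FA n" if "set x \<subseteq> {..<n}" for x
    using g that unfolding cong_gens_def by (intro wprod_FA) auto
  have move: "set z \<subseteq> {..<n} \<and> wprod g x - wprod g z \<in> hecke_ideal q n"
    if "braid_move x z \<or> braid_move z x" "set x \<subseteq> {..<n}" for x z
  proof -
    have "wprod g x - wprod g z \<in> hecke_ideal q n" if "braid_move x z" "set x \<subseteq> {..<n}" for x z
      using that(1)
    proof cases
      case (commute s t a b)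
      have "wprod g x - wprod g z = wprod g a * (g s * g t - g t * g s) * wprod g b"
        unfolding commute(1,2) by (simp add: algebra_simps)
      moreover have "g s * g t - g t * g s \<in> hecke_ideal q n"
        using g commute that(2) unfolding cong_gens_def by simp
      hence "wprod g a * (g s * g t - g t * g s) * wprod g b \<in> hecke_ideal q n"
        by (rule hecke_ideal_closed(6)[OF hecke_ideal_closed(5)[OF _ FA] FA])
           (use that(2) commute(1) in auto)
      ultimately show ?thesis
        by simp
    next
      case (braid s t a b)
      have "wprod g x - wprod g z = wprod g a * (g s * g t * g s - g t * g s * g t) * wprod g b"
        unfolding braid(1,2) by (simp add: algebra_simps)
      moreover have "g s * g t * g s - g t * g s * g t \<in> hecke_ideal q n"
        using g braid that(2) unfolding cong_gens_def by simp
      hence "wprod g a * (g s * g t * g s - g t * g s * g t) * wprod g b \<in> hecke_ideal q n"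
        by (rule hecke_ideal_closed(6)[OF hecke_ideal_closed(5)[OF _ FA] FA])
           (use that(2) braid(1) in auto)
      ultimately show ?thesis
        by simp
    qed
    note m = this
    have sets: "set x = set z" if "braid_move x z" for x z
      using that by cases auto
    show ?thesis
      using that(1)
    proof
      assume "braid_move x z"
      thus ?thesis
        using m sets that(2) by metis
    next
      assume zx: "braid_move z x"
      hence "- (wprod g z - wprod g x) \<in> hecke_ideal q n"
        using m[OF zx] sets[OF zx] that(2) hecke_ideal_closed(3) by metis
      thus ?thesis
        using sets[OF zx] that(2) by simp
    qed
  qed
  have "braid_eq x z"
    using reduced_braid_eq assms by blast
  hence "set z \<subseteq> {..<n} \<and> wprod g x - wprod g z \<in> hecke_ideal q n"
  proof (induction rule: equivclp_induct)
    case base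
    show ?case
      using assms(2) by (simp add: hecke_ideal_closed)
  next
    case (step y z)
    have "wprod g x - wprod g z = (wprod g x - wprod g y) + (wprod g y - wprod g z)"
      by simp
    thus ?case
      using step.IH move[OF step.hyps(2)] hecke_ideal_closed(2) by metis
  qed
  thus ?thesis ..
qed

text \<open>\<open>g\<close> will be the generators, with \<open>d = 0\<close>, or their inverses,
  with \<open>d = q - inverse q\<close>, and \<open>rd\<close> selects reduced words. The span is
  stable under left multiplication by \<open>g s\<close>: when the length grows, the product is
  again one of the family; when it drops, the quadratic relation applies.\<close>

lemma spanning:
  fixes q :: "'k::field"
  assumes g: "cong_gens q n \<kappa> g" and gen: "\<And>s. s < n \<Longrightarrow> gen_F s = g s + const_F d" and n: "2 \<le> n"
    and rd: "\<And>u. u \<in> parabolic n \<Longrightarrow> set (rd u) \<subseteq> {..<n} \<and> cw (rd u) = u \<and> reduced (rd u)"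
    and f: "f \<in> FA n"
  shows "\<exists>c. f - (\<Sum>w\<in>parabolic n. const_F (c w) * wprod g (rd w)) \<in> hecke_ideal q n"
proof -
  have fin: "finite (parabolic n)"
    by (rule finite_parabolic[OF n])
  define comb where "comb c = (\<Sum>w\<in>parabolic n. const_F (c w) * wprod g (rd w))" for c
  define Sp where "Sp f \<longleftrightarrow> (\<exists>c. f - comb c \<in> hecke_ideal q n)" for f
  have Sp_zero: "Sp 0"
    unfolding Sp_def comb_def
    by (rule exI[of _ "\<lambda>_. 0"]) (simp add: const_F_simps hecke_ideal_closed)
  have Sp_add: "Sp (f + f')" if A: "Sp f" "Sp f'" for f f'
  proof -
    obtain c c' where cc: "f - comb c \<in> hecke_ideal q n" "f' - comb c' \<in> hecke_ideal q n"
      using A unfolding Sp_def by blast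
    have "comb (\<lambda>w. c w + c' w) = comb c + comb c'"
      by (simp add: comb_def const_F_simps distrib_right sum.distrib)
    hence "(f + f') - comb (\<lambda>w. c w + c' w) = (f - comb c) + (f' - comb c')"
      by simp
    thus ?thesis
      unfolding Sp_def using cc hecke_ideal_closed(2) by metis
  qed
  have Sp_const: "Sp (const_F e * f)" if A: "Sp f" for e f
  proof -
    obtain c where c: "f - comb c \<in> hecke_ideal q n"
      using A unfolding Sp_def by blast
    have "comb (\<lambda>w. e * c w) = const_F e * comb c"
      by (simp add: comb_def const_F_simps sum_distrib_left mult.assoc)
    hence "const_F e * f - comb (\<lambda>w. e * c w) = const_F e * (f - comb c)"
      by (simp add: right_diff_distrib)
    thus ?thesis
      unfolding Sp_def using hecke_ideal_closed(5)[OF c FA_closed(7)] by metis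
  qed
  have Sp_base: "Sp (wprod g (rd w))" if "w \<in> parabolic n" for w
  proof -
    have "comb (\<lambda>v. if v = w then 1 else 0) = (\<Sum>v\<in>parabolic n. if v = w then wprod g (rd v) else 0)"
      unfolding comb_def by (rule sum.cong) (auto simp: const_F_simps)
    also have "\<dots> = wprod g (rd w)"
      using that fin by simp
    finally show ?thesis
      unfolding Sp_def by (intro exI[of _ "\<lambda>v. if v = w then 1 else 0"]) (simp add: hecke_ideal_closed)
  qed
  have Sp_cong: "Sp f" if A: "Sp f'" "f - f' \<in> hecke_ideal q n" for f f'
  proof -
    obtain c where c: "f' - comb c \<in> hecke_ideal q n"
      using A unfolding Sp_def by blast
    have "f - comb c = (f - f') + (f' - comb c)"
      by simp
    thus ?thesis
      unfolding Sp_def using A(2) c hecke_ideal_closed(2) by metis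
  qed
  have FA: "wprod g x \<in> FA n" if "set x \<subseteq> {..<n}" for x
    using g that unfolding cong_gens_def by (intro wprod_FA) auto
  have gFA: "g s \<in> FA n" if "s < n" for s
    using g that unfolding cong_gens_def by blast
  have Sp_g_base: "Sp (g s * wprod g (rd w))" if s: "s < n" and w: "w \<in> parabolic n" for s w
  proof -
    have sw: "cg s + w \<in> parabolic n"
      using parabolic_add[OF parabolic_cg[OF s] w] .
    note rw = rd[OF w] and rsw = rd[OF sw]
    show ?thesis
      using clen_cg_add[of s w]
    proof
      assume up: "clen (cg s + w) = clen w + 1"
      have "reduced (s # rd w)"
        using rw up by (simp add: reduced_Cons)
      hence "wprod g (s # rd w) - wprod g (rd (cg s + w)) \<in> hecke_ideal q n"
        using rw rsw s by (intro wprod_cong[OF g]) (auto simp: cw_Cons)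
      thus ?thesis
        using Sp_cong[OF Sp_base[OF sw]] by simp
    next
      assume down: "clen w = clen (cg s + w) + 1"
      \<comment> \<open>When the length drops, a reduced word of \<open>w\<close> may be taken to
        start with \<open>s\<close>.\<close>
      define x where "x = rd (cg s + w)"
      have red: "reduced (s # x)"
        using rsw down by (simp add: reduced_Cons x_def)
      have e1: "wprod g (rd w) - wprod g (s # x) \<in> hecke_ideal q n"
        using rw rsw s red by (intro wprod_cong[OF g]) (auto simp: cw_Cons x_def)
      have quad: "g s * g s - 1 - const_F \<kappa> * g s \<in> hecke_ideal q n"
        using g s unfolding cong_gens_def by blast
      have "g s * wprod g (rd w) - (wprod g x + const_F \<kappa> * wprod g (rd w)) =
        g s * (wprod g (rd w) - wprod g (s # x)) + (g s * g s - 1 - const_F \<kappa> * g s) * wprod g x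
        - const_F \<kappa> * (wprod g (rd w) - wprod g (s # x))"
        by (simp add: algebra_simps)
      moreover have "g s * (wprod g (rd w) - wprod g (s # x)) \<in> hecke_ideal q n"
        by (rule hecke_ideal_closed(5)[OF e1 gFA[OF s]])
      moreover have "(g s * g s - 1 - const_F \<kappa> * g s) * wprod g x \<in> hecke_ideal q n"
        by (rule hecke_ideal_closed(6)[OF quad FA]) (use rsw in \<open>simp add: x_def\<close>)
      moreover have "const_F \<kappa> * (wprod g (rd w) - wprod g (s # x)) \<in> hecke_ideal q n"
        by (rule hecke_ideal_closed(5)[OF e1 FA_closed(7)])
      ultimately have "g s * wprod g (rd w) - (wprod g x + const_F \<kappa> * wprod g (rd w)) \<in> hecke_ideal q n"
        using hecke_ideal_closed(2,4) by metis
      moreover have "Sp (wprod g x + const_F \<kappa> * wprod g (rd w))"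
        unfolding x_def by (intro Sp_add Sp_const Sp_base w sw)
      ultimately show ?thesis
        using Sp_cong by blast
    qed
  qed
  have Sp_gen: "Sp (gen_F s * f)" if s: "s < n" and A: "Sp f" for s f
  proof -
    obtain c where c: "f - comb c \<in> hecke_ideal q n"
      using A unfolding Sp_def by blast
    have "Sp (g s * (\<Sum>w\<in>A. const_F (c w) * wprod g (rd w)))" if "finite A" "A \<subseteq> parabolic n" for A
      using that
    proof (induction rule: finite_induct)
      case (insert w A)
      have "g s * (const_F (c w) * wprod g (rd w)) = const_F (c w) * (g s * wprod g (rd w))"
        by (metis const_F_commute mult.assoc)
      moreover have "Sp (const_F (c w) * (g s * wprod g (rd w)))"
        using insert.prems s by (intro Sp_const Sp_g_base) auto
      ultimately show ?case
        using insert by (simp add: distrib_left Sp_add)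
    qed (simp add: Sp_zero)
    hence "Sp (g s * comb c)"
      unfolding comb_def using fin by blast
    moreover have "Sp (const_F d * comb c)"
      unfolding Sp_def by (rule Sp_const[unfolded Sp_def]) (rule exI[of _ c], simp add: hecke_ideal_closed)
    ultimately have "Sp (gen_F s * comb c)"
      unfolding gen[OF s] distrib_right by (rule Sp_add)
    moreover have "gen_F s * f - gen_F s * comb c \<in> hecke_ideal q n"
      using hecke_ideal_closed(5)[OF c FA_closed(8)[OF s]] by (simp add: right_diff_distrib)
    ultimately show ?thesis
      by (rule Sp_cong)
  qed
  have Sp_word: "Sp (Poly_Mapping.single (Word x) 1)" if "set x \<subseteq> {..<n}" for x
    using that
  proof (induction x)
    case Nil
    have "rd 0 = []"
      using rd[OF parabolic_zero] by (metis clen_zero length_0_conv reduced_def)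
    hence "Sp 1"
      using Sp_base[OF parabolic_zero] by simp
    moreover have "Poly_Mapping.single (Word []) 1 = (1 :: word \<Rightarrow>\<^sub>0 'k)"
      using zero_word_def single_one by metis
    ultimately show ?case
      by simp
  next
    case (Cons s x)
    have "Poly_Mapping.single (Word (s # x)) 1 = gen_F s * (Poly_Mapping.single (Word x) 1 :: word \<Rightarrow>\<^sub>0 'k)"
      by (simp add: gen_F_def mult_single plus_word_def)
    thus ?case
      using Sp_gen Cons by simp
  qed
  have "Sp f"
  proof (induction f rule: poly_mapping_add_induct)
    case (2 x c)
    have "Poly_Mapping.single x c = const_F c * Poly_Mapping.single (Word (letters x)) 1"
      by (simp add: const_F_def mult_single)
    moreover have "set (letters x) \<subseteq> {..<n}"
      using 2 f by (simp add: FA_def)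
    ultimately show ?case
      using Sp_const[OF Sp_word[of "letters x"], of c] by simp
  qed (simp_all add: Sp_zero Sp_add)
  thus ?thesis
    by (simp add: Sp_def comb_def)
qed


subsection \<open>Operations on classes\<close>

lemma ring_hecke: "ring (hecke q n)"
  unfolding hecke_def by (rule ideal.quotient_is_ring[OF hecke_ideal])

lemma hecke_class_hom: "hecke_class q n \<in> ring_hom (free_algebra n) (hecke q n)"
  using ideal.rcos_ring_hom[OF hecke_ideal[of q n]] unfolding hecke_def hecke_class_def[abs_def]
  by simp

lemma hecke_class_ops:
  assumes "f \<in> FA n" "g \<in> FA n"
  shows "hecke_class q n f \<oplus>\<^bsub>hecke q n\<^esub> hecke_class q n g = hecke_class q n (f + g)"
    and "hecke_class q n f \<otimes>\<^bsub>hecke q n\<^esub> hecke_class q n g = hecke_class q n (f * g)"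
proof -
  have "hecke_class q n (f \<oplus>\<^bsub>free_algebra n\<^esub> g) =
    hecke_class q n f \<oplus>\<^bsub>hecke q n\<^esub> hecke_class q n g"
    by (rule ring_hom_add[OF hecke_class_hom]) (simp_all add: assms)
  thus "hecke_class q n f \<oplus>\<^bsub>hecke q n\<^esub> hecke_class q n g = hecke_class q n (f + g)"
    by simp
  have "hecke_class q n (f \<otimes>\<^bsub>free_algebra n\<^esub> g) =
    hecke_class q n f \<otimes>\<^bsub>hecke q n\<^esub> hecke_class q n g"
    by (rule ring_hom_mult[OF hecke_class_hom]) (simp_all add: assms)
  thus "hecke_class q n f \<otimes>\<^bsub>hecke q n\<^esub> hecke_class q n g = hecke_class q n (f * g)"
    by simp
qed

lemma hecke_class_closed: "f \<in> FA n \<Longrightarrow> hecke_class q n f \<in> carrier (hecke q n)"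
  by (rule ring_hom_closed[OF hecke_class_hom]) simp

lemma hecke_class_one: "\<one>\<^bsub>hecke q n\<^esub> = hecke_class q n 1"
proof -
  have "hecke_class q n \<one>\<^bsub>free_algebra n\<^esub> = \<one>\<^bsub>hecke q n\<^esub>"
    by (rule ring_hom_one[OF hecke_class_hom])
  thus ?thesis
    by simp
qed

lemma hecke_class_mem: "f \<in> FA n \<Longrightarrow> g \<in> hecke_class q n f \<longleftrightarrow> g - f \<in> hecke_ideal q n"
  unfolding hecke_class_def a_r_coset_def'
  by (auto intro!: bexI[of _ "g - f"])

lemma hecke_class_eq_iff:
  assumes "f \<in> FA n" "g \<in> FA n"
  shows "hecke_class q n f = hecke_class q n g \<longleftrightarrow> f - g \<in> hecke_ideal q n"
proof
  assume "hecke_class q n f = hecke_class q n g"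
  moreover have "f \<in> hecke_class q n f"
    using hecke_class_mem[OF assms(1), of f q] by (simp add: hecke_ideal_closed)
  ultimately show "f - g \<in> hecke_ideal q n"
    using hecke_class_mem[OF assms(2)] by blast
next
  assume fg: "f - g \<in> hecke_ideal q n"
  have "x - f \<in> hecke_ideal q n \<longleftrightarrow> x - g \<in> hecke_ideal q n" for x
  proof
    assume "x - f \<in> hecke_ideal q n"
    from hecke_ideal_closed(2)[OF this fg] show "x - g \<in> hecke_ideal q n"
      by simp
  next
    assume "x - g \<in> hecke_ideal q n"
    from hecke_ideal_closed(4)[OF this fg] show "x - f \<in> hecke_ideal q n"
      by simp
  qed
  thus "hecke_class q n f = hecke_class q n g"
    using hecke_class_mem[OF assms(1)] hecke_class_mem[OF assms(2)] by blast
qed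

lemma hecke_carrier: "h \<in> carrier (hecke q n) \<Longrightarrow> \<exists>f\<in>FA n. h = hecke_class q n f"
  unfolding hecke_def FactRing_def A_RCOSETS_def' hecke_class_def by auto

lemma hecke_scale_class: "f \<in> FA n \<Longrightarrow> hecke_scale q n c (hecke_class q n f) = hecke_class q n (const_F c * f)"
  unfolding hecke_scale_def by (rule hecke_class_ops(2)[OF FA_closed(7)])

lemma list_prod_class:
  assumes "\<And>x. x \<in> set xs \<Longrightarrow> f x \<in> FA n"
  shows "list_prod (hecke q n) (map (\<lambda>x. hecke_class q n (f x)) xs) =
      hecke_class q n (prod_list (map f xs)) \<and> prod_list (map f xs) \<in> FA n"
  using assms
proof (induction xs)
  case Nil
  show ?case
    by (simp add: list_prod_def hecke_class_one FA_closed)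
next
  case (Cons x xs)
  hence f: "f x \<in> FA n" and IH: "prod_list (map f xs) \<in> FA n"
    "list_prod (hecke q n) (map (\<lambda>x. hecke_class q n (f x)) xs) = hecke_class q n (prod_list (map f xs))"
    by auto
  show ?case
    using IH(2) hecke_class_ops(2)[OF f IH(1), of q] FA_closed(6)[OF f IH(1)] by (simp add: list_prod_def)
qed

lemma finsum_class:
  assumes "finite A" "\<And>w. w \<in> A \<Longrightarrow> f w \<in> FA n"
  shows "(\<Oplus>\<^bsub>hecke q n\<^esub> w\<in>A. hecke_class q n (f w)) = hecke_class q n (\<Sum>w\<in>A. f w)"
proof -
  interpret R: ring "hecke q n"
    by (rule ring_hecke)
  show ?thesis
    using assms
  proof (induction rule: finite_induct)
    case empty
    have "hecke_class q n \<zero>\<^bsub>free_algebra n\<^esub> = \<zero>\<^bsub>hecke q n\<^esub>"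
      by (rule ring_hom_zero[OF hecke_class_hom ring_free_algebra ring_hecke])
    thus ?case
      by simp
  next
    case (insert w A)
    have "(\<Oplus>\<^bsub>hecke q n\<^esub> w\<in>insert w A. hecke_class q n (f w)) =
      hecke_class q n (f w) \<oplus>\<^bsub>hecke q n\<^esub> (\<Oplus>\<^bsub>hecke q n\<^esub> w\<in>A. hecke_class q n (f w))"
      using insert by (intro R.finsum_insert) (auto intro: hecke_class_closed)
    also have "(\<Oplus>\<^bsub>hecke q n\<^esub> w\<in>A. hecke_class q n (f w)) = hecke_class q n (\<Sum>w\<in>A. f w)"
      using insert by simp
    also have "hecke_class q n (f w) \<oplus>\<^bsub>hecke q n\<^esub> \<dots> = hecke_class q n (\<Sum>w\<in>insert w A. f w)"
      using insert hecke_class_ops(1)[of "f w" n "\<Sum>w\<in>A. f w" q] sum_FA[of A f n] by simp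
    finally show ?case .
  qed
qed

lemma inv_class:
  assumes "f \<in> FA n" "g \<in> FA n" "f * g - 1 \<in> hecke_ideal q n" "g * f - 1 \<in> hecke_ideal q n"
  shows "inv\<^bsub>hecke q n\<^esub> hecke_class q n f = hecke_class q n g"
proof -
  have "hecke_class q n f \<otimes>\<^bsub>hecke q n\<^esub> hecke_class q n g = \<one>\<^bsub>hecke q n\<^esub>"
    "hecke_class q n g \<otimes>\<^bsub>hecke q n\<^esub> hecke_class q n f = \<one>\<^bsub>hecke q n\<^esub>"
    using assms hecke_class_ops(2) hecke_class_eq_iff[OF FA_closed(6) FA_closed(2)] hecke_class_one
    by metis+
  thus ?thesis
    by (intro monoid.inv_char[OF ring.is_monoid[OF ring_hecke]] hecke_class_closed assms(1,2))
qed

definition op_rep :: "'k::field \<Rightarrow> (word \<Rightarrow>\<^sub>0 'k) \<Rightarrow> 'k lend" where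
  "op_rep q = ev (\<lambda>c. c) (hw (hop (q - inverse q)))"

lemma op_rep_simps:
  "op_rep q (f + g) = op_rep q f + op_rep q g" "op_rep q (f - g) = op_rep q f - op_rep q g" "op_rep q (f * g) = op_rep q f * op_rep q g"
  "op_rep q (const_F c) = sc c" "op_rep q (gen_F s) = hop (q - inverse q) s" "op_rep q 0 = 0" "op_rep q 1 = 1"
  "op_rep q (inv_F q s) = uop (q - inverse q) s"
proof -
  show *: "op_rep q (f - g) = op_rep q f - op_rep q g" "op_rep q (const_F c) = sc c"
    "op_rep q (gen_F s) = hop (q - inverse q) s" for f g c s
    unfolding op_rep_def by (rule ev_diff[OF fhom_id] ev_gen_const[OF fhom_id]; simp)+
  show "op_rep q (f + g) = op_rep q f + op_rep q g" "op_rep q (f * g) = op_rep q f * op_rep q g"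
    unfolding op_rep_def by (rule ev_add[OF fhom_id] ev_mult[OF fhom_id hw_add])+
  show "op_rep q 0 = 0"
    by (simp add: op_rep_def)
  show "op_rep q 1 = 1"
    using *(2)[of 1] by (simp add: const_F_simps)
  show "op_rep q (inv_F q s) = uop (q - inverse q) s"
    unfolding inv_F_def * by (simp add: hop_def)
qed

lemma op_rep_wprod: "op_rep q (wprod g x) = wprod (\<lambda>s. op_rep q (g s)) x"
  by (induction x) (simp_all add: op_rep_simps)

lemma op_rep_sum: "op_rep q (\<Sum>w\<in>A. g w) = (\<Sum>w\<in>A. op_rep q (g w))"
  by (induction A rule: infinite_finite_induct) (simp_all add: op_rep_simps)

lemma op_rep_inv_word: "op_rep q (wprod (inv_F q) x) = uword (q - inverse q) x"
  by (simp add: op_rep_wprod op_rep_simps uword_def)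

lemma op_rep_ideal: "q \<noteq> 0 \<Longrightarrow> f \<in> hecke_ideal q n \<Longrightarrow> op_rep q f = 0"
  unfolding op_rep_def by (rule ev_ideal(1)[OF fhom_id]) (auto intro: hecke_gens_hop)

definition rw :: "nat \<Rightarrow> cox \<Rightarrow> nat list" where
  "rw n u = reduced_word (cox_class n u)"

lemma rw: "u \<in> parabolic n \<Longrightarrow> set (rw n u) \<subseteq> {..<n} \<and> cw (rw n u) = u \<and> reduced (rw n u)"
  unfolding rw_def using reduced_word_class by blast

lemma ap_sum: "ap (\<Sum>u\<in>A. g u) v w = (\<Sum>u\<in>A. ap (g u) v w)"
  by (induction A rule: infinite_finite_induct) simp_all

lemma uword_independent:
  assumes "finite A" "\<And>u. u \<in> A \<Longrightarrow> reduced (x u)" "inj_on (\<lambda>u. cw (x u)) A"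
    and "(\<Sum>u\<in>A. sc (c u) * uword m (x u)) = 0" "u \<in> A"
  shows "c u = 0"
proof -
  have "0 = ap (\<Sum>v\<in>A. sc (c v) * uword m (x v)) (delta0 0) (cw (x u))"
    using assms(4) by simp
  also have "\<dots> = (\<Sum>v\<in>A. c v * delta0 (cw (x v)) (cw (x u)))"
    unfolding ap_sum using assms(2) by (intro sum.cong) (simp_all add: ap_uword_delta)
  also have "\<dots> = (\<Sum>v\<in>A. if v = u then c v else 0)"
    using assms(3,5) by (intro sum.cong) (auto simp: delta0_def inj_on_def)
  also have "\<dots> = c u"
    using assms(1,5) by simp
  finally show ?thesis
    by simp
qed

text \<open>Faithfulness: modulo the ideal \<open>f\<close> is a combination of products of inverse
  generators along reduced words, and these send \<open>delta0 0\<close> to distinct delta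
  functions.\<close>

lemma op_rep_kernel:
  assumes "q \<noteq> 0" "2 \<le> n" "f \<in> FA n" "op_rep q f = 0"
  shows "f \<in> hecke_ideal q n"
proof -
  have fin: "finite (parabolic n)"
    by (rule finite_parabolic[OF assms(2)])
  obtain c where c: "f - (\<Sum>w\<in>parabolic n. const_F (c w) * wprod (inv_F q) (rw n w)) \<in> hecke_ideal q n"
    using spanning[where f = f and d = "q - inverse q", OF cong_gens_inv[OF assms(1)] _ assms(2) rw assms(3)]
    by (auto simp: inv_F_def)
  from op_rep_ideal[OF assms(1) c]
  have "(\<Sum>w\<in>parabolic n. sc (c w) * uword (q - inverse q) (rw n w)) = 0"
    using assms(4) by (simp add: op_rep_simps op_rep_sum op_rep_inv_word)
  hence "c w = 0" if "w \<in> parabolic n" for w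
    using uword_independent[OF fin, of "rw n"] rw that by (simp add: inj_on_def)
  thus ?thesis
    using c by (simp add: const_F_simps)
qed

lemma hecke_class_eq_pi:
  assumes "q \<noteq> 0" "2 \<le> n" "f \<in> FA n" "g \<in> FA n"
  shows "hecke_class q n f = hecke_class q n g \<longleftrightarrow> op_rep q f = op_rep q g"
  unfolding hecke_class_eq_iff[OF assms(3,4)]
proof
  assume "f - g \<in> hecke_ideal q n"
  thus "op_rep q f = op_rep q g"
    using op_rep_ideal[OF assms(1), of "f - g" n] by (simp add: op_rep_simps)
next
  assume "op_rep q f = op_rep q g"
  thus "f - g \<in> hecke_ideal q n"
    by (intro op_rep_kernel[OF assms(1,2) FA_closed(5)[OF assms(3,4)]]) (simp add: op_rep_simps)
qed


subsection \<open>Coordinates\<close>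

lemma hecke_comb_class:
  assumes "2 \<le> n" "\<And>u. u \<in> parabolic n \<Longrightarrow> B (cox_class n u) = hecke_class q n (F u) \<and> F u \<in> FA n"
  shows "hecke_comb q n B c = hecke_class q n (\<Sum>u\<in>parabolic n. const_F (c (cox_class n u)) * F u)"
proof -
  interpret R: ring "hecke q n"
    by (rule ring_hecke)
  have mem: "const_F d * F u \<in> FA n" if "u \<in> parabolic n" for d u
    using assms(2)[OF that] by (intro FA_closed) auto
  have sc: "hecke_scale q n (c (cox_class n u)) (B (cox_class n u)) =
    hecke_class q n (const_F (c (cox_class n u)) * F u)" if "u \<in> parabolic n" for u
    using assms(2)[OF that] hecke_scale_class by metis
  have "hecke_comb q n B c =
    (\<Oplus>\<^bsub>hecke q n\<^esub> u\<in>parabolic n. hecke_scale q n (c (cox_class n u)) (B (cox_class n u)))"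
    unfolding hecke_comb_def W_D_eq
  proof (rule R.finsum_reindex[OF _ cox_class_inj])
    show "(\<lambda>w. hecke_scale q n (c w) (B w)) \<in> cox_class n ` parabolic n \<rightarrow> carrier (hecke q n)"
      by (auto simp: sc intro!: hecke_class_closed mem)
  qed
  also have "\<dots> = (\<Oplus>\<^bsub>hecke q n\<^esub> u\<in>parabolic n. hecke_class q n (const_F (c (cox_class n u)) * F u))"
    by (rule R.finsum_cong') (auto simp: sc intro!: hecke_class_closed mem)
  also have "\<dots> = hecke_class q n (\<Sum>u\<in>parabolic n. const_F (c (cox_class n u)) * F u)"
    by (rule finsum_class) (use finite_parabolic assms(1) mem in auto)
  finally show ?thesis .
qed

text \<open>Independence and spanning, stated modulo the ideal for representatives
  \<open>F u\<close>, justify the definite description in \<open>hecke_coords\<close>.\<close>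

lemma hecke_coords_class:
  assumes "2 \<le> n" and B: "\<And>u. u \<in> parabolic n \<Longrightarrow> B (cox_class n u) = hecke_class q n (F u) \<and> F u \<in> FA n"
    and indep: "\<And>c u. (\<Sum>u\<in>parabolic n. const_F (c u) * F u) \<in> hecke_ideal q n \<Longrightarrow> u \<in> parabolic n \<Longrightarrow> c u = 0"
    and span: "\<And>f. f \<in> FA n \<Longrightarrow> \<exists>c. f - (\<Sum>u\<in>parabolic n. const_F (c u) * F u) \<in> hecke_ideal q n"
    and f: "f \<in> FA n"
  defines "c \<equiv> hecke_coords q n B (hecke_class q n f)"
  shows "f - (\<Sum>u\<in>parabolic n. const_F (c (cox_class n u)) * F u) \<in> hecke_ideal q n"
proof -
  have mem: "(\<Sum>u\<in>parabolic n. const_F (d u) * F u) \<in> FA n" for d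
    using B by (intro sum_FA FA_closed) auto
  define P where "P d \<longleftrightarrow> (\<forall>w. w \<notin> W_D n \<longrightarrow> d w = 0) \<and> hecke_class q n f = hecke_comb q n B d" for d
  have P_iff: "P d \<longleftrightarrow> (\<forall>w. w \<notin> W_D n \<longrightarrow> d w = 0) \<and>
    f - (\<Sum>u\<in>parabolic n. const_F (d (cox_class n u)) * F u) \<in> hecke_ideal q n" for d
  proof -
    have "hecke_comb q n B d = hecke_class q n (\<Sum>u\<in>parabolic n. const_F (d (cox_class n u)) * F u)"
      by (rule hecke_comb_class[where B = B and F = F]) (use assms(1) B in auto)
    thus ?thesis
      unfolding P_def using hecke_class_eq_iff[OF f mem] by simp
  qed
  have "\<exists>!d. P d"
  proof -
    obtain e where e: "f - (\<Sum>u\<in>parabolic n. const_F (e u) * F u) \<in> hecke_ideal q n"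
      using span[OF f] by blast
    define d where "d w = (if w \<in> W_D n then e (the_inv_into (parabolic n) (cox_class n) w) else 0)" for w
    have "d (cox_class n u) = e u" if "u \<in> parabolic n" for u
      using that cox_class_inj by (simp add: d_def W_D_eq the_inv_into_f_f)
    hence "P d"
      unfolding P_iff using e by (simp add: d_def)
    moreover have "d1 = d2" if "P d1" "P d2" for d1 d2
    proof
      fix w
      have "(f - (\<Sum>u\<in>parabolic n. const_F (d2 (cox_class n u)) * F u)) -
        (f - (\<Sum>u\<in>parabolic n. const_F (d1 (cox_class n u)) * F u)) \<in> hecke_ideal q n"
        by (rule hecke_ideal_closed(4)) (use that in \<open>simp_all add: P_iff\<close>)
      hence "(\<Sum>u\<in>parabolic n. const_F (d1 (cox_class n u) - d2 (cox_class n u)) * F u) \<in> hecke_ideal q n"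
        by (simp add: const_F_simps left_diff_distrib sum_subtractf)
      from indep[OF this] have "d1 (cox_class n u) = d2 (cox_class n u)" if "u \<in> parabolic n" for u
        using that by simp
      thus "d1 w = d2 w"
        using that unfolding P_iff by (cases "w \<in> W_D n") (auto simp: W_D_eq)
    qed
    ultimately show ?thesis
      by blast
  qed
  hence "P (THE d. P d)"
    by (rule theI')
  moreover have "(THE d. P d) = c"
    by (simp add: c_def hecke_coords_def P_def)
  ultimately show ?thesis
    unfolding P_iff by simp
qed

lemma T_basis_class:
  fixes q :: "'k::field"
  assumes "u \<in> parabolic n"
  shows "T_basis q n (cox_class n u) = hecke_class q n (wprod gen_F (rw n u)) \<and> wprod gen_F (rw n u) \<in> (FA n :: (word \<Rightarrow>\<^sub>0 'k) set)"
proof -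
  have "gen_F s \<in> (FA n :: (word \<Rightarrow>\<^sub>0 'k) set)" if "s \<in> set (rw n u)" for s
    using rw[OF assms] that by (intro FA_closed) auto
  from list_prod_class[where f = gen_F and xs = "rw n u" and q = q, OF this] show ?thesis
    unfolding T_basis_def gen_def[abs_def] rw_def[symmetric] by simp
qed

lemma wprod_inverse:
  assumes "q \<noteq> 0" "2 \<le> n" "set x \<subseteq> {..<n}"
  shows "wprod gen_F x * wprod (inv_F q) (rev x) - 1 \<in> hecke_ideal q n"
    "wprod (inv_F q) (rev x) * wprod gen_F x - 1 \<in> hecke_ideal q n"
proof -
  define m where "m = q - inverse q"
  have FA: "wprod gen_F x \<in> (FA n :: (word \<Rightarrow>\<^sub>0 'a) set)" "wprod (inv_F q) (rev x) \<in> FA n"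
    using assms(3) by (auto intro!: wprod_FA FA_closed inv_F_FA)
  have "wprod (hop m) x * uword m (rev x) = 1 \<and> uword m (rev x) * wprod (hop m) x = 1"
  proof (induction x)
    case (Cons s x)
    hence "wprod (hop m) x * (uword m (rev x) * v) = v" for v
      by (metis mult.assoc mult_1_left)
    moreover have "uop m s * (hop m s * v) = v" for v
      by (simp add: hop_uop flip: mult.assoc)
    ultimately show ?case
      using Cons by (simp add: mult.assoc hop_uop)
  qed simp
  hence "op_rep q (wprod gen_F x * wprod (inv_F q) (rev x) - 1) = 0"
    "op_rep q (wprod (inv_F q) (rev x) * wprod gen_F x - 1) = 0"
    by (simp_all add: op_rep_simps op_rep_wprod m_def uword_def)
  thus "wprod gen_F x * wprod (inv_F q) (rev x) - 1 \<in> hecke_ideal q n"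
    "wprod (inv_F q) (rev x) * wprod gen_F x - 1 \<in> hecke_ideal q n"
    using FA by (auto intro!: op_rep_kernel[OF assms(1,2)] FA_closed)
qed

lemma T_inv_basis_class:
  assumes "q \<noteq> 0" "2 \<le> n" "u \<in> parabolic n"
  shows "T_inv_basis q n (cox_class n u) = hecke_class q n (wprod (inv_F q) (rev (rw n u))) \<and>
    wprod (inv_F q) (rev (rw n u)) \<in> FA n"
proof -
  have FA: "wprod (inv_F q) (rev (rw n u)) \<in> FA n"
    using rw[OF assms(3)] by (intro wprod_FA inv_F_FA) auto
  have T: "T_basis q n (cox_class n u) = hecke_class q n (wprod gen_F (rw n u))" "wprod gen_F (rw n u) \<in> (FA n :: (word \<Rightarrow>\<^sub>0 'a) set)"
    using T_basis_class[OF assms(3)] by blast+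
  show ?thesis
    unfolding T_inv_basis_def T(1)
    using inv_class[OF T(2) FA wprod_inverse[OF assms(1,2)]] rw[OF assms(3)] FA by blast
qed

lemma T_coords:
  assumes "q \<noteq> 0" "2 \<le> n" "f \<in> FA n"
  defines "c \<equiv> hecke_coords q n (T_basis q n) (hecke_class q n f)"
  shows "f - (\<Sum>u\<in>parabolic n. const_F (c (cox_class n u)) * wprod gen_F (rw n u)) \<in> hecke_ideal q n"
  unfolding c_def
proof (rule hecke_coords_class[where F = "\<lambda>u. wprod gen_F (rw n u)", OF assms(2) T_basis_class])
  fix d u assume d: "(\<Sum>u\<in>parabolic n. const_F (d u) * wprod gen_F (rw n u)) \<in> hecke_ideal q n"
    and u: "u \<in> parabolic n"
  define m where "m = q - inverse q"
  \<comment> \<open>A second representation: \<open>uop (- m)\<close> satisfies the quadratic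
    relation of the generators themselves, so products of generators along reduced words become
    words in \<open>uop\<close>, whose independence is known.\<close>
  define F :: "(word \<Rightarrow>\<^sub>0 'a) \<Rightarrow> 'a lend" where "F = ev (\<lambda>c. c) (hw (uop (- m)))"
  have F: "F (g + h) = F g + F h" "F (g * h) = F g * F h" "F (const_F c) = sc c" "F (gen_F s) = uop (- m) s"
    for g h c s
    unfolding F_def by (rule ev_add[OF fhom_id] ev_mult[OF fhom_id hw_add] ev_gen_const[OF fhom_id]; simp)+
  have F1: "F 1 = 1" and F0: "F 0 = 0"
    using F(3)[of 1] F(3)[of 0] by (simp_all add: const_F_simps)
  have Fsum: "F (\<Sum>u\<in>A. g u) = (\<Sum>u\<in>A. F (g u))" for g and A :: "cox set"
    by (induction A rule: infinite_finite_induct) (simp_all add: F F0)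
  have Fw: "F (wprod gen_F x) = uword (- m) x" for x
    by (induction x) (simp_all add: F F1)
  have "F (\<Sum>u\<in>parabolic n. const_F (d u) * wprod gen_F (rw n u)) = 0"
    unfolding F_def
    by (rule ev_ideal(1)[OF fhom_id assms(1) _ d]) (use hecke_gens_uop[of "- m" n] in \<open>simp add: m_def\<close>)
  hence "(\<Sum>u\<in>parabolic n. sc (d u) * uword (- m) (rw n u)) = 0"
    by (simp add: Fsum F Fw)
  thus "d u = 0"
    by (rule uword_independent[OF finite_parabolic[OF assms(2)], rotated 2])
       (use rw u in \<open>simp_all add: inj_on_def\<close>)
next
  fix f assume "f \<in> (FA n :: (word \<Rightarrow>\<^sub>0 'a) set)"
  thus "\<exists>c. f - (\<Sum>u\<in>parabolic n. const_F (c u) * wprod gen_F (rw n u)) \<in> hecke_ideal q n"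
    using spanning[where f = f and d = 0, OF cong_gens_gen[OF assms(1)] _ assms(2) rw] by (auto simp: const_F_simps)
qed (use assms(3) in auto)

lemma T_inv_coords:
  assumes "q \<noteq> 0" "2 \<le> n" "f \<in> FA n"
  defines "c \<equiv> hecke_coords q n (T_inv_basis q n) (hecke_class q n f)"
  shows "f - (\<Sum>u\<in>parabolic n. const_F (c (cox_class n u)) * wprod (inv_F q) (rev (rw n u))) \<in> hecke_ideal q n"
  unfolding c_def
proof (rule hecke_coords_class[where F = "\<lambda>u. wprod (inv_F q) (rev (rw n u))",
      OF assms(2) T_inv_basis_class[OF assms(1,2)]])
  fix d u assume d: "(\<Sum>u\<in>parabolic n. const_F (d u) * wprod (inv_F q) (rev (rw n u))) \<in> hecke_ideal q n"
    and u: "u \<in> parabolic n"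
  have "(\<Sum>u\<in>parabolic n. sc (d u) * uword (q - inverse q) (rev (rw n u))) = 0"
    using op_rep_ideal[OF assms(1) d] by (simp add: op_rep_sum op_rep_simps op_rep_inv_word)
  thus "d u = 0"
    by (rule uword_independent[OF finite_parabolic[OF assms(2)], rotated 2])
       (use rw u in \<open>simp_all add: inj_on_def reduced_rev cw_rev\<close>)
next
  fix f assume f: "f \<in> (FA n :: (word \<Rightarrow>\<^sub>0 'a) set)"
  \<comment> \<open>Inverting a product of generators multiplies the inverse generators along the
    reversed word, a reduced word of the inverse element; hence the reindexing by
    \<open>- u\<close>.\<close>
  define rd where "rd u = rev (rw n (- u))" for u
  have rd: "set (rd u) \<subseteq> {..<n} \<and> cw (rd u) = u \<and> reduced (rd u)" if "u \<in> parabolic n" for u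
    using rw[OF parabolic_uminus[OF that]] by (simp add: rd_def reduced_rev cw_rev)
  obtain c where c: "f - (\<Sum>u\<in>parabolic n. const_F (c u) * wprod (inv_F q) (rd u)) \<in> hecke_ideal q n"
    using spanning[where f = f and d = "q - inverse q", OF cong_gens_inv[OF assms(1)] _ assms(2) rd f]
    by (auto simp: inv_F_def)
  have "(\<Sum>u\<in>parabolic n. const_F (c u) * wprod (inv_F q) (rd u)) =
    (\<Sum>u\<in>parabolic n. const_F (c (- u)) * wprod (inv_F q) (rev (rw n u)))"
    by (rule sum.reindex_bij_witness[of _ uminus uminus]) (auto simp: rd_def parabolic_uminus)
  thus "\<exists>c. f - (\<Sum>u\<in>parabolic n. const_F (c u) * wprod (inv_F q) (rev (rw n u))) \<in> hecke_ideal q n"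
    using c by (intro exI[of _ "\<lambda>u. c (- u)"]) simp
qed (use assms(3) in auto)

text \<open>The operator of the basis element indexed by \<open>u\<close> sends
  \<open>delta0 0\<close> to \<open>delta0 (- u)\<close>, so evaluation at the identity singles out
  the coefficient of \<open>u = 0\<close>.\<close>

lemma hecke_tau_class:
  assumes "q \<noteq> 0" "2 \<le> n" "f \<in> FA n"
  shows "hecke_tau q n (hecke_class q n f) = tau (op_rep q f)"
proof -
  define c where "c = hecke_coords q n (T_inv_basis q n) (hecke_class q n f)"
  define m where "m = q - inverse q"
  have "op_rep q f = (\<Sum>u\<in>parabolic n. sc (c (cox_class n u)) * uword m (rev (rw n u)))"
    using op_rep_ideal[OF assms(1) T_inv_coords[OF assms]]
    by (simp add: op_rep_simps op_rep_sum op_rep_inv_word m_def flip: c_def)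
  hence "tau (op_rep q f) = (\<Sum>u\<in>parabolic n. c (cox_class n u) * ap (uword m (rev (rw n u))) (delta0 0) 0)"
    by (simp add: tau_def ap_sum)
  also have "\<dots> = (\<Sum>u\<in>parabolic n. if u = 0 then c (cox_class n u) else 0)"
  proof (rule sum.cong[OF refl])
    fix u assume "u \<in> parabolic n"
    hence "ap (uword m (rev (rw n u))) (delta0 0) = delta0 (- u)"
      using rw by (simp add: ap_uword_delta reduced_rev cw_rev)
    moreover have "delta0 (- u) 0 = (if u = 0 then 1 else 0 :: 'a)"
      by (simp add: delta0_def)
    ultimately show "c (cox_class n u) * ap (uword m (rev (rw n u))) (delta0 0) 0 =
      (if u = 0 then c (cox_class n u) else 0)"
      by simp
  qed
  also have "\<dots> = c (W_e n)"
    using finite_parabolic[OF assms(2)] by (simp add: W_e_eq)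
  finally show ?thesis
    by (simp add: hecke_tau_def c_def)
qed

section \<open>The trace on operators\<close>

definition hspan :: "'k::field \<Rightarrow> nat \<Rightarrow> 'k lend \<Rightarrow> bool" where
  "hspan m n = aspan (\<lambda>z. \<exists>c x. set x \<subseteq> {..<n} \<and> z = sc c * wprod (hop m) x)"

lemma hspan_word: "set x \<subseteq> {..<n} \<Longrightarrow> hspan m n (sc c * wprod (hop m) x)"
  unfolding hspan_def by (rule aspan_base) blast

lemma hspan_one: "hspan m n 1"
  using hspan_word[of "[]" n m 1] by simp

lemma hspan_zero: "hspan m n 0"
  by (simp add: hspan_def aspan_zero)

lemma hspan_add: "hspan m n A \<Longrightarrow> hspan m n C \<Longrightarrow> hspan m n (A + C)"
  by (simp add: hspan_def aspan_add)

lemma hspan_map: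
  assumes "hspan m n A" "f 0 = 0" "\<And>x y. f (x + y) = f x + f y"
    "\<And>c x. set x \<subseteq> {..<n} \<Longrightarrow> hspan m n (f (sc c * wprod (hop m) x))"
  shows "hspan m n (f A)"
  using assms(1) unfolding hspan_def
  by (rule aspan_map) (use assms in \<open>auto simp: hspan_def\<close>)

lemma hspan_scale: "hspan m n A \<Longrightarrow> hspan m n (sc d * A)"
proof (rule hspan_map[where f = "\<lambda>A. sc d * A"])
  fix c x assume "set x \<subseteq> {..<n}"
  thus "hspan m n (sc d * (sc c * wprod (hop m) x))"
    using hspan_word[of x n m "d * c"] by (simp add: sc_mult mult.assoc)
qed (simp_all add: distrib_left)

lemma hspan_right: "hspan m n A \<Longrightarrow> s < n \<Longrightarrow> hspan m n (A * hop m s)"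
proof (rule hspan_map[where f = "\<lambda>A. A * hop m s"])
  fix c x assume "set x \<subseteq> {..<n}" "s < n"
  thus "hspan m n (sc c * wprod (hop m) x * hop m s)"
    using hspan_word[of "x @ [s]" n m c] by (simp add: mult.assoc)
qed (simp_all add: distrib_right)

lemma Sop_hword: "Sop * wprod (hop m) x = wprod (hop m) (map flip x) * Sop"
proof (induction x)
  case (Cons s x)
  have "Sop * wprod (hop m) (s # x) = hop m (flip s) * (Sop * wprod (hop m) x)"
    by (simp add: Sop_hop flip: mult.assoc)
  thus ?case
    using Cons by (simp add: mult.assoc)
qed simp

lemma hspan_conj: "hspan m n A \<Longrightarrow> 2 \<le> n \<Longrightarrow> hspan m n (Sop * A * Sop)"
proof (rule hspan_map[where f = "\<lambda>A. Sop * A * Sop"])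
  fix c x assume x: "set x \<subseteq> {..<n}" "2 \<le> n"
  have "Sop * (sc c * wprod (hop m) x) * Sop = sc c * (Sop * wprod (hop m) x) * Sop"
    by (metis mult.assoc sc_commute)
  also have "\<dots> = sc c * wprod (hop m) (map flip x)"
    unfolding Sop_hword by (simp add: mult.assoc Sop_Sop)
  finally show "hspan m n (Sop * (sc c * wprod (hop m) x) * Sop)"
    using hspan_word[of "map flip x" n m c] x flip_less by fastforce
qed (simp_all add: distrib_left distrib_right)

text \<open>An odd element is \<open>Sop\<close> times an element of the type D algebra, and this
  algebra is stable under conjugation by \<open>Sop\<close>.\<close>

lemma lend_B_hspan: "lend.B m n p A \<Longrightarrow> 2 \<le> n \<Longrightarrow> hspan m n (if p then Sop * A else A)"
proof (induction rule: lend.B.induct)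
  case (B_add p x y)
  thus ?case
    by (cases p) (simp_all add: distrib_left hspan_add)
next
  case (B_scale p x c)
  have "Sop * (sc c * x) = sc c * (Sop * x)"
    by (metis mult.assoc sc_commute)
  thus ?case
    using B_scale by (cases p) (simp_all add: hspan_scale)
next
  case (B_right_S p x)
  show ?case
  proof (cases p)
    case True
    thus ?thesis
      using hspan_conj[of m n x] B_right_S by (simp add: mult.assoc)
  next
    case False
    hence "hspan m n (Sop * (Sop * x) * Sop)"
      using hspan_conj[of m n "Sop * x"] B_right_S by simp
    thus ?thesis
      using False by (simp add: Sop_Sop flip: mult.assoc)
  qed
next
  case (B_right_t p x i)
  thus ?case
    using hspan_right[of m n _ i] by (cases p) (simp_all add: mult.assoc[symmetric])
qed (simp_all add: hspan_zero hspan_one)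

lemma lend_B_even_hspan: "lend.B m n False A \<Longrightarrow> 2 \<le> n \<Longrightarrow> hspan m n A"
  using lend_B_hspan[of m n False A] by simp

lemma ap_hop: "ap (hop m s) v w = ap (uop m s) v w + m * v w"
  by (simp add: hop_def)

lemma left_op_hop: "left_op m (hop m s)"
  unfolding hop_def by (intro left_op_simps)

lemma left_op_hword: "left_op m (wprod (hop m) x)"
  by (induction x) (simp_all add: left_op_simps left_op_hop)

lemma left_op_hspan: "hspan m n A \<Longrightarrow> left_op m A"
  unfolding hspan_def
proof (induction rule: aspan.induct)
  case (aspan_base z)
  thus ?case
    by (auto intro: left_op_simps left_op_hword)
next
  case aspan_zero
  show ?case
    by (simp add: left_op_def)
qed (simp_all add: left_op_simps)

text \<open>Letters below \<open>n\<close> lead neither into nor out of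
  \<open>parabolic n\<close>.\<close>

lemma hspan_support: "hspan m n A \<Longrightarrow> w \<notin> parabolic n \<Longrightarrow> ap A (delta0 0) w = 0"
  unfolding hspan_def
proof (induction rule: aspan.induct)
  case (aspan_base z)
  have "ap (wprod (hop m) x) (delta0 0) w = 0" if "set x \<subseteq> {..<n}" "w \<notin> parabolic n" for x w
    using that
  proof (induction x arbitrary: w)
    case (Cons s x)
    have "cg s + w \<notin> parabolic n"
    proof
      assume a: "cg s + w \<in> parabolic n"
      have "cg s + (cg s + w) \<in> parabolic n"
        by (rule parabolic_add[OF parabolic_cg a]) (use Cons.prems in auto)
      thus False
        using Cons.prems by simp
    qed
    hence "ap (wprod (hop m) x) (delta0 0) (cg s + w) = 0" "ap (wprod (hop m) x) (delta0 0) w = 0"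
      using Cons by auto
    thus ?case
      by (simp add: ap_hop ap_uop)
  next
    case (Nil w)
    hence "w \<noteq> 0"
      by auto
    thus ?case
      by (simp add: delta0_def)
  qed
  thus ?case
    using aspan_base by auto
qed simp_all

lemma tau_hspan_commute:
  assumes "left_op m A" "hspan m n C"
  shows "tau (A * C) = tau (C * A)"
  using assms(2) unfolding hspan_def
proof (induction rule: aspan.induct)
  case (aspan_base z)
  then obtain c x where z: "z = sc c * wprod (hop m) x"
    by blast
  have hop: "tau (A * hop m s) = tau (hop m s * A)" if "left_op m A" for A s
    using tau_uop_commute[OF that, of s] by (simp add: hop_def distrib_left distrib_right flip: sc_commute)
  have "tau (A * wprod (hop m) x) = tau (wprod (hop m) x * A)" if "left_op m A" for A x
    using that
  proof (induction x arbitrary: A)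
    case (Cons s x)
    have s: "left_op m (hop m s)"
      by (rule left_op_hop)
    have "tau (A * wprod (hop m) (s # x)) = tau (wprod (hop m) x * (A * hop m s))"
      using Cons.IH[OF left_op_simps(6)[OF Cons.prems s]] by (simp add: mult.assoc)
    also have "\<dots> = tau (hop m s * (wprod (hop m) x * A))"
      using hop[OF left_op_simps(6)[OF left_op_hword Cons.prems], of x s] by (simp add: mult.assoc)
    finally show ?case
      by (simp add: mult.assoc)
  qed simp
  moreover have "A * (sc c * wprod (hop m) x) = sc c * (A * wprod (hop m) x)"
    by (metis mult.assoc sc_commute)
  ultimately show ?case
    using assms(1) by (simp add: z mult.assoc)
qed (simp_all add: distrib_left distrib_right)

definition jw :: "nat \<Rightarrow> nat list" where
  "jw i = (if i \<le> 1 then [] else JM_word i)"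

text \<open>The middle of the word uses \<open>uop m 0 = Sop * uop m 1 * Sop\<close>, and the later
  letters commute with \<open>Sop\<close>. Up to the commuting letters 0 and 1 the word is a
  palindrome, so its reversal gives the same operator.\<close>

lemma uword_jw:
  assumes "1 \<le> i"
  shows "uword m (jw i) = Sop * lend.Lam m i \<and> uword m (rev (jw i)) = Sop * lend.Lam m i"
  using assms
proof (induction i rule: dec_induct)
  case base
  show ?case
    by (simp add: jw_def Sop_Sop)
next
  case (step i)
  show ?case
  proof (cases "i = 1")
    case True
    have "uop m 0 * uop m 1 = uop m 1 * uop m 0"
      by (rule uop_commute) (simp_all add: adjacent_def)
    moreover have "Sop * (uop m 1 * Sop * uop m 1) = uop m 0 * uop m 1"
      using Sop_uop_Sop[of m] by (simp add: mult.assoc[symmetric])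
    moreover have "jw (Suc i) = [0, 1]"
      using True JM_word_2 by (simp add: jw_def numeral_2_eq_2)
    ultimately show ?thesis
      using True by (simp add: mult.assoc)
  next
    case False
    hence i: "2 \<le> i"
      using step.hyps by simp
    have "jw (Suc i) = i # jw i @ [i]"
      using i JM_word_Suc[of i] by (simp add: jw_def)
    moreover have "uop m i * Sop = Sop * uop m i"
      by (rule lend.S_u[OF i, symmetric])
    hence "uop m i * (Sop * v) = Sop * (uop m i * v)" for v
      by (metis mult.assoc)
    ultimately show ?thesis
      using step.IH i by (simp add: mult.assoc)
  qed
qed

global_interpretation lend_tau: hecke_B_trace sc Sop "uop m" "hop m" m tau for m :: "'k::field"
proof
  fix x y :: "'k lend" and c :: 'k and n :: nat
  show "tau (x + y) = tau x + tau y" "tau (sc c * x) = c * tau x" "tau (1 :: 'k lend) = 1"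
    by simp_all
  show "tau (Sop * x * Sop) = tau x"
    by (rule tau_Sop)
  show "tau (uop m 1) = 0"
    using cg_neq_zero by (simp add: tau_def ap_uop delta0_def)
  show "tau (x * y) = tau (y * x)" if "lend.B m n False x" "lend.B m n False y"
  proof -
    have "hspan m (max n 2) x" "hspan m (max n 2) y"
      by (rule lend_B_even_hspan[OF lend.B_mono[OF that(1)]] lend_B_even_hspan[OF lend.B_mono[OF that(2)]];
          simp)+
    thus ?thesis
      using tau_hspan_commute left_op_hspan by blast
  qed
  \<comment> \<open>The letter \<open>n\<close> moves the point of evaluation to
    \<open>cg n\<close>, outside \<open>parabolic n\<close>, which contains the support of
    \<open>ap x (delta0 0)\<close>.\<close>
  show "tau (x * uop m n) = 0" if "2 \<le> n" "lend.B m n False x"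
  proof -
    have x: "hspan m n x"
      using that by (intro lend_B_even_hspan)
    have "tau (x * uop m n) = tau (uop m n * x)"
      by (rule tau_uop_commute[OF left_op_hspan[OF x]])
    also have "\<dots> = ap x (delta0 0) (cg n)"
      by (simp add: tau_def ap_uop)
    also have "\<dots> = 0"
      by (rule hspan_support[OF x parabolic_cg_not])
    finally show ?thesis .
  qed
  \<comment> \<open>Split \<open>x * lend.Lam m n\<close> into the even element
    \<open>x * Sop\<close> and \<open>Sop * lend.Lam m n\<close>, the operator of a reduced word.
    The trace is then a value of \<open>x * Sop\<close> outside \<open>parabolic (n - 1)\<close>.
    For \<open>n = 2\<close> the element \<open>x * Sop\<close> is a scalar.\<close>
  show "tau (x * lend.Lam m n) = 0" if n: "2 \<le> n" and x: "lend.B m (n - 1) True x"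
  proof -
    define w where "w = - cw (JM_word n)"
    have red: "reduced (JM_word n)"
      by (rule JM_word_reduced[OF n])
    have e: "lend.B m (n - 1) False (x * Sop)"
      by (rule lend.B_mult[OF x lend.B_S]) (use n in auto)
    have h: "hspan m n (x * Sop)"
      by (rule lend_B_even_hspan[OF lend.B_mono[OF e] n]) simp
    have "x * lend.Lam m n = (x * Sop) * uword m (jw n)"
      using uword_jw[of n m] n by (simp add: mult.assoc)
    hence "tau (x * lend.Lam m n) = tau (uword m (JM_word n) * (x * Sop))"
      using tau_uword_commute[OF left_op_hspan[OF h], of "JM_word n"] n by (simp add: jw_def)
    also have "\<dots> = ap (x * Sop) (delta0 0) w"
      unfolding tau_def w_def ap_simps(6)[of "uword m (JM_word n)"] by (rule ap_uword_zero[OF red])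
    also have "\<dots> = 0"
    proof (cases "n = 2")
      case True
      obtain d where "x * Sop = sc d"
        using lend.B_1[OF e] True by auto
      moreover have "clen w = 2"
        using red True by (simp add: w_def reduced_def JM_word_2)
      hence "w \<noteq> 0"
        by auto
      ultimately show ?thesis
        by (simp add: delta0_def)
    next
      case False
      hence n3: "2 \<le> n - 1"
        using n by simp
      have "w \<notin> parabolic (n - 1)"
      proof
        assume "w \<in> parabolic (n - 1)"
        hence "cw (JM_word (Suc (n - 1))) \<in> parabolic (n - 1)"
          using parabolic_uminus[of w "n - 1"] n by (simp add: w_def)
        thus False
          using JM_word_notin[OF n3] by simp
      qed
      thus ?thesis
        using hspan_support[OF lend_B_even_hspan[OF e n3]] by simp
    qed
    finally show ?thesis .
  qed
qed


section \<open>Uniqueness of Markov traces on the presented algebra\<close>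

lemma hspan_pi:
  assumes "hspan (q - inverse q) n A"
  shows "\<exists>f\<in>FA n. op_rep q f = A"
  using assms unfolding hspan_def
proof (induction rule: aspan.induct)
  case aspan_zero
  show ?case
    by (rule bexI[of _ 0]) (simp_all add: op_rep_simps FA_closed)
next
  case (aspan_base z)
  then obtain c x where z: "set x \<subseteq> {..<n}" "z = sc c * wprod (hop (q - inverse q)) x"
    by blast
  have "const_F c * wprod gen_F x \<in> FA n"
    using z(1) by (intro FA_closed wprod_FA) auto
  moreover have "op_rep q (const_F c * wprod gen_F x) = z"
    by (simp add: op_rep_simps op_rep_wprod z(2))
  ultimately show ?case
    by blast
next
  case (aspan_add x y)
  then obtain f g where "f \<in> FA n" "op_rep q f = x" "g \<in> FA n" "op_rep q g = y"
    by blast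
  thus ?case
    by (intro bexI[of _ "f + g"]) (simp_all add: op_rep_simps FA_closed)
qed

lemma FA_mono: "f \<in> FA n \<Longrightarrow> n \<le> k \<Longrightarrow> f \<in> FA k"
  unfolding FA_def using order_less_le_trans by (fastforce simp: subset_iff)

lemma lend_B_ev:
  assumes s: "fhom s" and n: "2 \<le> n" and f: "f \<in> FA n"
  shows "lend.B m n False (ev s (hw (hop m)) f)"
proof -
  have w: "lend.B m n False (wprod (hop m) x)" if "set x \<subseteq> {..<n}" for x
    using that
  proof (induction x)
    case (Cons t x)
    thus ?case
      using lend.B_mult[OF lend_B_hop[OF n, of t m], of False "wprod (hop m) x" False] by simp
  qed (simp add: lend.B_one)
  have "lend.B m n False (\<Sum>x\<in>A. sc (s (Poly_Mapping.lookup f x)) * hw (hop m) x)"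
    if "A \<subseteq> Poly_Mapping.keys f" for A
    using that
  proof (induction A rule: infinite_finite_induct)
    case (insert x A)
    have "lend.B m n False (hw (hop m) x)"
      unfolding hw_def using insert.prems f by (intro w) (auto simp: FA_def)
    thus ?case
      using insert by (simp add: lend.B_add lend.B_scale)
  qed (simp_all add: lend.B_zero)
  thus ?thesis
    unfolding ev_def by blast
qed

text \<open>\<open>D\<close> stands for the difference of two Markov traces with equal constants and
  equal prescribed values, and \<open>VF n\<close> for a representative of U_1 ... U_n. By induction
  on the rank the Markov rules supply the hypotheses of \<open>markov_zero\<close>.\<close>

lemma markov_trace_zero:
  fixes q :: "'k::field" and D :: "nat \<Rightarrow> (word \<Rightarrow>\<^sub>0 'k) \<Rightarrow> 'r::field"
  assumes q: "q \<noteq> 0" and rho: "\<rho> \<noteq> 0"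
    and ideal: "\<And>n f. 2 \<le> n \<Longrightarrow> f \<in> hecke_ideal q n \<Longrightarrow> D n f = 0"
    and add: "\<And>n f g. 2 \<le> n \<Longrightarrow> f \<in> FA n \<Longrightarrow> g \<in> FA n \<Longrightarrow> D n (f + g) = D n f + D n g"
    and scale: "\<And>n f c. 2 \<le> n \<Longrightarrow> f \<in> FA n \<Longrightarrow> D n (const_F c * f) = \<epsilon> c * D n f"
    and trace: "\<And>n f g. 2 \<le> n \<Longrightarrow> f \<in> FA n \<Longrightarrow> g \<in> FA n \<Longrightarrow> D n (f * g) = D n (g * f)"
    and embed: "\<And>n f. 3 \<le> n \<Longrightarrow> f \<in> FA (n - 1) \<Longrightarrow> D n f = \<rho> * D (n - 1) f"
    and markov: "\<And>n f. 3 \<le> n \<Longrightarrow> f \<in> FA (n - 1) \<Longrightarrow> D n (f * gen_F (n - 1)) = \<mu> * D (n - 1) f"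
    and one: "\<And>n. 2 \<le> n \<Longrightarrow> D n 1 = 0"
    and V: "\<And>n. 2 \<le> n \<Longrightarrow> even n \<Longrightarrow> VF n \<in> FA n \<and> op_rep q (VF n) = lend.V (q - inverse q) n \<and> D n (VF n) = 0"
    and n: "2 \<le> n" and f: "f \<in> FA n"
  shows "D n f = 0"
proof -
  define m where "m = q - inverse q"
  have eqD: "D n f = D n g" if "2 \<le> n" "f \<in> FA n" "g \<in> FA n" "op_rep q f = op_rep q g" for n f g
  proof -
    have I: "f - g \<in> hecke_ideal q n"
      using that by (intro op_rep_kernel[OF q that(1)] FA_closed) (simp_all add: op_rep_simps)
    have "D n ((f - g) + g) = D n (f - g) + D n g"
      by (rule add[OF that(1) hecke_ideal_FA[OF I] that(3)])
    thus ?thesis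
      using ideal[OF that(1) I] by simp
  qed
  \<comment> \<open>\<open>D\<close> descends to operators because the kernel of
    \<open>op_rep\<close> is the ideal; the choice of representative is immaterial by
    \<open>eqD\<close>.\<close>
  define \<phi> where "\<phi> n A = D n (SOME f. f \<in> FA n \<and> op_rep q f = A)" for n A
  have phi: "\<phi> n (op_rep q f) = D n f" if "2 \<le> n" "f \<in> FA n" for n f
  proof -
    have "(SOME g. g \<in> FA n \<and> op_rep q g = op_rep q f) \<in> FA n \<and> op_rep q (SOME g. g \<in> FA n \<and> op_rep q g = op_rep q f) = op_rep q f"
      by (rule someI[of "\<lambda>g. g \<in> FA n \<and> op_rep q g = op_rep q f" f]) (use that in simp)
    thus ?thesis
      unfolding \<phi>_def using eqD[OF that(1) _ that(2)] by blast
  qed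
  have rep: "\<exists>f\<in>FA n. op_rep q f = A" if "2 \<le> n" "lend.B m n False A" for n A
    using hspan_pi[of q n A] lend_B_even_hspan[OF that(2,1)] by (simp add: m_def)
  have main: "\<phi> n x = 0"
    if n: "2 \<le> n" and low: "\<And>x. lend.B m (n - 1) False x \<Longrightarrow> \<phi> n x = 0"
      and mid: "\<And>p x y. lend.B m (n - 1) p x \<Longrightarrow> lend.B m (n - 1) p y \<Longrightarrow> \<phi> n (x * hop m (n - 1) * y) = 0"
      and x: "lend.B m n False x" for n x
  proof -
    interpret Z: markov_zero sc Sop "uop m" "hop m" m "\<phi> n" \<epsilon> n
    proof
      fix x y c assume "lend.B m n False x"
      then obtain f where f: "f \<in> FA n" "x = op_rep q f"
        using rep[OF n] by blast
      show "\<phi> n (sc c * x) = \<epsilon> c * \<phi> n x"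
        using scale[OF n f(1), of c] phi[OF n f(1)] phi[OF n FA_closed(6)[OF FA_closed(7) f(1)], of c]
        by (simp add: f(2) op_rep_simps)
      assume "lend.B m n False y"
      then obtain g where g: "g \<in> FA n" "y = op_rep q g"
        using rep[OF n] by blast
      show "\<phi> n (x + y) = \<phi> n x + \<phi> n y"
        using add[OF n f(1) g(1)] phi[OF n f(1)] phi[OF n g(1)] phi[OF n FA_closed(3)[OF f(1) g(1)]]
        by (simp add: f(2) g(2) op_rep_simps)
      show "\<phi> n (x * y) = \<phi> n (y * x)"
        using trace[OF n f(1) g(1)] phi[OF n FA_closed(6)[OF f(1) g(1)]] phi[OF n FA_closed(6)[OF g(1) f(1)]]
        by (simp add: f(2) g(2) op_rep_simps)
    qed (use n low mid in auto)
    show ?thesis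
    proof (rule Z.phi_vanishes[OF _ x])
      assume "even n"
      thus "\<phi> n (lend.V m n) = 0"
        using V[OF n] phi[OF n, of "VF n"] by (simp add: m_def)
    qed
  qed
  have D3: "D 3 f = \<rho> * D 2 f" if "f \<in> FA 2" for f
    using embed[of 3 f] that by simp
  \<comment> \<open>The Markov rule does not reach rank two. In rank three the generators
    \<open>s\<close> and \<open>2\<close> are \<open>x * y\<close> and \<open>y * x\<close> for the
    product \<open>x\<close> of the inverses of \<open>2\<close> and \<open>s\<close> and
    \<open>y = gen_F s * gen_F 2 * gen_F s\<close>, so their values agree; \<open>rho\<close> allows
    the return to rank two.\<close>
  have D2: "D 2 (gen_F s) = 0" if s: "s < 2" for s
  proof -
    have adj: "adjacent s 2"
      using s by (auto simp: adjacent_def)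
    have s3: "gen_F s \<in> FA 3" "gen_F 2 \<in> FA 3" "inv_F q s \<in> FA 3" "inv_F q 2 \<in> FA 3" "gen_F s \<in> FA 2"
      using s by (auto intro!: FA_closed inv_F_FA)
    have br: "hop m s * hop m 2 * hop m s = hop m 2 * hop m s * hop m 2"
      by (rule hop_braid[OF adj])
    have "D 3 (gen_F s) = D 3 ((inv_F q 2 * inv_F q s) * (gen_F s * gen_F 2 * gen_F s))"
    proof (rule eqD)
      have "uop m 2 * uop m s * (hop m s * hop m 2 * hop m s) = hop m s"
        by (simp add: mult.assoc hop_uop) (simp add: hop_uop flip: mult.assoc)
      thus "op_rep q (gen_F s) = op_rep q ((inv_F q 2 * inv_F q s) * (gen_F s * gen_F 2 * gen_F s))"
        by (simp add: op_rep_simps flip: m_def)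
    qed (use s3 in \<open>auto intro!: FA_closed(6)\<close>)
    also have "\<dots> = D 3 ((gen_F s * gen_F 2 * gen_F s) * (inv_F q 2 * inv_F q s))"
      using s3 by (intro trace FA_closed(6)) auto
    also have "\<dots> = D 3 (gen_F 2)"
    proof (rule eqD)
      have "hop m s * hop m 2 * hop m s * (uop m 2 * uop m s) = hop m 2"
        unfolding br by (simp add: mult.assoc hop_uop)
      thus "op_rep q (gen_F s * gen_F 2 * gen_F s * (inv_F q 2 * inv_F q s)) = op_rep q (gen_F 2)"
        by (simp add: op_rep_simps flip: m_def)
    qed (use s3 in \<open>auto intro!: FA_closed(6)\<close>)
    also have "\<dots> = 0"
      using markov[of 3 1] one[of 2] by (simp add: FA_closed)
    finally show ?thesis
      using D3[OF s3(5)] rho by simp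
  qed
  have "\<phi> n x = 0" if "2 \<le> n" "lend.B m n False x" for n x
    using that
  proof (induction n arbitrary: x rule: dec_induct)
    case base
    have gen: "\<phi> 2 (sc c * hop m s) = 0" if "s < 2" for c s
      using phi[of 2 "const_F c * gen_F s"] scale[of 2 "gen_F s" c] D2[OF that] that
      by (simp add: op_rep_simps FA_closed flip: m_def)
    show ?case
    proof (rule main[OF _ _ _ base])
      fix x assume "lend.B m (2 - 1) False x"
      then obtain c where "x = sc c"
        using lend.B_1[of m 1 False x] by auto
      thus "\<phi> 2 x = 0"
        using phi[of 2 "const_F c * 1"] scale[of 2 1 c] one[of 2] by (simp add: op_rep_simps FA_closed)
    next
      fix p x y assume "lend.B m (2 - 1) p x" "lend.B m (2 - 1) p y"
      then obtain c d where cd: "x = (if p then sc c * Sop else sc c)" "y = (if p then sc d * Sop else sc d)"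
        using lend.B_1[of m 1 p x] lend.B_1[of m 1 p y] by auto
      have sd: "v * sc d = sc d * v" for v
        by (rule sc_commute[symmetric])
      have "x * hop m (2 - 1) * y = sc (c * d) * (if p then Sop * hop m 1 * Sop else hop m 1)"
        unfolding cd by (cases p) (simp_all add: sc_mult sd mult.assoc, metis mult.assoc sd)
      thus "\<phi> 2 (x * hop m (2 - 1) * y) = 0"
        using gen[of 0 "c * d"] gen[of 1 "c * d"] Sop_hop_Sop[of m] by (cases p) simp_all
    qed simp
  next
    case (step n)
    have n2: "2 \<le> n" "3 \<le> Suc n" "2 \<le> Suc n"
      using step.hyps by auto
    \<comment> \<open>Cyclicity moves \<open>g\<close> to the front, so that the Markov rule applies
      to \<open>g * f\<close>.\<close>
    have even: "\<phi> (Suc n) (x * hop m n * y) = 0" if xy: "lend.B m n False x" "lend.B m n False y" for x y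
    proof -
      obtain f g where f: "f \<in> FA n" "x = op_rep q f" and g: "g \<in> FA n" "y = op_rep q g"
        using rep[OF n2(1)] xy by blast
      have fg: "f \<in> FA (Suc n)" "g \<in> FA (Suc n)" "gen_F n \<in> FA (Suc n)" "g * f \<in> FA n"
        using f g by (auto intro: FA_mono FA_closed)
      have "\<phi> (Suc n) (x * hop m n * y) = D (Suc n) (f * gen_F n * g)"
        using phi[OF n2(3), of "f * gen_F n * g"] fg
        by (simp add: f(2) g(2) op_rep_simps FA_closed flip: m_def)
      also have "\<dots> = D (Suc n) (g * (f * gen_F n))"
        using fg n2 by (intro trace FA_closed(6)) auto
      also have "\<dots> = \<mu> * D n (g * f)"
        using markov[OF n2(2), of "g * f"] fg by (simp add: mult.assoc)
      also have "D n (g * f) = 0"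
        using step.IH[of "y * x"] lend.B_mult[OF xy(2,1), of False] phi[OF n2(1) fg(4)]
        by (simp add: f(2) g(2) op_rep_simps)
      finally show ?thesis
        by simp
    qed
    show ?case
    proof (rule main[OF n2(3) _ _ step.prems])
      fix x assume x: "lend.B m (Suc n - 1) False x"
      then obtain f where f: "f \<in> FA n" "x = op_rep q f"
        using rep[OF n2(1)] by auto
      have "\<phi> (Suc n) x = D (Suc n) f"
        using phi[OF n2(3), of f] FA_mono[OF f(1), of "Suc n"] by (simp add: f(2))
      also have "\<dots> = \<rho> * \<phi> n x"
        using embed[OF n2(2), of f] phi[OF n2(1) f(1)] f by simp
      finally show "\<phi> (Suc n) x = 0"
        using step.IH x by simp
    next
      fix p x y assume x: "lend.B m (Suc n - 1) p x" and y: "lend.B m (Suc n - 1) p y"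
      show "\<phi> (Suc n) (x * hop m (Suc n - 1) * y) = 0"
      proof (cases p)
        case False
        thus ?thesis
          using even x y by simp
      next
        case True
        \<comment> \<open>Two odd factors become even by splitting off \<open>Sop\<close>, which
          commutes with \<open>hop m n\<close> for \<open>n \<ge> 2\<close>.\<close>
        have "x * hop m n * y = x * (Sop * hop m n * Sop) * y"
          using lend.S_t[OF n2(1), of m] by (simp add: mult.assoc Sop_Sop)
        also have "\<dots> = (x * Sop) * hop m n * (Sop * y)"
          by (simp add: mult.assoc)
        finally have eq: "x * hop m n * y = (x * Sop) * hop m n * (Sop * y)" .
        have S: "lend.B m n True Sop"
          using n2(1) by (intro lend.B_S) simp
        have "lend.B m n False (x * Sop)" "lend.B m n False (Sop * y)"
          using lend.B_mult[OF _ S, of True x False] lend.B_mult[OF S, of True y False] x y True by simp_all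
        thus ?thesis
          using even eq by simp
      qed
    qed
  qed
  moreover have "lend.B m n False (op_rep q f)"
    unfolding op_rep_def m_def by (rule lend_B_ev[OF _ n f]) (simp add: fhom_def)
  ultimately show ?thesis
    using phi[OF n f] n by simp
qed

section \<open>The element \<open>\<delta>\<close> and the pairing\<close>

lemma even_prod_hom:
  assumes "\<And>x y. F (x + y) = F x + F y" "\<And>x y. F (x * y) = F x * F y" "F 1 = 1" "F 0 = 0"
  shows "F (even_prod y a \<xi> n) = even_prod (F y) (F a) (\<lambda>i. F (\<xi> i)) n \<and>
    F (odd_prod y a \<xi> n) = odd_prod (F y) (F a) (\<lambda>i. F (\<xi> i)) n"
  by (induction n) (simp_all add: even_prod_Suc odd_prod_Suc assms)

lemma even_prod_FA:
  assumes "y \<in> FA n" "a \<in> FA n" "\<And>i. 1 \<le> i \<Longrightarrow> i \<le> k \<Longrightarrow> \<xi> i \<in> FA n"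
  shows "even_prod y a \<xi> k \<in> FA n \<and> odd_prod y a \<xi> k \<in> FA n"
  using assms(3)
proof (induction k)
  case (Suc k)
  have x: "\<xi> (Suc k) \<in> FA n"
    using Suc.prems by simp
  have e: "even_prod y a \<xi> k \<in> FA n" and o: "odd_prod y a \<xi> k \<in> FA n"
    using Suc by simp_all
  show ?case
    unfolding even_prod_Suc odd_prod_Suc by (intro conjI FA_closed(2,3,6) x e o assms(1,2))
qed (simp add: FA_closed)

text \<open>\<open>hecke_bar\<close> is defined through coordinates. The basis element for
  \<open>w\<close> goes to the product of the inverse generators along a reduced word of
  \<open>w\<close>, so on operators the bar is a semilinear homomorphism inverting the generators.
  It respects the relations because \<open>bar q = inverse q\<close>.\<close>

lemma hecke_bar_class:
  fixes q :: "'k::field"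
  assumes bar: "fhom bar" "bar q = inverse q" and q: "q \<noteq> 0" and n: "2 \<le> n" and f: "f \<in> FA n"
  shows "\<exists>g\<in>FA n. hecke_bar bar q n (hecke_class q n f) = hecke_class q n g \<and>
    op_rep q g = ev bar (hw (uop (q - inverse q))) f"
proof -
  define m where "m = q - inverse q"
  define c where "c = hecke_coords q n (T_basis q n) (hecke_class q n f)"
  define F where "F u = wprod (inv_F q) (rev (rw n (- u)))" for u
  define g where "g = (\<Sum>u\<in>parabolic n. const_F (bar (c (cox_class n u))) * F u)"
  have F: "T_inv_basis q n (W_inv (cox_class n u)) = hecke_class q n (F u) \<and> F u \<in> FA n"
    if "u \<in> parabolic n" for u
    unfolding W_inv_eq F_def by (rule T_inv_basis_class[OF q n parabolic_uminus[OF that]])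
  have "hecke_bar bar q n (hecke_class q n f) = hecke_class q n g"
    unfolding hecke_bar_def c_def[symmetric] g_def
    by (rule hecke_comb_class[where B = "\<lambda>w. T_inv_basis q n (W_inv w)" and F = F, OF n F])
  moreover have gFA: "g \<in> FA n"
    unfolding g_def using F by (intro sum_FA FA_closed(6) FA_closed(7)) blast
  moreover have "op_rep q g = ev bar (hw (uop m)) f"
  proof -
    define E where "E = ev bar (hw (uop m))"
    have E: "E (f + g) = E f + E g" "E (f - g) = E f - E g" "E (f * g) = E f * E g"
      "E (const_F d) = sc (bar d)" "E (gen_F s) = uop m s" for f g d s
      unfolding E_def
      by (rule ev_add[OF bar(1)] ev_diff[OF bar(1)] ev_mult[OF bar(1) hw_add] ev_gen_const[OF bar(1)]; simp)+
    have E1: "E 1 = 1" and E0: "E 0 = 0"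
      using E(4)[of 1] E(4)[of 0] by (simp_all add: const_F_simps fhom_simps[OF bar(1)])
    have Esum: "E (\<Sum>u\<in>A. g u) = (\<Sum>u\<in>A. E (g u))" for g and A :: "cox set"
      by (induction A rule: infinite_finite_induct) (simp_all add: E E0)
    have Ew: "E (wprod gen_F x) = uword m x" for x
      by (induction x) (simp_all add: E E1)
    have "hecke_gens (bar q - inverse (bar q)) n (uop m)"
      using hecke_gens_uop[of m n] by (simp add: bar(2) m_def)
    from ev_ideal(1)[OF bar(1) q this T_coords[OF q n f]]
    have "E (f - (\<Sum>u\<in>parabolic n. const_F (c (cox_class n u)) * wprod gen_F (rw n u))) = 0"
      by (simp only: E_def c_def)
    hence "E f = (\<Sum>u\<in>parabolic n. sc (bar (c (cox_class n u))) * uword m (rw n u))"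
      by (simp add: E Esum Ew)
    also have "\<dots> = (\<Sum>u\<in>parabolic n. sc (bar (c (cox_class n u))) * uword m (rev (rw n (- u))))"
    proof (rule sum.cong[OF refl])
      fix u assume u: "u \<in> parabolic n"
      have "uword m (rw n u) = uword m (rev (rw n (- u)))"
        using rw[OF u] rw[OF parabolic_uminus[OF u]]
        by (intro uword_cong) (simp_all add: cw_rev reduced_rev)
      thus "sc (bar (c (cox_class n u))) * uword m (rw n u) =
        sc (bar (c (cox_class n u))) * uword m (rev (rw n (- u)))"
        by simp
    qed
    also have "\<dots> = op_rep q g"
      unfolding g_def F_def op_rep_sum by (simp add: op_rep_simps op_rep_inv_word m_def)
    finally show ?thesis
      by (simp add: E_def)
  qed
  ultimately show ?thesis
    unfolding m_def by blast
qed

text \<open>A reversed reduced word is a reduced word of the inverse element, so the coordinate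
  definition amounts to evaluation in reversed order.\<close>

lemma hecke_anti_class:
  fixes q :: "'k::field"
  assumes q: "q \<noteq> 0" and n: "2 \<le> n" and f: "f \<in> FA n"
  shows "\<exists>g\<in>FA n. hecke_anti q n (hecke_class q n f) = hecke_class q n g \<and>
    op_rep q g = ev (\<lambda>c. c) (hw_rev (hop (q - inverse q))) f"
proof -
  define m where "m = q - inverse q"
  define c where "c = hecke_coords q n (T_basis q n) (hecke_class q n f)"
  define F :: "cox \<Rightarrow> (word \<Rightarrow>\<^sub>0 'k)" where "F u = wprod gen_F (rw n (- u))" for u
  define g where "g = (\<Sum>u\<in>parabolic n. const_F (c (cox_class n u)) * F u)"
  have F: "T_basis q n (W_inv (cox_class n u)) = hecke_class q n (F u) \<and> F u \<in> FA n"
    if "u \<in> parabolic n" for u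
    unfolding W_inv_eq F_def by (rule T_basis_class[OF parabolic_uminus[OF that]])
  have "hecke_anti q n (hecke_class q n f) = hecke_class q n g"
    unfolding hecke_anti_def c_def[symmetric] g_def
    by (rule hecke_comb_class[where B = "\<lambda>w. T_basis q n (W_inv w)" and F = F, OF n F])
  moreover have gFA: "g \<in> FA n"
    unfolding g_def using F by (intro sum_FA FA_closed(6) FA_closed(7)) blast
  moreover have "op_rep q g = ev (\<lambda>c. c) (hw_rev (hop m)) f"
  proof -
    define E :: "(word \<Rightarrow>\<^sub>0 'k) \<Rightarrow> 'k lend" where "E = ev (\<lambda>c. c) (hw_rev (hop m))"
    have E: "E (f + g) = E f + E g" "E (f - g) = E f - E g" "E (f * g) = E g * E f"
      "E (const_F d) = sc d" "E (gen_F s) = hop m s" for f g d s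
      unfolding E_def
      by (rule ev_add[OF fhom_id] ev_diff[OF fhom_id] ev_mult_rev[OF fhom_id hw_rev_add]
          ev_gen_const[OF fhom_id]; simp)+
    have E1: "E 1 = 1" and E0: "E 0 = 0"
      using E(4)[of 1] E(4)[of 0] by (simp_all add: const_F_simps)
    have Esum: "E (\<Sum>u\<in>A. g u) = (\<Sum>u\<in>A. E (g u))" for g and A :: "cox set"
      by (induction A rule: infinite_finite_induct) (simp_all add: E E0)
    have Ew: "E (wprod gen_F x) = wprod (hop m) (rev x)" for x
      by (induction x) (simp_all add: E E1)
    have "ev (\<lambda>c. c) (hw_rev (hop m)) (f - (\<Sum>u\<in>parabolic n. const_F (c (cox_class n u)) * wprod gen_F (rw n u))) = 0"
      by (rule ev_ideal(2)[OF fhom_id q _ T_coords[OF q n f, folded c_def]])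
         (simp add: hecke_gens_hop m_def)
    hence "E f = (\<Sum>u\<in>parabolic n. wprod (hop m) (rev (rw n u)) * sc (c (cox_class n u)))"
      unfolding E_def[symmetric] by (simp add: E Esum Ew)
    also have "\<dots> = (\<Sum>u\<in>parabolic n. sc (c (cox_class n u)) * wprod (hop m) (rw n (- u)))"
    proof (rule sum.cong[OF refl])
      fix u assume u: "u \<in> parabolic n"
      have "wprod gen_F (rev (rw n u)) - wprod gen_F (rw n (- u)) \<in> hecke_ideal q n"
        using rw[OF u] rw[OF parabolic_uminus[OF u]]
        by (intro wprod_cong[OF cong_gens_gen[OF q]]) (simp_all add: cw_rev reduced_rev)
      from op_rep_ideal[OF q this] have "wprod (hop m) (rev (rw n u)) = wprod (hop m) (rw n (- u))"
        by (simp add: op_rep_simps op_rep_wprod m_def)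
      thus "wprod (hop m) (rev (rw n u)) * sc (c (cox_class n u)) =
        sc (c (cox_class n u)) * wprod (hop m) (rw n (- u))"
        by (simp add: sc_commute)
    qed
    also have "\<dots> = op_rep q g"
      unfolding g_def F_def op_rep_sum by (simp add: op_rep_simps op_rep_wprod m_def)
    finally show ?thesis
      by (simp add: E_def)
  qed
  ultimately show ?thesis
    unfolding m_def by blast
qed

text \<open>Each j_i, written in inverse generators, contributes \<open>Sop * lend.Lam m i\<close>.
  As \<open>Sop\<close> commutes with every \<open>lend.Lam m i\<close>, these factors cancel in the
  even part and leave one \<open>Sop\<close> in the odd part.\<close>

lemma anti_even_prod:
  fixes q :: "'k::field"
  defines "m \<equiv> q - inverse q"
  defines "E \<equiv> ev (\<lambda>c. c) (hw_rev (hop m))"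
  shows "E (even_prod (const_F y) (const_F a) (\<lambda>i. wprod (inv_F q) (jw i)) n) = lend_tau.Pl m y a n \<and>
    E (odd_prod (const_F y) (const_F a) (\<lambda>i. wprod (inv_F q) (jw i)) n) = Sop * lend_tau.Ql m y a n"
proof -
  have E: "E (f + g) = E f + E g" "E (f - g) = E f - E g" "E (f * g) = E g * E f"
    "E (const_F d) = sc d" "E (gen_F s) = hop m s" for f g d s
    unfolding E_def
    by (rule ev_add[OF fhom_id] ev_diff[OF fhom_id] ev_mult_rev[OF fhom_id hw_rev_add]
        ev_gen_const[OF fhom_id]; simp)+
  have E1: "E 1 = 1" and E0: "E 0 = 0"
    using E(4)[of 1] E(4)[of 0] by (simp_all add: const_F_simps)
  have Ei: "E (inv_F q s) = uop m s" for s
    unfolding inv_F_def E by (simp add: hop_def m_def)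
  have Ew: "E (wprod (inv_F q) x) = uword m (rev x)" for x
    by (induction x) (simp_all add: E E1 Ei)
  show ?thesis
  proof (induction n)
    case (Suc n)
    define l P Q where "l = lend.Lam m (Suc n)" and "P = lend_tau.Pl m y a n" and "Q = lend_tau.Ql m y a n"
    have x: "E (wprod (inv_F q) (jw (Suc n))) = Sop * l"
      unfolding Ew l_def using uword_jw[of "Suc n" m] by simp
    have IH: "E (even_prod (const_F y) (const_F a) (\<lambda>i. wprod (inv_F q) (jw i)) n) = P"
      "E (odd_prod (const_F y) (const_F a) (\<lambda>i. wprod (inv_F q) (jw i)) n) = Sop * Q"
      using Suc by (simp_all add: P_def Q_def)
    have B: "lend.B m n False P" "lend.B m n True Q"
      using lend_tau.B_PQl[of m n y a] by (simp_all add: P_def Q_def)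
    have lP: "l * P = P * l" and lQ: "l * Q = Q * l"
      unfolding l_def by (rule lend.Lam_B_commute[OF B(1)] lend.Lam_B_commute[OF B(2)]; simp)+
    have lS: "l * Sop = Sop * l"
      unfolding l_def by (rule lend.Lam_S) simp
    have lP': "l * (P * v) = P * (l * v)" and lQ': "l * (Q * v) = Q * (l * v)"
      and lS': "l * (Sop * v) = Sop * (l * v)" for v
      using lP lQ lS by (metis mult.assoc)+
    have S: "Sop * (Sop * v) = v" for v :: "'k lend"
      by (simp add: Sop_Sop flip: mult.assoc)
    have c: "v * sc d = sc d * v" "v * (sc d * w) = sc d * (v * w)" if "v \<in> {P, Q, l, Sop}" for v w d
      by (metis mult.assoc sc_commute)+
    have c': "P * sc d = sc d * P" "P * (sc d * w) = sc d * (P * w)" "Q * sc d = sc d * Q"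
      "Q * (sc d * w) = sc d * (Q * w)" "l * sc d = sc d * l" "l * (sc d * w) = sc d * (l * w)"
      "Sop * sc d = sc d * Sop" "Sop * (sc d * w) = sc d * (Sop * w)" for w d
      using c[of P] c[of Q] c[of l] c[of Sop] by simp_all
    show ?case
      unfolding even_prod_Suc odd_prod_Suc lend_tau.PQl_Suc E E1 IH x l_def[symmetric] P_def[symmetric] Q_def[symmetric]
      by (simp add: distrib_left distrib_right mult.assoc lP lQ lS lP' lQ' lS' S c')
  qed (simp add: E1 E0)
qed

section \<open>Multivariate polynomials at commuting operators, and the class of delta\<close>

definition mp_mono :: "nat \<Rightarrow> (nat \<Rightarrow> 'b::ring_1) \<Rightarrow> (nat \<Rightarrow>\<^sub>0 nat) \<Rightarrow> 'b" where
  "mp_mono n x e = prod_list (map (\<lambda>i. x i ^ Poly_Mapping.lookup e i) [1..<Suc n])"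

definition mp_op :: "nat \<Rightarrow> (nat \<Rightarrow> 'k::field lend) \<Rightarrow> 'k mpoly \<Rightarrow> 'k lend" where
  "mp_op n x p = (\<Sum>e\<in>Poly_Mapping.keys p. sc (Poly_Mapping.lookup p e) * mp_mono n x e)"

lemma mp_op_add: "mp_op n x (p + r) = mp_op n x p + mp_op n x r"
  unfolding mp_op_def by (rule setsum_keys_plus_distrib) (simp_all add: sc_add distrib_right)

lemma mp_op_zero [simp]: "mp_op n x 0 = 0"
  by (simp add: mp_op_def)

lemma mp_op_single: "mp_op n x (Poly_Mapping.single e c) = sc c * mp_mono n x e"
  by (simp add: mp_op_def)

lemma power_commute: "x * z = z * x \<Longrightarrow> x ^ k * z = z * (x ^ k :: 'b::monoid_mult)"
  by (induction k) (simp_all add: mult.assoc, metis mult.assoc)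

lemma mp_mono_add:
  assumes "\<And>i j. x i * x j = x j * x i"
  shows "mp_mono n x (e + f) = mp_mono n x e * mp_mono n x f"
proof (induction n)
  case (Suc n)
  have p: "x i ^ k * x j ^ l = x j ^ l * x i ^ k" for i j k l
    by (rule power_commute[OF power_commute[OF assms, symmetric, of _ _ _], symmetric] power_commute) (rule power_commute[symmetric], rule assms)
  have "x i ^ k * mp_mono j x f = mp_mono j x f * x i ^ k" for i k j
  proof (induction j)
    case (Suc j)
    have s: "mp_mono (Suc j) x f = mp_mono j x f * x (Suc j) ^ Poly_Mapping.lookup f (Suc j)"
      by (simp add: mp_mono_def)
    show ?case
      unfolding s using Suc p by (metis mult.assoc)
  qed (simp add: mp_mono_def)
  note c = this
  have s: "mp_mono (Suc n) x g = mp_mono n x g * x (Suc n) ^ Poly_Mapping.lookup g (Suc n)" for g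
    by (simp add: mp_mono_def)
  show ?case
    unfolding s lookup_add power_add Suc using c[of "Suc n" "Poly_Mapping.lookup e (Suc n)" n]
    by (metis mult.assoc)
qed (simp add: mp_mono_def)

lemma mp_op_mult:
  assumes "\<And>i j. x i * x j = x j * x i"
  shows "mp_op n x (p * r) = mp_op n x p * mp_op n x r"
proof (induction p rule: poly_mapping_add_induct)
  case (2 e c)
  show ?case
  proof (induction r rule: poly_mapping_add_induct)
    case (2 f d)
    have "sc c * mp_mono n x e * (sc d * mp_mono n x f) = sc c * sc d * (mp_mono n x e * mp_mono n x f)"
      by (metis mult.assoc sc_commute)
    thus ?case
      by (simp add: mult_single mp_op_single mp_mono_add[OF assms] sc_mult)
  qed (simp_all add: mp_op_add distrib_left)
qed (simp_all add: mp_op_add distrib_right)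

lemma mp_mono_zero: "mp_mono n x 0 = 1"
  by (induction n) (simp_all add: mp_mono_def)

lemma mp_op_const: "mp_op n x (mp_const c) = sc c"
  by (simp add: mp_const_def mp_op_single mp_mono_zero)

lemma mp_op_var:
  assumes "1 \<le> i" "i \<le> n"
  shows "mp_op n x (mp_var i) = x i"
proof -
  have "mp_mono k x (Poly_Mapping.single i 1) = (if i \<le> k then x i else 1)" for k
  proof (induction k)
    case 0
    show ?case
      using assms by (simp add: mp_mono_def)
  next
    case (Suc k)
    have "mp_mono (Suc k) x (Poly_Mapping.single i 1) =
      mp_mono k x (Poly_Mapping.single i 1) * x (Suc k) ^ Poly_Mapping.lookup (Poly_Mapping.single i 1) (Suc k)"
      by (simp add: mp_mono_def)
    thus ?case
      using Suc by (cases "i = Suc k") (auto simp: lookup_single when_def)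
  qed
  thus ?thesis
    using assms by (simp add: mp_var_def mp_op_single)
qed

definition P_part :: "('r \<Rightarrow> 'r) \<Rightarrow> 'r \<Rightarrow> nat \<Rightarrow> 'r \<Rightarrow> 'r::field mpoly" where
  "P_part bar a k y =
     (\<Prod>i\<in>{1..k}. 1 + mp_const (bar y) * mp_var i + mp_const (inverse a) * mp_var i ^ 2)"

lemma mp_op_P:
  assumes "\<And>i j. x i * x j = x j * x i" "k \<le> n"
  shows "mp_op n x (P_part bar a k y) = full_prod (sc (bar y)) (sc (inverse a)) x k"
  using assms(2)
proof (induction k)
  case 0
  have "mp_op n x 1 = 1"
    using mp_op_const[of n x 1] by (simp add: mp_const_def)
  thus ?case
    by (simp add: P_part_def)
next
  case (Suc k)
  have one: "mp_op n x 1 = 1"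
    using mp_op_const[of n x 1] by (simp add: mp_const_def)
  have "P_part bar a (Suc k) y = P_part bar a k y *
    (1 + mp_const (bar y) * mp_var (Suc k) + mp_const (inverse a) * (mp_var (Suc k) * mp_var (Suc k)))"
    by (simp add: P_part_def power2_eq_square)
  thus ?case
    using Suc mp_op_var[of "Suc k" n x] by (simp add: mp_op_mult[OF assms(1)] mp_op_add mp_op_const one full_prod_Suc)
qed

text \<open>Ensures that the total degree is visible to \<open>mp_mono\<close>, which multiplies
  only over the indices from 1 to \<open>n\<close>.\<close>

lemma P_part_keys:
  assumes "e \<in> Poly_Mapping.keys (P_part bar a k y)"
  shows "Poly_Mapping.keys e \<subseteq> {1..k}"
proof -
  define vars_in where "vars_in A p \<longleftrightarrow> (\<forall>e\<in>Poly_Mapping.keys p. Poly_Mapping.keys e \<subseteq> A)"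
    for A :: "nat set" and p :: "'a mpoly"
  have add: "vars_in A (p + r)" if "vars_in A p" "vars_in A r" for A p r
    using that keys_add[of p r] unfolding vars_in_def by blast
  have mult: "vars_in A (p * r)" if "vars_in A p" "vars_in A r" for A p r
    unfolding vars_in_def
  proof
    fix e assume "e \<in> Poly_Mapping.keys (p * r)"
    then obtain f g where "f \<in> Poly_Mapping.keys p" "g \<in> Poly_Mapping.keys r" "e = f + g"
      using keys_mult[of p r] by blast
    thus "Poly_Mapping.keys e \<subseteq> A"
      using that keys_add[of f g] unfolding vars_in_def by blast
  qed
  have const: "vars_in A (mp_const c)" for A c
    by (auto simp: vars_in_def mp_const_def split: if_splits)
  have one: "vars_in A 1" for A
    using const[of A 1] by (simp add: mp_const_def)
  have var: "vars_in A (mp_var i)" if "i \<in> A" for A i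
    using that by (auto simp: vars_in_def mp_var_def)
  have "vars_in {1..k} (P_part bar a j y)" if "j \<le> k" for j
    using that
  proof (induction j)
    case (Suc j)
    have "P_part bar a (Suc j) y = P_part bar a j y *
      (1 + mp_const (bar y) * mp_var (Suc j) + mp_const (inverse a) * (mp_var (Suc j) * mp_var (Suc j)))"
      by (simp add: P_part_def power2_eq_square)
    moreover have "vars_in {1..k} (P_part bar a j y *
      (1 + mp_const (bar y) * mp_var (Suc j) + mp_const (inverse a) * (mp_var (Suc j) * mp_var (Suc j))))"
      using Suc by (intro mult add one const var) auto
    ultimately show ?case
      by simp
  qed (simp add: P_part_def one)
  thus ?thesis
    using assms unfolding vars_in_def by blast
qed

lemma mp_mono_neg:
  assumes "Poly_Mapping.keys e \<subseteq> {1..n}"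
  shows "mp_mono n (\<lambda>i. - x i) e = (if even (total_degree e) then mp_mono n x e else - mp_mono n x e)"
proof -
  have *: "mp_mono k (\<lambda>i. - x i) e =
    (if even (\<Sum>i\<in>{1..k}. Poly_Mapping.lookup e i) then mp_mono k x e else - mp_mono k x e)" for k
  proof (induction k)
    case (Suc k)
    have "mp_mono (Suc k) z e = mp_mono k z e * z (Suc k) ^ Poly_Mapping.lookup e (Suc k)" for z :: "nat \<Rightarrow> 'a"
      by (simp add: mp_mono_def)
    thus ?case
      using Suc by (cases "even (Poly_Mapping.lookup e (Suc k))") simp_all
  qed (simp add: mp_mono_def)
  have "total_degree e = (\<Sum>i\<in>{1..n}. Poly_Mapping.lookup e i)"
    unfolding total_degree_def
    by (rule sum.mono_neutral_left) (use assms in \<open>auto simp: in_keys_iff\<close>)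
  thus ?thesis
    using * by simp
qed

text \<open>Changing the sign of all arguments multiplies a monomial by the sign of its total
  degree. This is the counterpart of \<open>full_prod_parity\<close>, with the sign on the arguments
  in place of \<open>y\<close>.\<close>

lemma mp_op_even_part:
  assumes "\<And>e. e \<in> Poly_Mapping.keys p \<Longrightarrow> Poly_Mapping.keys e \<subseteq> {1..n}"
  shows "mp_op n x (even_part p) + mp_op n x (even_part p) = mp_op n x p + mp_op n (\<lambda>i. - x i) p"
proof -
  have sum: "mp_op n x (\<Sum>e\<in>A. g e) = (\<Sum>e\<in>A. mp_op n x (g e))" for A :: "(nat \<Rightarrow>\<^sub>0 nat) set" and g
    by (induction A rule: infinite_finite_induct) (simp_all add: mp_op_add)
  let ?t = "\<lambda>e. sc (Poly_Mapping.lookup p e) * mp_mono n x e"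
  have ev: "mp_op n x (even_part p) = (\<Sum>e\<in>Poly_Mapping.keys p. if even (total_degree e) then ?t e else 0)"
    unfolding even_part_def sum mp_op_single by (rule sum.mono_neutral_cong_left) auto
  have "mp_op n x p + mp_op n (\<lambda>i. - x i) p =
    (\<Sum>e\<in>Poly_Mapping.keys p. ?t e + sc (Poly_Mapping.lookup p e) * mp_mono n (\<lambda>i. - x i) e)"
    by (simp add: mp_op_def sum.distrib)
  also have "\<dots> = (\<Sum>e\<in>Poly_Mapping.keys p. (if even (total_degree e) then ?t e else 0) +
    (if even (total_degree e) then ?t e else 0))"
    by (rule sum.cong[OF refl]) (simp add: mp_mono_neg[OF assms])
  finally show ?thesis
    by (simp add: ev sum.distrib)
qed

lemma JM_class:
  fixes q :: "'k::field"
  assumes "2 \<le> n" "i \<le> n"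
  shows "JM q n i = hecke_class q n (wprod gen_F (jw i)) \<and> wprod gen_F (jw i) \<in> (FA n :: (word \<Rightarrow>\<^sub>0 'k) set)"
proof (cases "i \<le> 1")
  case True
  thus ?thesis
    by (simp add: JM_def jw_def hecke_class_one FA_closed)
next
  case False
  have "set (JM_word i) \<subseteq> {..<i}"
    using JM_word_set False by simp
  hence "gen_F s \<in> (FA n :: (word \<Rightarrow>\<^sub>0 'k) set)" if "s \<in> set (JM_word i)" for s
    using assms that by (intro FA_closed(8)) auto
  from list_prod_class[where f = gen_F and xs = "JM_word i" and q = q, OF this] show ?thesis
    using False by (simp add: JM_def jw_def gen_def[abs_def] JM_word_def)
qed

text \<open>The two representatives are compared as operators and after doubling: twice the even
  part is P(x; y) + P(-x; y), and P(-x; y) = P(x; -y), so \<open>full_prod_parity\<close>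
  applies.\<close>

lemma delta_class:
  fixes q a y :: "'k::field" and bar :: "'k \<Rightarrow> 'k"
  assumes q: "q \<noteq> 0" and n: "2 \<le> n" and two: "(2 :: 'k) \<noteq> 0"
  defines "f \<equiv> even_prod (const_F (bar y)) (const_F (inverse a)) (\<lambda>i. wprod gen_F (jw i)) n"
  shows "f \<in> FA n \<and> delta bar q a n y = hecke_class q n f"
proof -
  define m where "m = q - inverse q"
  define X :: "nat \<Rightarrow> (word \<Rightarrow>\<^sub>0 'k)" where "X i = wprod gen_F (jw i)" for i
  define p where "p = P_poly bar a n y"
  have JM: "JM q n i = hecke_class q n (X i) \<and> X i \<in> FA n" if "i \<le> n" for i
    unfolding X_def using JM_class[OF n that] by blast
  have f: "f \<in> FA n"
    unfolding f_def by (intro conjunct1[OF even_prod_FA] FA_closed(7)) (use JM in \<open>auto simp: X_def\<close>)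
  interpret R: ring "hecke q n"
    by (rule ring_hecke)
  have pow_FA: "X i ^ k \<in> FA n" if "i \<le> n" for i k
    using JM[OF that] by (induction k) (auto intro: FA_closed)
  have pow: "JM q n i [^]\<^bsub>hecke q n\<^esub> k = hecke_class q n (X i ^ k)" if "i \<le> n" for i k
  proof (induction k)
    case 0
    show ?case
      by (simp add: hecke_class_one)
  next
    case (Suc k)
    have "hecke_class q n (X i ^ k) \<otimes>\<^bsub>hecke q n\<^esub> hecke_class q n (X i) = hecke_class q n (X i ^ k * X i)"
      by (rule hecke_class_ops(2)[OF pow_FA[OF that]]) (use JM[OF that] in blast)
    thus ?case
      using Suc JM[OF that] by (simp add: power_commutes)
  qed
  define g where "g e = mp_mono n X e" for e
  have g: "list_prod (hecke q n) (map (\<lambda>i. JM q n i [^]\<^bsub>hecke q n\<^esub> Poly_Mapping.lookup e i) [1..<n + 1]) =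
      hecke_class q n (g e) \<and> g e \<in> FA n" for e
  proof -
    have "X i ^ Poly_Mapping.lookup e i \<in> FA n" if "i \<in> set [1..<n + 1]" for i
      using that by (intro pow_FA) auto
    note * = list_prod_class[where f = "\<lambda>i. X i ^ Poly_Mapping.lookup e i" and xs = "[1..<n + 1]" and q = q, OF this]
    have "map (\<lambda>i. JM q n i [^]\<^bsub>hecke q n\<^esub> Poly_Mapping.lookup e i) [1..<n + 1] =
      map (\<lambda>i. hecke_class q n (X i ^ Poly_Mapping.lookup e i)) [1..<n + 1]"
      by (rule map_cong[OF refl], rule pow) auto
    moreover have "g e = prod_list (map (\<lambda>i. X i ^ Poly_Mapping.lookup e i) [1..<n + 1])"
      by (simp only: g_def mp_mono_def Suc_eq_plus1)
    ultimately show ?thesis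
      using * by (simp only:)
  qed
  define d where "d = (\<Sum>e\<in>Poly_Mapping.keys (even_part p). const_F (Poly_Mapping.lookup (even_part p) e) * g e)"
  have cg: "const_F c * g e \<in> FA n" for c e
    using g by (intro FA_closed(6) FA_closed(7)) blast
  have d: "d \<in> FA n"
    unfolding d_def by (intro sum_FA cg)
  have "delta bar q a n y = hecke_class q n d"
  proof -
    have "delta bar q a n y = (\<Oplus>\<^bsub>hecke q n\<^esub> e\<in>Poly_Mapping.keys (even_part p).
        hecke_class q n (const_F (Poly_Mapping.lookup (even_part p) e) * g e))"
      unfolding delta_def mp_eval_def p_def[symmetric]
    proof (rule R.finsum_cong')
      show "hecke_scale q n c (list_prod (hecke q n)
          (map (\<lambda>i. JM q n i [^]\<^bsub>hecke q n\<^esub> Poly_Mapping.lookup e i) [1..<n + 1])) =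
          hecke_class q n (const_F c * g e)" for c e
        using g[of e] by (simp only: hecke_scale_class)
    qed (use cg in \<open>auto intro: hecke_class_closed\<close>)
    also have "\<dots> = hecke_class q n d"
      unfolding d_def by (rule finsum_class) (simp_all add: cg)
    finally show ?thesis .
  qed
  moreover have "op_rep q d = op_rep q f"
  proof -
    define x where "x i = wprod (hop m) (jw i)" for i
    have piX: "op_rep q (X i) = x i" for i
      by (simp add: X_def x_def op_rep_wprod op_rep_simps m_def)
    \<comment> \<open>The operators of the j_i commute because their inverses, which are
      \<open>Sop * lend.Lam m i\<close> for \<open>i \<ge> 1\<close>, do.\<close>
    have comm: "x i * x j = x j * x i" for i j
    proof -
      have L: "uword m (rev (jw i)) * uword m (rev (jw j)) = uword m (rev (jw j)) * uword m (rev (jw i))"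
        if "i < j" for i j
      proof (cases "i = 0")
        case False
        have "lend.B m i False (Sop * lend.Lam m i)"
          by (rule lend.B_mult[OF lend.B_S lend.B_Lam]) (use False in auto)
        hence c: "lend.Lam m j * (Sop * lend.Lam m i) = Sop * lend.Lam m i * lend.Lam m j"
          by (rule lend.Lam_B_commute) (rule that)
        have "Sop * lend.Lam m i = lend.Lam m i * Sop"
          using lend.Lam_S[of i m] False by simp
        hence "Sop * (Sop * lend.Lam m i) = Sop * lend.Lam m i * Sop"
          by (metis mult.assoc)
        hence "Sop * lend.Lam m i * (Sop * lend.Lam m j) = Sop * (Sop * lend.Lam m i) * lend.Lam m j"
          by (simp only: mult.assoc)
        also have "\<dots> = Sop * (lend.Lam m j * (Sop * lend.Lam m i))"
          by (simp only: c mult.assoc)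
        finally have "Sop * lend.Lam m i * (Sop * lend.Lam m j) = Sop * lend.Lam m j * (Sop * lend.Lam m i)"
          by (simp only: mult.assoc)
        thus ?thesis
          using uword_jw[of i m] uword_jw[of j m] that False by simp
      qed (simp add: jw_def)
      have inv: "x i * uword m (rev (jw i)) = 1" "uword m (rev (jw i)) * x i = 1" for i
      proof -
        have "wprod (hop m) w * uword m (rev w) = 1 \<and> uword m (rev w) * wprod (hop m) w = 1" for w
        proof (induction w)
          case (Cons s w)
          hence "wprod (hop m) w * (uword m (rev w) * v) = v" for v
            by (metis mult.assoc mult_1_left)
          moreover have "uop m s * (hop m s * v) = v" for v
            by (simp add: hop_uop flip: mult.assoc)
          ultimately show ?case
            using Cons by (simp add: mult.assoc hop_uop)
        qed simp
        thus "x i * uword m (rev (jw i)) = 1" "uword m (rev (jw i)) * x i = 1"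
          by (simp_all add: x_def)
      qed
      define A C where "A = uword m (rev (jw i))" and "C = uword m (rev (jw j))"
      have AC: "A * C = C * A"
        using L[of i j] L[of j i] unfolding A_def C_def by (cases i j rule: linorder_cases) auto
      have "(x i * x j) * (C * A) = 1"
        using inv(1)[of i] inv(1)[of j] unfolding A_def C_def by (metis mult.assoc mult_1_left)
      moreover have "(A * C) * (x j * x i) = 1"
      proof -
        have "C * A * (x i * x j) = 1"
          using inv(2)[of i] inv(2)[of j] unfolding A_def C_def by (metis mult.assoc mult_1_left)
        moreover have "A * C * (x j * x i) = 1"
          unfolding A_def C_def
          using inv(2)[of i] inv(2)[of j] A_def AC C_def by (metis mult.assoc mult_1_left)
        ultimately show ?thesis
          by simp
      qed
      ultimately show ?thesis
        unfolding AC by (rule left_inverse_eq_right)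
    qed
    have pig: "op_rep q (g e) = mp_mono n x e" for e
    proof -
      have "op_rep q (z ^ k) = op_rep q z ^ k" for z k
        by (induction k) (simp_all add: op_rep_simps)
      hence "op_rep q (prod_list (map (\<lambda>i. X i ^ Poly_Mapping.lookup e i) l)) =
        prod_list (map (\<lambda>i. x i ^ Poly_Mapping.lookup e i) l)" for l
        by (induction l) (simp_all add: op_rep_simps piX)
      thus ?thesis
        by (simp only: g_def mp_mono_def Suc_eq_plus1)
    qed
    have dop: "op_rep q d = mp_op n x (even_part p)"
      by (simp add: d_def op_rep_sum op_rep_simps pig mp_op_def)
    have pP: "p = P_part bar a n y"
      by (simp add: p_def P_poly_def P_part_def)
    have neg: "full_prod b c (\<lambda>i. - x i) n = full_prod (- b) c x n" for b c
      by (simp add: full_prod_def)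
    have comm': "- x i * - x j = - x j * - x i" for i j
      using comm[of i j] by simp
    have "op_rep q d + op_rep q d = mp_op n x p + mp_op n (\<lambda>i. - x i) p"
      unfolding dop by (rule mp_op_even_part) (simp only: pP, drule P_part_keys, simp)
    also have "\<dots> = full_prod (sc (bar y)) (sc (inverse a)) x n + full_prod (- sc (bar y)) (sc (inverse a)) x n"
      unfolding pP by (simp add: mp_op_P[OF comm] mp_op_P[OF comm'] neg)
    also have "\<dots> = even_prod (sc (bar y)) (sc (inverse a)) x n + even_prod (sc (bar y)) (sc (inverse a)) x n"
      by (rule full_prod_parity) (rule sc_commute)
    also have "even_prod (sc (bar y)) (sc (inverse a)) x n = op_rep q f"
    proof -
      have "op_rep q f = even_prod (op_rep q (const_F (bar y))) (op_rep q (const_F (inverse a))) (\<lambda>i. op_rep q (wprod gen_F (jw i))) n"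
        unfolding f_def by (rule conjunct1[OF even_prod_hom]) (simp_all add: op_rep_simps)
      thus ?thesis
        using piX by (simp add: op_rep_simps X_def)
    qed
    finally have "op_rep q d + op_rep q d = op_rep q f + op_rep q f" .
    hence "sc (1 / 2) * (op_rep q d + op_rep q d) = sc (1 / 2) * (op_rep q f + op_rep q f)"
      by simp
    hence "sc (1 / 2 + 1 / 2) * op_rep q d = sc (1 / 2 + 1 / 2) * op_rep q f"
      by (simp only: sc_add distrib_left distrib_right)
    thus ?thesis
      using two by simp
  qed
  ultimately show ?thesis
    using f d hecke_class_eq_pi[OF q n d f] by simp
qed

text \<open>The bar turns \<open>bar y\<close>, \<open>inverse a\<close> and the generators into
  \<open>y\<close>, \<open>a\<close> and the inverse generators, and the anti-involution then yields
  \<open>Pl\<close>. The pairing becomes \<open>tau\<close> of a product of operators.\<close>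

lemma hecke_tr_delta:
  fixes q a y :: "'k::field"
  assumes q: "q \<noteq> 0" and n: "2 \<le> n" and two: "(2 :: 'k) \<noteq> 0" and bar: "fhom bar" "bar q = inverse q"
    and inv: "\<And>x. bar (bar x) = x" "bar a = inverse a" and h: "h \<in> FA n"
  shows "hecke_tr bar q n (delta bar q a n y) (hecke_class q n h) =
    tau (lend_tau.Pl (q - inverse q) y a n * op_rep q h)"
proof -
  define m where "m = q - inverse q"
  define f where "f = even_prod (const_F (bar y)) (const_F (inverse a)) (\<lambda>i. wprod gen_F (jw i)) n"
  define g where "g = even_prod (const_F y) (const_F a) (\<lambda>i. wprod (inv_F q) (jw i)) n"
  have f: "f \<in> FA n" "delta bar q a n y = hecke_class q n f"
    using delta_class[OF q n two, of bar y a] by (simp_all add: f_def)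
  have jw: "set (jw i) \<subseteq> {..<n}" if "i \<le> n" for i
  proof (cases "i \<le> 1")
    case False
    hence "set (jw i) \<subseteq> {..<i}"
      using JM_word_set[of i] by (simp add: jw_def)
    also have "{..<i} \<subseteq> {..<n}"
      using that by simp
    finally show ?thesis .
  qed (simp add: jw_def)
  have g: "g \<in> FA n"
    unfolding g_def by (intro conjunct1[OF even_prod_FA] FA_closed(7) wprod_FA inv_F_FA jw)
  obtain f' where f': "f' \<in> FA n" "hecke_bar bar q n (hecke_class q n f) = hecke_class q n f'"
    "op_rep q f' = ev bar (hw (uop m)) f"
    using hecke_bar_class[OF bar q n f(1)] unfolding m_def by blast
  have "ev bar (hw (uop m)) f = op_rep q g"
  proof -
    define E where "E = ev bar (hw (uop m))"
    have E: "E (f + g) = E f + E g" "E (f * g) = E f * E g"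
      "E (const_F d) = sc (bar d)" "E (gen_F s) = uop m s" for f g d s
      unfolding E_def
      by (rule ev_add[OF bar(1)] ev_mult[OF bar(1) hw_add] ev_gen_const[OF bar(1)]; simp)+
    have E1: "E 1 = 1" and E0: "E 0 = 0"
      using E(3)[of 1] E(3)[of 0] by (simp_all add: const_F_simps fhom_simps[OF bar(1)])
    have Ew: "E (wprod gen_F x) = uword m x" for x
      by (induction x) (simp_all add: E E1)
    have "bar (inverse a) = a"
      using fhom_simps(7)[OF bar(1), of a] inv(2) by simp
    moreover have "E f = even_prod (E (const_F (bar y))) (E (const_F (inverse a))) (\<lambda>i. E (wprod gen_F (jw i))) n"
      unfolding f_def by (rule conjunct1[OF even_prod_hom]) (simp_all add: E E1 E0)
    moreover have "op_rep q g = even_prod (op_rep q (const_F y)) (op_rep q (const_F a)) (\<lambda>i. op_rep q (wprod (inv_F q) (jw i))) n"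
      unfolding g_def by (rule conjunct1[OF even_prod_hom]) (simp_all add: op_rep_simps)
    ultimately have "E f = op_rep q g"
      by (simp add: E Ew inv(1) op_rep_simps op_rep_inv_word m_def)
    thus ?thesis
      by (simp only: E_def)
  qed
  hence "hecke_class q n f' = hecke_class q n g"
    using hecke_class_eq_pi[OF q n f'(1) g] f'(3) by simp
  moreover obtain g' where g': "g' \<in> FA n" "hecke_anti q n (hecke_class q n g) = hecke_class q n g'"
    "op_rep q g' = ev (\<lambda>c. c) (hw_rev (hop m)) g"
    using hecke_anti_class[OF q n g] unfolding m_def by blast
  moreover have "ev (\<lambda>c. c) (hw_rev (hop m)) g = lend_tau.Pl m y a n"
    unfolding g_def m_def by (rule conjunct1[OF anti_even_prod])
  ultimately have "hecke_tr bar q n (delta bar q a n y) (hecke_class q n h) =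
    hecke_tau q n (hecke_class q n (g' * h))" "op_rep q (g' * h) = lend_tau.Pl m y a n * op_rep q h"
    unfolding hecke_tr_def hecke_pairing_def f(2) f'(2)
    using hecke_class_ops(2)[OF g'(1) h, of q] by (simp_all add: op_rep_simps)
  thus ?thesis
    using hecke_tau_class[OF q n FA_closed(6)[OF g'(1) h]] by (simp add: m_def)
qed

section \<open>The Markov trace\<close>

lemma scalar_ext_class:
  assumes s: "fhom \<epsilon>" and q: "q \<noteq> 0" and n: "2 \<le> n" and f: "f \<in> FA n"
  defines "m \<equiv> \<epsilon> q - inverse (\<epsilon> q)"
  shows "scalar_ext \<epsilon> q n (hecke_class q n f) = hecke_class (\<epsilon> q) n (Poly_Mapping.map \<epsilon> f)"
    and "Poly_Mapping.map \<epsilon> f \<in> FA n"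
    and "op_rep (\<epsilon> q) (Poly_Mapping.map \<epsilon> f) = ev \<epsilon> (hw (hop m)) f"
proof -
  have look: "Poly_Mapping.lookup (Poly_Mapping.map \<epsilon> g) x = \<epsilon> (Poly_Mapping.lookup g x)" for g :: "word \<Rightarrow>\<^sub>0 'a" and x
    using fhom_simps(1)[OF s] by (simp add: Poly_Mapping.map.rep_eq when_def)
  hence keys: "Poly_Mapping.keys (Poly_Mapping.map \<epsilon> g) = Poly_Mapping.keys g" for g :: "word \<Rightarrow>\<^sub>0 'a"
    using fhom_simps(8)[OF s] by (auto simp: in_keys_iff)
  have FA: "Poly_Mapping.map \<epsilon> g \<in> FA n" if "g \<in> FA n" for g
    using that by (simp add: FA_def keys)
  show "Poly_Mapping.map \<epsilon> f \<in> FA n"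
    by (rule FA[OF f])
  have op_rep_map: "op_rep (\<epsilon> q) (Poly_Mapping.map \<epsilon> g) = ev \<epsilon> (hw (hop m)) g" for g
    by (simp add: op_rep_def ev_def keys look m_def)
  show "op_rep (\<epsilon> q) (Poly_Mapping.map \<epsilon> f) = ev \<epsilon> (hw (hop m)) f"
    by (rule op_rep_map)
  have eq: "\<epsilon> q \<noteq> 0"
    using fhom_simps(8)[OF s] q by simp
  have "hecke_class (\<epsilon> q) n (Poly_Mapping.map \<epsilon> g) = hecke_class (\<epsilon> q) n (Poly_Mapping.map \<epsilon> f)"
    if "g \<in> hecke_class q n f" for g
  proof -
    have I: "g - f \<in> hecke_ideal q n"
      using hecke_class_mem[OF f] that by blast
    hence "(g - f) + f \<in> FA n"
      by (intro FA_closed(3) hecke_ideal_FA f)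
    hence g: "g \<in> FA n"
      by simp
    have "ev \<epsilon> (hw (hop m)) (g - f) = 0"
      by (rule ev_ideal(1)[OF s q _ I]) (simp add: m_def hecke_gens_hop)
    thus ?thesis
      using hecke_class_eq_pi[OF eq n FA[OF g] FA[OF f]] by (simp add: op_rep_map ev_diff[OF s])
  qed
  moreover have "f \<in> hecke_class q n f"
    using hecke_class_mem[OF f, of f q] by (simp add: hecke_ideal_closed)
  ultimately have "(\<lambda>g. hecke_class (\<epsilon> q) n (Poly_Mapping.map \<epsilon> g)) ` hecke_class q n f =
    {hecke_class (\<epsilon> q) n (Poly_Mapping.map \<epsilon> f)}"
    by blast
  thus "scalar_ext \<epsilon> q n (hecke_class q n f) = hecke_class (\<epsilon> q) n (Poly_Mapping.map \<epsilon> f)"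
    by (simp add: scalar_ext_def)
qed

lemma hecke_embed_class:
  assumes q: "q \<noteq> 0" and n: "3 \<le> n" and f: "f \<in> FA (n - 1)"
  shows "hecke_embed q n (hecke_class q (n - 1) f) = hecke_class q n f"
proof -
  have fn: "f \<in> FA n"
    by (rule FA_mono[OF f]) simp
  have "hecke_class q n g = hecke_class q n f" if "g \<in> hecke_class q (n - 1) f" for g
  proof -
    have I: "g - f \<in> hecke_ideal q (n - 1)"
      using hecke_class_mem[OF f] that by blast
    have "g - f \<in> FA n"
      by (rule FA_mono[OF hecke_ideal_FA[OF I]]) simp
    hence g: "g \<in> FA n"
      using FA_closed(3)[OF _ fn, of "g - f"] by simp
    have "op_rep q g = op_rep q f"
      using op_rep_ideal[OF q I] by (simp add: op_rep_simps)
    thus ?thesis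
      using hecke_class_eq_pi[OF q _ g fn] n by simp
  qed
  moreover have "f \<in> hecke_class q (n - 1) f"
    using hecke_class_mem[OF f, of f q] by (simp add: hecke_ideal_closed)
  ultimately have "hecke_class q n ` hecke_class q (n - 1) f = {hecke_class q n f}"
    by blast
  thus ?thesis
    by (simp add: hecke_embed_def)
qed

definition U_F :: "'k::field \<Rightarrow> nat \<Rightarrow> (word \<Rightarrow>\<^sub>0 'k)" where
  "U_F q i = (if i \<le> 1 then 1 else wprod gen_F (rev [2..<i] @ [0]) * wprod (inv_F q) [1..<i])"

text \<open>Rank two is \<open>hop m 0 = Sop * hop m 1 * Sop\<close>; afterwards each new
  \<open>hop m i\<close> passes \<open>Sop\<close>.\<close>

lemma M_word:
  "2 \<le> i \<Longrightarrow> wprod (hop m) (rev [2..<i] @ [0]) * uword m [1..<i] = Sop * lend.M m i"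
proof (induction i rule: dec_induct)
  case base
  have "lend.M m 2 = hop m 1 * Sop * uop m 1"
    by (simp add: numeral_2_eq_2)
  thus ?case
    using Sop_hop_Sop[of m] by (simp add: numeral_2_eq_2 mult.assoc[symmetric])
next
  case (step i)
  have l: "rev [2..<Suc i] @ [0] = i # (rev [2..<i] @ [0])" "[1..<Suc i] = [1..<i] @ [i]"
    using step.hyps by simp_all
  have "wprod (hop m) (rev [2..<Suc i] @ [0]) * uword m [1..<Suc i] =
    hop m i * (wprod (hop m) (rev [2..<i] @ [0]) * uword m [1..<i]) * uop m i"
    unfolding l by (simp add: mult.assoc)
  also have "\<dots> = (hop m i * Sop) * lend.M m i * uop m i"
    unfolding step.IH by (simp add: mult.assoc)
  also have "hop m i * Sop = Sop * hop m i"
    by (rule lend.S_t[OF step.hyps(1), symmetric])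
  finally show ?case
    using step.hyps by (simp add: mult.assoc)
qed

text \<open>\<open>F\<close> is left open because the product is evaluated twice: over \<rat>(v) to
  identify it in the uniqueness argument, and over the extension to compute its trace.\<close>

lemma U_F_eval:
  assumes F: "\<And>f g. F (f * g) = F f * F g" "F 1 = 1" "\<And>s. F (gen_F s) = hop m s" "\<And>s. F (inv_F q s) = uop m s"
  shows "F (wprod (U_F q) [1..<Suc n]) = lend.V m n"
proof -
  have w: "F (wprod g x) = wprod (\<lambda>s. F (g s)) x" for g x
    by (induction x) (simp_all add: F)
  have U: "F (U_F q i) = Sop * lend.M m i" if "1 \<le> i" for i
  proof (cases "i = 1")
    case True
    thus ?thesis
      by (simp add: U_F_def F Sop_Sop)
  next
    case False
    thus ?thesis
      using M_word[of i m] that by (simp add: U_F_def F w uword_def mult.assoc)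
  qed
  show ?thesis
    unfolding w lend.V_def by (rule arg_cong[where f = prod_list], rule map_cong) (auto intro: U)
qed

lemma U_prod_class:
  fixes q :: "'k::field"
  assumes q: "q \<noteq> 0" and n: "2 \<le> n"
  shows "U_prod q n = hecke_class q n (wprod (U_F q) [1..<Suc n]) \<and> wprod (U_F q) [1..<Suc n] \<in> FA n"
proof -
  have inv: "inv_gen q n s = hecke_class q n (inv_F q s)" if "s < n" for s
    unfolding inv_gen_def gen_def
    by (rule inv_class) (use that wprod_inverse[OF q n, of "[s]"] in \<open>simp_all add: FA_closed inv_F_FA\<close>)
  have U: "U_elt q n i = hecke_class q n (U_F q i) \<and> U_F q i \<in> FA n" if "i \<le> n" for i
  proof (cases "i \<le> 1")
    case True
    thus ?thesis
      by (simp add: U_elt_def U_F_def hecke_class_one FA_closed)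
  next
    case False
    define xs where "xs = map (Pair True) (rev [2..<i] @ [0]) @ map (Pair False) [1..<i]"
    define G where "G = (\<lambda>(b, s). if b then gen_F s else inv_F q s)"
    have b: "snd p < n" if "p \<in> set xs" for p
      using that \<open>i \<le> n\<close> False by (auto simp: xs_def)
    have G: "G p \<in> FA n" if "p \<in> set xs" for p
      using b[OF that] by (auto simp: G_def split_def intro!: FA_closed(8) inv_F_FA)
    have m: "map (gen q n) (rev [2..<i] @ [0]) @ map (inv_gen q n) [1..<i] = map (\<lambda>p. hecke_class q n (G p)) xs"
      using that inv by (simp add: xs_def G_def gen_def)
    have "prod_list (map G xs) = U_F q i"
      using False by (simp add: xs_def G_def U_F_def comp_def mult.assoc)
    thus ?thesis
      using list_prod_class[where f = G and xs = xs and q = q, OF G] False m by (simp add: U_elt_def)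
  qed
  have FA: "U_F q i \<in> FA n" if "i \<in> set [1..<Suc n]" for i
  proof -
    have "i \<le> n"
      using that by auto
    thus ?thesis
      using U by blast
  qed
  have "map (U_elt q n) [1..<n + 1] = map (\<lambda>i. hecke_class q n (U_F q i)) [1..<Suc n]"
    using U by (intro map_cong) auto
  thus ?thesis
    unfolding U_prod_def using list_prod_class[where f = "U_F q" and xs = "[1..<Suc n]" and q = q, OF FA]
    by (simp only:)
qed

lemma v_A_facts: "v_A \<noteq> 0" "bar_A v_A = inverse v_A"
proof -
  show "v_A \<noteq> 0"
    by (simp add: v_A_def)
  have "to_fract [:1 :: rat:] = 1"
    by (metis one_pCons to_fract_1)
  hence "eval_at_inv_v [:0, 1:] = inverse v_A" "eval_at_inv_v 1 = 1"
    by (simp_all add: eval_at_inv_v_def map_poly_pCons one_pCons flip: one_poly_def)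
  thus "bar_A v_A = inverse v_A"
    by (simp add: bar_A_def v_A_def)
qed

text \<open>2 and 1 + a are images of nonzero elements under an injective map. The first is inverted
  to isolate the even part, the second makes the uniqueness argument work in rank two.\<close>

lemma coefficient_extension_facts:
  fixes ext :: "ratfun poly fract \<Rightarrow> 'r::field"
  assumes "coefficient_extension ext bar"
  shows "fhom (ext_A ext)" "fhom bar" "bar (bar x) = x" "bar (ext_a ext) = inverse (ext_a ext)"
    "bar (ext_A ext v_A) = inverse (ext_A ext v_A)" "(2 :: 'r) \<noteq> 0" "1 + ext_a ext \<noteq> 0"
proof -
  have ext: "fhom ext"
    using assms by (auto simp: coefficient_extension_def fhom_def)
  have c: "[:f * g:] = [:f:] * [:g:]" "[:f + g:] = [:f:] + [:g:]" for f g :: ratfun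
    by simp_all
  show A: "fhom (ext_A ext)"
    unfolding fhom_def ext_A_def c to_fract_mult to_fract_add
    using fhom_simps[OF ext] by (simp flip: one_pCons)
  show "fhom bar" "bar (bar x) = x" "bar (ext_a ext) = inverse (ext_a ext)"
    using assms by (auto simp: coefficient_extension_def fhom_def)
  have "bar (ext_A ext v_A) = ext_A ext (inverse v_A)"
    using assms v_A_facts(2) by (simp add: coefficient_extension_def)
  thus "bar (ext_A ext v_A) = inverse (ext_A ext v_A)"
    using fhom_simps(7)[OF A] by simp
  have "(2 :: 'r) = ext_A ext (1 + 1)"
    by (simp only: fhom_simps(2,3)[OF A], simp only: one_add_one)
  moreover have "(1 + 1 :: ratfun) \<noteq> 0"
  proof -
    have "(1 + 1 :: ratfun) = to_fract (1 + 1)"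
      by (simp only: to_fract_add to_fract_1)
    thus ?thesis
      by simp
  qed
  ultimately show "(2 :: 'r) \<noteq> 0"
    using fhom_simps(8)[OF A] by metis
  have "1 + ext_a ext = ext (to_fract 1 + to_fract [:0, 1:])"
    using fhom_simps(2,3)[OF ext] by (simp add: ext_a_def)
  also have "to_fract 1 + to_fract [:0, 1 :: ratfun:] = to_fract (1 + [:0, 1:])"
    by simp
  finally have "1 + ext_a ext = ext (to_fract (1 + [:0, 1:]))" .
  moreover have "to_fract (1 + [:0, 1 :: ratfun:]) \<noteq> 0"
    unfolding to_fract_eq_0_iff by (simp add: one_pCons)
  ultimately show "1 + ext_a ext \<noteq> 0"
    using fhom_simps(8)[OF ext] by metis
qed

theorem corollary3p2p5:
  fixes ext :: "ratfun poly fract \<Rightarrow> 'r::field"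
    and bar :: "'r \<Rightarrow> 'r"
    and y :: 'r
    and tr :: "nat \<Rightarrow> (word \<Rightarrow>\<^sub>0 ratfun) set \<Rightarrow> 'r"
    and n :: nat
    and h :: "(word \<Rightarrow>\<^sub>0 ratfun) set"
  assumes "coefficient_extension ext bar"
    and "markov_trace (ext_A ext) (1 + ext_a ext) (ext_A ext (v_A - inverse v_A)) tr"
    and "\<forall>k\<ge>2. tr k \<one>\<^bsub>hecke v_A k\<^esub> = (1 + ext_a ext) ^ k"
    and "\<forall>m\<ge>1. tr (2 * m) (U_prod v_A (2 * m)) = y ^ (2 * m)"
    and "n \<ge> 2"
    and "h \<in> carrier (hecke v_A n)"
  shows "tr n h =
    hecke_tr bar (ext_A ext v_A) n
      (delta bar (ext_A ext v_A) (ext_a ext) n y)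
      (scalar_ext (ext_A ext) v_A n h)"
proof -
  define \<epsilon> a q m where "\<epsilon> = ext_A ext" and "a = ext_a ext" and "q = \<epsilon> v_A" and "m = q - inverse q"
  note facts = coefficient_extension_facts[OF assms(1), folded \<epsilon>_def a_def, folded q_def]
  note eps = facts(1)
  have q: "q \<noteq> 0"
    unfolding q_def using fhom_simps(8)[OF eps] v_A_facts(1) by simp
  have m: "m = \<epsilon> (v_A - inverse v_A)"
    by (simp add: m_def q_def fhom_simps[OF eps])
  \<comment> \<open>\<open>E\<close> evaluates words over \<rat>(v) directly as operators over the
    extension, so that both traces become functions on the same free algebra.\<close>
  define E where "E = ev \<epsilon> (hw (hop m))"
  have E: "E (f + g) = E f + E g" "E (f - g) = E f - E g" "E (f * g) = E f * E g"
    "E (const_F d) = sc (\<epsilon> d)" "E (gen_F s) = hop m s" for f g d s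
    unfolding E_def
    by (rule ev_add[OF eps] ev_diff[OF eps] ev_mult[OF eps hw_add] ev_gen_const[OF eps]; simp)+
  have E1: "E 1 = 1"
    using E(4)[of 1] by (simp add: const_F_simps fhom_simps[OF eps])
  have Ei: "E (inv_F v_A s) = uop m s" for s
    unfolding inv_F_def E m[symmetric] by (simp add: hop_def)
  have EB: "lend.B m k False (E f)" if "2 \<le> k" "f \<in> FA k" for k f
    unfolding E_def by (rule lend_B_ev[OF eps that])
  define P where "P = lend_tau.Pl m y a"
  have PB: "lend.B m k False (P k)" for k
    unfolding P_def using lend_tau.B_PQl by blast
  have central: "P k * x = x * P k" if "lend.B m k False x" for k x
    unfolding P_def by (rule lend_tau.Pl_central[OF facts(6) that])
  have mt: "A_linear_functional \<epsilon> k (tr k)"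
    "\<And>h h'. h \<in> carrier (hecke v_A k) \<Longrightarrow> h' \<in> carrier (hecke v_A k) \<Longrightarrow>
      tr k (h \<otimes>\<^bsub>hecke v_A k\<^esub> h') = tr k (h' \<otimes>\<^bsub>hecke v_A k\<^esub> h)" if "2 \<le> k" for k
    using assms(2) that unfolding markov_trace_def \<epsilon>_def by blast+
  have mk: "tr k (hecke_embed v_A k h) = (1 + a) * tr (k - 1) h"
    "tr k (hecke_embed v_A k h \<otimes>\<^bsub>hecke v_A k\<^esub> gen v_A k (k - 1)) = m * tr (k - 1) h"
    if "3 \<le> k" "h \<in> carrier (hecke v_A (k - 1))" for k h
    using assms(2) that unfolding markov_trace_def \<epsilon>_def[symmetric] a_def[symmetric] m[symmetric] by blast+
  define T where "T k f = tr k (hecke_class v_A k f)" for k f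
  \<comment> \<open>By \<open>hecke_tr_delta\<close> this is the trace of delta on representatives.
    What remains is that it has the same constants and prescribed values as
    \<open>T\<close>.\<close>
  define R where "R k f = tau (P k * E f)" for k f
  have T_add: "T k (f + g) = T k f + T k g" if "2 \<le> k" "f \<in> FA k" "g \<in> FA k" for k f g
    using mt(1)[OF that(1)] hecke_class_closed[OF that(2), of v_A] hecke_class_closed[OF that(3), of v_A]
      hecke_class_ops(1)[OF that(2,3), of v_A]
    unfolding A_linear_functional_def T_def by metis
  have T_scale: "T k (const_F c * f) = \<epsilon> c * T k f" if "2 \<le> k" "f \<in> FA k" for k f c
    using mt(1)[OF that(1)] hecke_class_closed[OF that(2), of v_A] hecke_scale_class[OF that(2), of v_A c]
    unfolding A_linear_functional_def T_def by metis
  have "T n f - R n f = 0" if "f \<in> FA n" for f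
  proof (rule markov_trace_zero[where D = "\<lambda>k f. T k f - R k f" and q = v_A and \<rho> = "1 + a" and \<mu> = m
        and \<epsilon> = \<epsilon> and VF = "\<lambda>k. wprod (U_F v_A) [1..<Suc k]"])
    show "v_A \<noteq> 0" "1 + a \<noteq> 0" "2 \<le> n" "f \<in> FA n"
      using v_A_facts facts assms(5) that by simp_all
  next
    fix k f assume k: "2 \<le> k" and f: "f \<in> hecke_ideal v_A k"
    have fFA: "f \<in> FA k"
      by (rule hecke_ideal_FA[OF f])
    have "hecke_class v_A k f = hecke_class v_A k 0"
      using hecke_class_eq_iff[OF fFA FA_closed(1)] f by simp
    moreover have "T k 0 = 0"
      using T_scale[OF k FA_closed(1), of 0] fhom_simps(1)[OF eps] by simp
    moreover have "E f = 0"
      unfolding E_def by (rule ev_ideal(1)[OF eps v_A_facts(1) _ f]) (simp add: hecke_gens_hop m_def q_def)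
    ultimately show "T k f - R k f = 0"
      by (simp add: T_def R_def)
  next
    fix k and f g :: "word \<Rightarrow>\<^sub>0 ratfun"
    assume k: "2 \<le> k" and f: "f \<in> FA k" and g: "g \<in> FA k"
    show "T k (f + g) - R k (f + g) = (T k f - R k f) + (T k g - R k g)"
      by (simp add: T_add[OF k f g] R_def E distrib_left)
    \<comment> \<open>The trace property of \<open>tau\<close> combined with the centrality of
      \<open>P k\<close>.\<close>
    have "R k (f * g) = R k (g * f)"
    proof -
      have "R k (f * g) = tau ((P k * E f) * E g)"
        by (simp add: R_def E mult.assoc)
      also have "\<dots> = tau (E g * (P k * E f))"
        by (rule lend_tau.tau_trace[OF lend.B_mult[OF PB EB[OF k f]] EB[OF k g]]) simp
      also have "\<dots> = tau (P k * (E g * E f))"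
        using central[OF EB[OF k g]] by (simp flip: mult.assoc)
      finally show ?thesis
        by (simp add: R_def E)
    qed
    moreover have "T k (f * g) = T k (g * f)"
      unfolding T_def
      using mt(2)[OF k hecke_class_closed[OF f] hecke_class_closed[OF g]]
        hecke_class_ops(2)[OF f g, of v_A] hecke_class_ops(2)[OF g f, of v_A] by simp
    ultimately show "T k (f * g) - R k (f * g) = T k (g * f) - R k (g * f)"
      by simp
  next
    fix k f c assume k: "2 \<le> k" and f: "f \<in> (FA k :: (word \<Rightarrow>\<^sub>0 ratfun) set)"
    have "P k * (sc (\<epsilon> c) * E f) = sc (\<epsilon> c) * (P k * E f)"
      by (metis mult.assoc sc_commute)
    thus "T k (const_F c * f) - R k (const_F c * f) = \<epsilon> c * (T k f - R k f)"
      by (simp add: T_scale[OF k f] R_def E right_diff_distrib)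
  next
    fix k f assume k: "3 \<le> k" and f: "f \<in> (FA (k - 1) :: (word \<Rightarrow>\<^sub>0 ratfun) set)"
    have k': "2 \<le> k - 1" "Suc (k - 1) = k" "k - 1 < k"
      using k by auto
    have fk: "f \<in> FA k"
      by (rule FA_mono[OF f]) simp
    note emb = hecke_embed_class[OF v_A_facts(1) k f]
    note mk' = mk[OF k hecke_class_closed[OF f], unfolded emb]
    have EfB: "lend.B m (k - 1) False (E f)"
      by (rule EB[OF k'(1) f])
    have "R k f = (1 + a) * R (k - 1) f"
      using lend_tau.tau_Pl_embed[OF EfB, of y a] k'(2) by (simp add: R_def P_def)
    thus "T k f - R k f = (1 + a) * (T (k - 1) f - R (k - 1) f)"
      using mk'(1) by (simp add: T_def right_diff_distrib)
    have "R k (f * gen_F (k - 1)) = m * R (k - 1) f"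
      using lend_tau.tau_Pl_gen[OF _ EfB, of y a] k' by (simp add: R_def P_def E mult.assoc)
    moreover have "T k (f * gen_F (k - 1)) = m * T (k - 1) f"
      using mk'(2) hecke_class_ops(2)[OF fk FA_closed(8)[OF k'(3)], of v_A] by (simp add: T_def gen_def)
    ultimately show "T k (f * gen_F (k - 1)) - R k (f * gen_F (k - 1)) = m * (T (k - 1) f - R (k - 1) f)"
      by (simp add: right_diff_distrib)
  next
    fix k :: nat assume k: "2 \<le> k"
    have "T k 1 = (1 + a) ^ k"
      using assms(3) k by (simp add: T_def a_def hecke_class_one)
    moreover have "R k 1 = (1 + a) ^ k"
      by (simp add: R_def E1 P_def lend_tau.tau_Pl)
    ultimately show "T k 1 - R k 1 = 0"
      by simp
  next
    fix k :: nat assume k: "2 \<le> k" "even k"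
    note U = U_prod_class[OF v_A_facts(1) k(1)]
    have "op_rep v_A (wprod (U_F v_A) [1..<Suc k]) = lend.V (v_A - inverse v_A) k"
      by (rule U_F_eval) (simp_all add: op_rep_simps)
    moreover have "R k (wprod (U_F v_A) [1..<Suc k]) = y ^ k"
    proof -
      have "E (wprod (U_F v_A) [1..<Suc k]) = lend.V m k"
        by (rule U_F_eval) (simp_all add: E E1 Ei)
      thus ?thesis
        using lend_tau.tau_Pl_V[of k m y a] k by (simp add: R_def P_def)
    qed
    moreover have "T k (wprod (U_F v_A) [1..<Suc k]) = y ^ k"
    proof -
      obtain j where "k = 2 * j"
        using k(2) by blast
      hence "tr k (U_prod v_A k) = y ^ k"
        using assms(4) k(1) by simp
      thus ?thesis
        using U by (simp add: T_def)
    qed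
    ultimately show "wprod (U_F v_A) [1..<Suc k] \<in> FA k \<and>
      op_rep v_A (wprod (U_F v_A) [1..<Suc k]) = lend.V (v_A - inverse v_A) k \<and>
      T k (wprod (U_F v_A) [1..<Suc k]) - R k (wprod (U_F v_A) [1..<Suc k]) = 0"
      using U by simp
  qed
  moreover obtain f where f: "f \<in> FA n" "h = hecke_class v_A n f"
    using hecke_carrier[OF assms(6)] by blast
  ultimately have "tr n h = R n f"
    by (simp add: T_def)
  also have "\<dots> = hecke_tr bar q n (delta bar q a n y) (scalar_ext \<epsilon> v_A n h)"
    unfolding f(2) scalar_ext_class(1)[OF eps v_A_facts(1) assms(5) f(1)] q_def[symmetric]
    using hecke_tr_delta[OF q assms(5) facts(6,2,5,3,4) scalar_ext_class(2)[OF eps v_A_facts(1) assms(5) f(1)], of y]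
      scalar_ext_class(3)[OF eps v_A_facts(1) assms(5) f(1)]
    by (simp add: R_def P_def E_def m_def q_def)
  finally show ?thesis
    by (simp only: q_def a_def \<epsilon>_def)
qed

end
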